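(* Consider solving the LQR problem described in the context by the derivative-free iteration in which every infinite-horizon cost $\mathcal J(K;x_0)$ used in the (one-point or two-point) gradient estimate is replaced by the finite-horizon cost $\mathcal J_\delta(K;x_0)=\sum_{t=0}^{T_\delta-1}c_t(x_t,u_t)$ with $u_t=-Kx_t$; i.e. the iteration is $K_{s+1}=K_s-\eta G(K_s)+\eta E_s$, $K_0\in\mathcal K_{st}$, where $E_s$ is the difference between the estimate $G(K_s)$ computed with $\mathcal J$ and the one computed with $\mathcal J_\delta$. Let $\theta_0=\min\{1/(2\phi_0),\rho_0/\lambda_0\}$, let $\epsilon>0$ satisfy $\epsilon\log(120\Delta_0/\epsilon)<12\Delta_0$, let $$\delta=\min\Big\{\frac{\mu\theta_0}{16}\sqrt{\frac{\epsilon}{15}},\ \frac12\sqrt{\frac{\mu\epsilon}{30}}\Big\},\qquad T_s=\frac4{\eta\mu}\log\Big(\frac{120\Delta_0}{\epsilon}\Big),$$ and suppose that: - in the one-point setting, $$\eta\le\min\Big\{\frac{\mu r^2\epsilon}{480\phi_0[20C_m\mathcal J(K_0)d]^2},\frac1{4\phi_0},\frac{\rho_0r}{20C_m\mathcal J(K_0)d+\delta r}\Big\},\quad r\le\min\Big\{\frac{\mu\theta_0}{16\phi_0}\sqrt{\frac{\epsilon}{15}},\frac1{4\phi_0}\sqrt{\frac{\mu\epsilon}{15}},\rho_0,\frac{10\mathcal J(K_0)}{\lambda_0}\Big\};$$ - in the two-point setting, $$\eta\le\min\Big\{\frac{\mu\epsilon}{480\phi_0d\lambda_0^2},\frac1{4\phi_0},\frac{\rho_0}{d\lambda_0+\delta}\Big\},\quad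 r\le\min\Big\{\frac{\mu\theta_0}{16\phi_0}\sqrt{\frac{\epsilon}{15}},\frac1{4\phi_0}\sqrt{\frac{\mu\epsilon}{15}},\rho_0\Big\}.$$ Suppose that the rollout length $T_\delta$ satisfies (for the sampled initial states $x_0$) $$T_\delta\ge\frac1{2(1-\gamma)}\max\Big\{\log\Big[\frac{16\sqrt{15}\,M\beta d\Vert x_0\Vert_2^2}{(1-\gamma^2)r\mu\theta_0\sqrt\epsilon}\Big],\ \log\Big[\frac{2\sqrt{30}\,M\beta d\Vert x_0\Vert_2^2}{(1-\gamma^2)r\sqrt{\mu\epsilon}}\Big]\Big\},$$ where $\beta=\max_{K\in\mathcal G^0}\Vert Q+K^\top RK\Vert_2$ and $\gamma\in(0,1)$, $M>0$ are constants such that, for all $K\in\mathcal G^0$, the closed-loop trajectories $x_{t+1}=(A-BK)x_t$ satisfy $\Vert x_t\Vert_2^2\le M\gamma^{2t}\Vert x_0\Vert_2^2$ for all $t\ge0$. Then, in either setting, $\mathcal J(K_{T_s})-\mathcal J(K^* )<\epsilon$ with probability at least $3/4$.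
   Context: **LQR problem.** Consider $x_{t+1}=Ax_t+Bu_t$, $x_t\in\mathbb R^n$, $u_t\in\mathbb R^m$, $x_0\sim\mathcal D$, with stage cost $c_t(x_t,u_t)=x_t^\top Qx_t+u_t^\top Ru_t$. Standing assumptions: $(A,B)$ is stabilizable, $Q$ is symmetric positive semidefinite, $R$ is symmetric positive definite, $(A,Q^{1/2})$ is detectable; for $v\sim\mathcal D$, $\mathbb E[v]=0$, $\mathbb E[vv^\top]=I_n$ and $\Vert v\Vert_2^2\le C_m$ almost surely, $C_m>0$ a constant. Let $\mathcal K_{st}=\{K\in\mathbb R^{m\times n}:\rho(A-BK)<1\}$ ($\rho$ = spectral radius). For $K\in\mathcal K_{st}$ and $u_t=-Kx_t$, let $\mathcal J(K;x_0)=\sum_{t\ge0}c_t(x_t,u_t)=x_0^\top P_Kx_0$, where $P_K=Q+K^\top RK+(A-BK)^\top P_K(A-BK)$, and $\mathcal J(K)=\mathbb E_{x_0\sim\mathcal D}[\mathcal J(K;x_0)]=\mathrm{Tr}(P_K)$. If $K\notin\mathcal K_{st}$, $\mathcal J(K)=+\infty$. $K^*$ is the unique minimizer of $\mathcal J$ over $\mathcal K_{st}$. $\Vert\cdot\Vert_F$ is the Frobenius norm, $\Vert\cdot\Vert_2$ the Euclidean/spectral norm. **Gradient estimates.** Let $d=mn$, $r>0$ (smoothing radius), and let $D$ be uniformly distributed on $\{D\in\mathbb R^{m\times n}:\Vert D\Vert_F=1\}$. One-point: $G^1_r(K,D;x_0)=\mathcal J(K+rD;x_0)\frac drD$. Two-point: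 $G^2_r(K,D;x_0)=[\mathcal J(K+rD;x_0)-\mathcal J(K-rD;x_0)]\frac d{2r}D$. **Algorithm.** Given $K_0\in\mathcal K_{st}$, stepsize $\eta>0$, radius $r>0$: at each iteration $s=0,1,\dots,T_s-1$, draw a fresh $x_0^{(s)}\sim\mathcal D$ and a fresh uniform direction $D_s$ (independent of each other and of the past), let $G(K_s)$ be the one-point or two-point estimate at $(K_s,D_s;x_0^{(s)})$, and set $K_{s+1}=K_s-\eta G(K_s)+\eta E_s$, where $E_s\in\mathbb R^{m\times n}$ is a perturbation. Once a cost value in this recursion is infinite, later iterates may be assigned by any measurable convention. The iteration number $T_s$ and rollout length $T_\delta\ge1$ are understood to be positive integers. **Constants.** $\Delta_0=\mathcal J(K_0)-\mathcal J(K^* )$ and $\mathcal G^0=\{K:\mathcal J(K)-\mathcal J(K^* )\le10\Delta_0\}$. For each $K\in\mathcal K_{st}$, fix positive scalars $\lambda_K,\widetilde\lambda_K,\zeta_K,\phi_K,\beta_K$ (known to exist) such that: if $\Vert K'-K\Vert_F\le\zeta_K$ then $|\mathcal J(K')-\mathcal J(K)|\le\lambda_K\Vert K'-K\Vert_F$ and $|\mathcal J(K';x_0)-\mathcal J(K;x_0)|\le\widetilde\lambda_K\Vert K'-K\Vert_F$; if $\Vert K'-K\Vert_F\le\beta_K$ then $\Vert\nabla\mathcal J(K')-\nabla\mathcal J(K)\Vert_F\le\phi_K\Vert K'-K\Vert_F$. Let $\mu>0$ be a constant (known to exist) with $\mu(\mathcal J(K)-\mathcal J(K^* ))\le\Vert\nabla\mathcal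 J(K)\Vert_F^2$ for all $K\in\mathcal K_{st}$. Put $\phi_0=\sup_{K\in\mathcal G^0}\phi_K$, $\lambda_0=\sup_{K\in\mathcal G^0}\lambda_K$, $\rho_0=\inf_{K\in\mathcal G^0}\min\{\beta_K,\zeta_K\}$; the scalars are chosen so that $\phi_0,\lambda_0<\infty$ and $\rho_0>0$. Let $g_\infty=\sup_{K\in\mathcal G^0}\Vert G(K)\Vert_F$ (supremum also over almost all realizations of $D,x_0$) and $g_2=\sup_{K\in\mathcal G^0}\mathbb E[\Vert G(K)-\mathbb E[G(K)\mid K]\Vert_F^2]$. The constants are those from the literature, for which the following known bounds hold and may be used: for the one-point estimate, if $r\le\min\{10\mathcal J(K_0)/\lambda_0,\rho_0\}$ then $g_2\le[20C_m\mathcal J(K_0)d/r]^2$ and $g_\infty\le20C_m\mathcal J(K_0)d/r$; for the two-point estimate, if $r\le\rho_0$ then $g_2\le d\lambda_0^2$ and $g_\infty\le d\lambda_0$. *)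

theory Defs
  imports "HOL-Probability.Probability"
begin

text \<open>
  States live in \<open>real^'n\<close>, inputs in \<open>real^'m\<close>, feedback gains in \<open>real^'n^'m\<close>. On
  \<open>real^'n^'m\<close> the library's \<^const>\<open>norm\<close> and \<^const>\<open>inner\<close> are the Frobenius norm and the
  Frobenius inner product; \<open>onorm ((*v) M)\<close> is the spectral norm of \<open>M\<close>.
\<close>

definition symmetric_psd :: "real^'n^'n \<Rightarrow> bool" where
  "symmetric_psd S \<longleftrightarrow> transpose S = S \<and> (\<forall>x. 0 \<le> x \<bullet> (S *v x))"

definition symmetric_pd :: "real^'n^'n \<Rightarrow> bool" where
  "symmetric_pd S \<longleftrightarrow> transpose S = S \<and> (\<forall>x. x \<noteq> 0 \<longrightarrow> 0 < x \<bullet> (S *v x))"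

definition psd_sqrt :: "real^'n^'n \<Rightarrow> real^'n^'n" where
  "psd_sqrt S = (THE T. symmetric_psd T \<and> T ** T = S)"

definition complex_spectrum :: "real^'n^'n \<Rightarrow> complex set" where
  "complex_spectrum M =
     {z. \<exists>v::complex^'n. v \<noteq> 0 \<and> (\<chi> i j. complex_of_real (M $ i $ j)) *v v = z *s v}"

definition spectral_radius :: "real^'n^'n \<Rightarrow> real" where
  "spectral_radius M = Max (cmod ` complex_spectrum M)"

definition stabilizing :: "real^'n^'n \<Rightarrow> real^'m^'n \<Rightarrow> (real^'n^'m) set" where
  "stabilizing A B = {K. spectral_radius (A - B ** K) < 1}"

definition stabilizable :: "real^'n^'n \<Rightarrow> real^'m^'n \<Rightarrow> bool" where
  "stabilizable A B \<longleftrightarrow> (\<exists>K. spectral_radius (A - B ** K) < 1)"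

definition detectable :: "real^'n^'n \<Rightarrow> real^'n^'p \<Rightarrow> bool" where
  "detectable A C \<longleftrightarrow> (\<exists>L. spectral_radius (A - L ** C) < 1)"

primrec lqr_state ::
    "real^'n^'n \<Rightarrow> real^'m^'n \<Rightarrow> real^'n^'m \<Rightarrow> real^'n \<Rightarrow> nat \<Rightarrow> real^'n" where
  "lqr_state A B K x0 0 = x0"
| "lqr_state A B K x0 (Suc t) =
     A *v lqr_state A B K x0 t + B *v (- (K *v lqr_state A B K x0 t))"

definition stage_cost ::
    "real^'n^'n \<Rightarrow> real^'m^'m \<Rightarrow> real^'n \<Rightarrow> real^'m \<Rightarrow> real" where
  "stage_cost Q R x u = x \<bullet> (Q *v x) + u \<bullet> (R *v u)"

definition lqr_stage ::
    "real^'n^'n \<Rightarrow> real^'m^'n \<Rightarrow> real^'n^'n \<Rightarrow> real^'m^'m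
      \<Rightarrow> real^'n^'m \<Rightarrow> real^'n \<Rightarrow> nat \<Rightarrow> real" where
  "lqr_stage A B Q R K x0 t =
     stage_cost Q R (lqr_state A B K x0 t) (- (K *v lqr_state A B K x0 t))"

text \<open>
  \<open>lqr_cost_from\<close> is \<open>J(K; x0)\<close>, \<open>lqr_cost_horizon\<close> is its truncation to the first \<open>N\<close>
  stages, and \<open>lqr_cost\<close> is \<open>J(K)\<close>. The series has nonnegative terms, so in \<^typ>\<open>ereal\<close> it
  always has a value, which is infinite when the series diverges.
\<close>

definition lqr_cost_from ::
    "real^'n^'n \<Rightarrow> real^'m^'n \<Rightarrow> real^'n^'n \<Rightarrow> real^'m^'m
      \<Rightarrow> real^'n^'m \<Rightarrow> real^'n \<Rightarrow> ereal" where
  "lqr_cost_from A B Q R K x0 = (\<Sum>t. ereal (lqr_stage A B Q R K x0 t))"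

definition lqr_cost_horizon ::
    "real^'n^'n \<Rightarrow> real^'m^'n \<Rightarrow> real^'n^'n \<Rightarrow> real^'m^'m \<Rightarrow> nat
      \<Rightarrow> real^'n^'m \<Rightarrow> real^'n \<Rightarrow> real" where
  "lqr_cost_horizon A B Q R N K x0 = (\<Sum>t<N. lqr_stage A B Q R K x0 t)"

definition lqr_cost ::
    "real^'n^'n \<Rightarrow> real^'m^'n \<Rightarrow> real^'n^'n \<Rightarrow> real^'m^'m \<Rightarrow> (real^'n) measure
      \<Rightarrow> real^'n^'m \<Rightarrow> ereal" where
  "lqr_cost A B Q R Dist K =
     (if K \<in> stabilizing A B
      then ereal (\<integral>x0. real_of_ereal (lqr_cost_from A B Q R K x0) \<partial>Dist)
      else \<infinity>)"

definition gradient :: "('a::real_inner \<Rightarrow> real) \<Rightarrow> 'a \<Rightarrow> 'a" where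
  "gradient f x = (THE g. GDERIV f x :> g)"

text \<open>
  The uniform distribution on the Euclidean unit sphere, as the radial projection of the
  uniform distribution on the unit ball (\<open>sgn x\<close> is \<open>x /\<^sub>R norm x\<close>): a Borel set \<open>S\<close> of
  directions gets the normalised volume of the cone over \<open>S\<close>, which for the Euclidean norm is
  its normalised surface measure. The lemmas below show that this is a probability measure
  carried by the unit sphere and invariant under every orthogonal transformation, properties
  that determine it.
\<close>

definition sphere_uniform :: "'a::euclidean_space measure" where
  "sphere_uniform = distr (uniform_measure lborel (cball 0 1)) borel sgn"

lemma lborel_orthogonal:
  fixes f :: "'a::euclidean_space \<Rightarrow> 'a"
  assumes f: "orthogonal_transformation f"
  shows "distr lborel borel f = lborel"
proof (rule measure_eqI)
  show "sets (distr lborel borel f) = sets (lborel :: 'a measure)" by simp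
  fix A :: "'a set" assume "A \<in> sets (distr lborel borel f)"
  then have A [measurable]: "A \<in> sets borel" by simp
  have lin: "linear f" using f by (simp add: orthogonal_transformation_linear)
  have fm [measurable]: "f \<in> borel_measurable borel"
    using lin by (intro borel_measurable_continuous_onI linear_continuous_on)
      (simp add: linear_conv_bounded_linear)
  have inj: "inj f" and surj: "surj f"
    using f by (auto simp: orthogonal_transformation_inj orthogonal_transformation_surj)
  have pull: "f -` cball 0 1 = cball 0 1"
    using f by (auto simp: orthogonal_transformation_norm)
  define B :: "'a set" where "B = cball 0 1"
  have B [measurable]: "B \<in> sets borel" by (simp add: B_def)
  let ?I = "indicator :: 'a set \<Rightarrow> 'a \<Rightarrow> ennreal"
  have sh: "(\<integral>\<^sup>+x. g (c + x) \<partial>lborel) = (\<integral>\<^sup>+x. g x \<partial>lborel)"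
    if [measurable]: "g \<in> borel_measurable borel" for g :: "'a \<Rightarrow> ennreal" and c
  proof -
    have "(\<integral>\<^sup>+x. g x \<partial>lborel) = (\<integral>\<^sup>+x. g x \<partial>distr lborel borel ((+) c))"
      by (simp add: lborel_distr_plus)
    also have "\<dots> = (\<integral>\<^sup>+x. g (c + x) \<partial>lborel)" by (subst nn_integral_distr) auto
    finally show ?thesis by simp
  qed
  have refl: "(\<integral>\<^sup>+x. g (c - x) \<partial>lborel) = (\<integral>\<^sup>+x. g x \<partial>lborel)"
    if [measurable]: "g \<in> borel_measurable borel" for g :: "'a \<Rightarrow> ennreal" and c
  proof -
    have "lborel = distr lborel borel (\<lambda>x::'a. c - x)"
      using lborel_affine[of "-1" c] by (simp add: density_1)
    then have "(\<integral>\<^sup>+x. g x \<partial>lborel) = (\<integral>\<^sup>+x. g x \<partial>distr lborel borel (\<lambda>x::'a. c - x))" by simp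
    also have "\<dots> = (\<integral>\<^sup>+x. g (c - x) \<partial>lborel)" by (subst nn_integral_distr) auto
    finally show ?thesis by simp
  qed
  have "emeasure lborel (f -` A) * emeasure lborel B
      = (\<integral>\<^sup>+x. (\<integral>\<^sup>+y. ?I A (f x) * ?I B y \<partial>lborel) \<partial>lborel)"
  proof -
    have [measurable]: "f -` A \<in> sets borel" using measurable_sets[OF fm A] by simp
    show ?thesis
      by (simp add: nn_integral_cmult nn_integral_multc flip: indicator_vimage)
  qed
  also have "\<dots> = (\<integral>\<^sup>+x. (\<integral>\<^sup>+y. ?I A (f x) * ?I B (f x + y) \<partial>lborel) \<partial>lborel)"
    by (intro nn_integral_cong sh[symmetric]) measurable
  also have "\<dots> = (\<integral>\<^sup>+y. (\<integral>\<^sup>+x. ?I A (f x) * ?I B (f x + y) \<partial>lborel) \<partial>lborel)"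
    by (rule lborel_pair.Fubini'[symmetric]) measurable
  also have "\<dots> = (\<integral>\<^sup>+y. (\<integral>\<^sup>+x. ?I A (f x - y) * ?I B (f x) \<partial>lborel) \<partial>lborel)"
  proof (rule nn_integral_cong)
    fix y :: 'a
    obtain z where z: "f z = y" using surj by (metis surjD)
    show "(\<integral>\<^sup>+x. ?I A (f x) * ?I B (f x + y) \<partial>lborel)
        = (\<integral>\<^sup>+x. ?I A (f x - y) * ?I B (f x) \<partial>lborel)"
      using sh[of "\<lambda>x. ?I A (f x - y) * ?I B (f x)" z]
      by (simp add: linear_add[OF lin] z add.commute)
  qed
  also have "\<dots> = (\<integral>\<^sup>+x. (\<integral>\<^sup>+y. ?I A (f x - y) * ?I B (f x) \<partial>lborel) \<partial>lborel)"
    by (rule lborel_pair.Fubini') measurable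
  also have "\<dots> = (\<integral>\<^sup>+x. emeasure lborel A * ?I B (f x) \<partial>lborel)"
    by (rule nn_integral_cong) (simp add: nn_integral_multc refl[of "?I A"])
  also have "\<dots> = emeasure lborel A * emeasure lborel B"
  proof -
    have e: "(\<lambda>x. ?I B (f x)) = ?I B" using pull by (auto simp: B_def indicator_def fun_eq_iff)
    show ?thesis by (subst nn_integral_cmult) (simp_all add: e)
  qed
  finally have *: "emeasure lborel (f -` A) * emeasure lborel B = emeasure lborel A * emeasure lborel B" .
  have "emeasure lborel B \<noteq> 0" "emeasure lborel B \<noteq> \<infinity>"
    by (auto simp: B_def emeasure_cball unit_ball_vol_pos less_imp_neq[symmetric])
  with * have "emeasure lborel (f -` A) = emeasure lborel A"
    by (metis ennreal_mult_cancel_left infinity_ennreal_def mult.commute top.not_eq_extremum)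
  then show "emeasure (distr lborel borel f) A = emeasure lborel A"
    by (simp add: emeasure_distr)
qed

lemma unit_cball_emeasure:
  "emeasure lborel (cball (0::'a::euclidean_space) 1) \<noteq> 0"
  "emeasure lborel (cball (0::'a::euclidean_space) 1) \<noteq> \<infinity>"
  by (auto simp: emeasure_cball unit_ball_vol_pos less_imp_neq[symmetric])

lemma sgn_borel [measurable]: "(sgn :: 'a::euclidean_space \<Rightarrow> 'a) \<in> borel_measurable borel"
  unfolding sgn_div_norm[abs_def] by measurable

lemma prob_space_sphere_uniform: "prob_space (sphere_uniform :: 'a::euclidean_space measure)"
  unfolding sphere_uniform_def
  by (intro prob_space.prob_space_distr prob_space_uniform_measure unit_cball_emeasure) simp

lemma AE_sphere_uniform: "AE D in sphere_uniform. norm (D::'a::euclidean_space) = 1"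
proof -
  have "AE x in lborel. x \<noteq> (0::'a)" by (rule AE_lborel_singleton)
  then have "AE x in uniform_measure lborel (cball 0 1). norm (sgn x :: 'a) = 1"
    by (intro AE_uniform_measureI) (auto simp: norm_sgn)
  then show ?thesis unfolding sphere_uniform_def by (subst AE_distr_iff) simp_all
qed

lemma sphere_uniform_orthogonal:
  fixes f :: "'a::euclidean_space \<Rightarrow> 'a"
  assumes f: "orthogonal_transformation f"
  shows "distr sphere_uniform borel f = sphere_uniform"
proof -
  let ?B = "cball (0::'a) 1"
  have lin: "linear f" using f by (simp add: orthogonal_transformation_linear)
  have fm [measurable]: "f \<in> borel_measurable borel"
    using lin by (intro borel_measurable_continuous_onI linear_continuous_on)
      (simp add: linear_conv_bounded_linear)
  have fs: "f (sgn x) = sgn (f x)" for x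
    by (simp add: sgn_div_norm linear_scale[OF lin] orthogonal_transformation_norm[OF f])
  have u: "distr (uniform_measure lborel ?B) borel f = uniform_measure lborel ?B"
  proof (rule measure_eqI)
    fix S assume "S \<in> sets (distr (uniform_measure lborel ?B) borel f)"
    then have S [measurable]: "S \<in> sets borel" by simp
    have "f -` S \<in> sets borel" using measurable_sets[OF fm S] by simp
    moreover have "?B \<inter> f -` S = f -` (?B \<inter> S)"
      by (auto simp: orthogonal_transformation_norm[OF f])
    moreover have "emeasure lborel (f -` (?B \<inter> S)) = emeasure lborel (?B \<inter> S)"
      using arg_cong[OF lborel_orthogonal[OF f], of "\<lambda>M. emeasure M (?B \<inter> S)"]
      by (simp add: emeasure_distr)
    ultimately show "emeasure (distr (uniform_measure lborel ?B) borel f) S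
        = emeasure (uniform_measure lborel ?B) S"
      by (simp add: emeasure_distr)
  qed simp
  have "distr sphere_uniform borel f = distr (distr (uniform_measure lborel ?B) borel f) borel sgn"
    by (simp add: sphere_uniform_def distr_distr o_def fs)
  then show ?thesis by (simp add: u sphere_uniform_def)
qed

datatype estimator = OnePoint | TwoPoint

text \<open>
  The cost \<open>c\<close> is a parameter of the estimate, so that it can be formed both with the
  infinite-horizon and with the truncated cost.
\<close>

definition grad_estimate ::
    "estimator \<Rightarrow> (real^'n^'m \<Rightarrow> real^'n \<Rightarrow> real) \<Rightarrow> real
      \<Rightarrow> real^'n^'m \<Rightarrow> real^'n^'m \<Rightarrow> real^'n \<Rightarrow> real^'n^'m" where
  "grad_estimate mode c r K D x0 =
     (let d = real (CARD('m) * CARD('n)) in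
      case mode of
        OnePoint \<Rightarrow> (c (K + r *\<^sub>R D) x0 * (d / r)) *\<^sub>R D
      | TwoPoint \<Rightarrow> ((c (K + r *\<^sub>R D) x0 - c (K - r *\<^sub>R D) x0) * (d / (2 * r))) *\<^sub>R D)"

definition queried_costs_finite ::
    "estimator \<Rightarrow> (real^'n^'m \<Rightarrow> real^'n \<Rightarrow> ereal) \<Rightarrow> real
      \<Rightarrow> real^'n^'m \<Rightarrow> real^'n^'m \<Rightarrow> real^'n \<Rightarrow> bool" where
  "queried_costs_finite mode c r K D x0 \<longleftrightarrow>
     (case mode of
        OnePoint \<Rightarrow> c (K + r *\<^sub>R D) x0 < \<infinity>
      | TwoPoint \<Rightarrow> c (K + r *\<^sub>R D) x0 < \<infinity> \<and> c (K - r *\<^sub>R D) x0 < \<infinity>)"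

text \<open>
  In the next two definitions \<open>G K D x0\<close> is a gradient estimate and \<open>S\<close> a set of gains. As
  \<open>K\<close> is deterministic and \<open>(x0, D)\<close> is drawn independently of it, the conditional expectation
  of the estimate given \<open>K\<close> is its plain expectation over \<open>(x0, D)\<close>.
\<close>

definition estimate_sup ::
    "(real^'n^'m \<Rightarrow> real^'n^'m \<Rightarrow> real^'n \<Rightarrow> real^'n^'m) \<Rightarrow> (real^'n) measure
      \<Rightarrow> (real^'n^'m) set \<Rightarrow> ereal" where
  "estimate_sup G Dist S =
     (SUP K\<in>S. esssup (Dist \<Otimes>\<^sub>M sphere_uniform) (\<lambda>(x0, D). ereal (norm (G K D x0))))"

definition estimate_variance ::
    "(real^'n^'m \<Rightarrow> real^'n^'m \<Rightarrow> real^'n \<Rightarrow> real^'n^'m) \<Rightarrow> (real^'n) measure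
      \<Rightarrow> (real^'n^'m) set \<Rightarrow> ennreal" where
  "estimate_variance G Dist S =
     (SUP K\<in>S. \<integral>\<^sup>+ (x0, D). ennreal
        ((norm (G K D x0 - (\<integral>(x0', D'). G K D' x0' \<partial>(Dist \<Otimes>\<^sub>M sphere_uniform))))\<^sup>2)
        \<partial>(Dist \<Otimes>\<^sub>M sphere_uniform))"

end

theory Submission
  imports Defs "HOL-Computational_Algebra.Fundamental_Theorem_Algebra"
begin

text \<open>
  Write \<open>f K = J K - J Kstar\<close>, \<open>u = 120 Delta0 / eps\<close>, and let the iteration be frozen when it first
  leaves \<open>{f \<le> b}\<close> for a level \<open>b\<close> slightly below \<open>10 Delta0\<close>. Following a gradient step inside the
  sublevel set gives \<open>|grad f|^2 \<le> 2 phi0 f\<close>, so \<open>mu \<le> 2 phi0\<close> and the queried gains \<open>K \<plusminus> r D\<close> with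
  \<open>f K \<le> b\<close> still lie in \<open>{f \<le> 10 Delta0}\<close>, where the truncation error is controlled. Since \<open>D\<close> is
  symmetric, truncation biases the estimate by at most \<open>delta / 2\<close>, while smoothing biases it by at most
  \<open>phi0 r\<close>. As long as \<open>f K \<le> b\<close>, one step therefore changes the expectation of \<open>f\<close> by at most
  \<open>eta mu eps / 100\<close>, and also multiplies it by \<open>1 - eta mu / 4\<close> up to an error of \<open>eta mu eps / 80\<close>.
  By Markov's inequality the first bound limits the probability of an exit, the second one that of
  ending inside with \<open>f \<ge> eps\<close>. The condition \<open>ln u < u / 10\<close> leaves two regimes: for \<open>u \<ge> 25\<close> the level
  \<open>b = 9 Delta0\<close> works, and for \<open>u \<le> 6/5\<close> a lower level is needed, but there \<open>eps > b\<close> and only the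
  exit has to be excluded.
\<close>

section \<open>Stable matrices have summable orbits\<close>

text \<open>\<open>gradient\<close> is a definite description, so hypotheses on its values concern
  the cost only once the cost is known to be differentiable. Since \<open>spectral_radius\<close> is
  defined through complex eigenvalues, a value below 1 must first become geometric decay, uniform
  over nearby gains, before the cost series can be differentiated termwise. Regularity is local
  (balls of radius \<open>rho0\<close> around gains of gap at most \<open>10 * Delta0\<close>), and
  so are the decay constants; hence the run is stopped at a level from which a single query cannot
  leave that set. The failure probability 1/4 is spent as follows. The expected gap of the stopped
  process is at most \<open>148/100 * Delta0\<close>, so an exit at level \<open>9 * Delta0\<close>
  has probability at most \<open>148/900\<close>, and ending inside with gap at least
  \<open>eps\<close> has at most \<open>7/120\<close>. For \<open>u \<le> 6/5\<close> a query may
  raise the square root of the gap by nearly \<open>sqrt (Delta0 / 2)\<close>, too much for level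
  \<open>9 * Delta0\<close>; the level \<open>(49/20)^2 * Delta0\<close> just leaves room for it and
  still keeps the exit below 1/4.\<close>

lemma summable_affine_recurrence:
  fixes a b :: "nat \<Rightarrow> real"
  assumes a: "\<And>n. 0 \<le> a n" and b: "\<And>n. 0 \<le> b n" "summable b"
    and c: "0 \<le> c" "c < 1" and rec: "\<And>n. a (Suc n) \<le> c * a n + b n"
  shows "summable a"
proof (rule summableI_nonneg_bounded)
  fix n
  have "(\<Sum>i<n. a i) \<le> (\<Sum>i<Suc n. a i)" using a by simp
  also have "\<dots> = a 0 + (\<Sum>i<n. a (Suc i))" by (rule sum.lessThan_Suc_shift)
  also have "\<dots> \<le> a 0 + (\<Sum>i<n. c * a i + b i)" using rec by (intro add_left_mono sum_mono)
  also have "\<dots> = a 0 + c * (\<Sum>i<n. a i) + (\<Sum>i<n. b i)"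
    by (simp add: sum.distrib sum_distrib_left)
  also have "(\<Sum>i<n. b i) \<le> suminf b" using b by (intro sum_le_suminf) auto
  finally have "(1 - c) * (\<Sum>i<n. a i) \<le> a 0 + suminf b" by (simp add: algebra_simps)
  then show "(\<Sum>i<n. a i) \<le> (a 0 + suminf b) / (1 - c)"
    using c by (simp add: pos_le_divide_eq mult.commute)
qed (rule a)

text \<open>Dependence is needed for an indexed family: if two members coincide, the set of values
  may be independent, and the relation is then \<open>v i - v j = 0\<close>.\<close>

lemma euclidean_family_dependent:
  fixes v :: "nat \<Rightarrow> 'a::euclidean_space"
  obtains c :: "nat \<Rightarrow> real" and k where "k \<le> DIM('a)" "c k \<noteq> 0" "(\<Sum>k\<le>DIM('a). c k *\<^sub>R v k) = 0"
proof (cases "inj_on v {..DIM('a)}")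
  case True
  have "card (v ` {..DIM('a)}) = Suc DIM('a)" using True by (simp add: card_image)
  then have "dependent (v ` {..DIM('a)})" using independent_card_le[of "v ` {..DIM('a)}"] by fastforce
  then obtain u where u: "\<exists>w\<in>v ` {..DIM('a)}. u w \<noteq> 0" "(\<Sum>w\<in>v ` {..DIM('a)}. u w *\<^sub>R w) = 0"
    by (subst (asm) dependent_finite) auto
  have "(\<Sum>k\<le>DIM('a). u (v k) *\<^sub>R v k) = 0" using u(2) by (simp add: sum.reindex[OF True])
  with u(1) that show ?thesis by fastforce
next
  case False
  then obtain i j where ij: "i \<le> DIM('a)" "j \<le> DIM('a)" "i \<noteq> j" "v i = v j" by (auto simp: inj_on_def)
  define c :: "nat \<Rightarrow> real" where "c = (\<lambda>k. if k = i then 1 else if k = j then -1 else 0)"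
  have "(\<Sum>k\<le>DIM('a). c k *\<^sub>R v k) = (\<Sum>k\<in>{i,j}. c k *\<^sub>R v k)"
    using ij by (intro sum.mono_neutral_right) (auto simp: c_def)
  also have "\<dots> = 0" using ij by (simp add: c_def)
  finally show ?thesis using that[of i c] ij by (simp add: c_def)
qed

text \<open>Complexification: the eigenvalues in \<open>complex_spectrum\<close> are complex, so
  real orbits are studied in the complex space and transferred back by
  \<open>norm_cvec\<close>.\<close>

definition cmat :: "real^'n^'m \<Rightarrow> complex^'n^'m" where
  "cmat M = (\<chi> i j. complex_of_real (M $ i $ j))"

definition cvec :: "real^'n \<Rightarrow> complex^'n" where
  "cvec v = (\<chi> i. complex_of_real (v $ i))"

lemma norm_cvec: "norm (cvec v) = norm v"
  by (simp add: norm_vec_def cvec_def)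

lemma cmat_mult_cvec: "cmat M *v cvec v = cvec (M *v v)"
  by (simp add: vec_eq_iff cmat_def cvec_def matrix_vector_mult_def)

lemma cmat_mult: "cmat (M ** N) *v v = cmat M *v (cmat N *v v)"
proof -
  have "cmat (M ** N) = cmat M ** cmat N"
    by (simp add: vec_eq_iff cmat_def matrix_matrix_mult_def)
  then show ?thesis by (simp add: matrix_vector_mul_assoc)
qed

lemma cmat_funpow_cvec:
  fixes M :: "real^'n^'n"
  shows "((*v) (cmat M) ^^ t) (cvec v) = cvec (((*v) M ^^ t) v)"
  by (induction t) (simp_all add: cmat_mult_cvec)

text \<open>This is \<open>p(M)\<close> applied to \<open>v\<close>, written with iterates of
  \<open>M\<close> so that orbits appear directly.\<close>

definition poly_act :: "complex^'n^'n \<Rightarrow> complex poly \<Rightarrow> complex^'n \<Rightarrow> complex^'n" where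
  "poly_act M p v = (\<Sum>k\<le>degree p. coeff p k *s ((*v) M ^^ k) v)"

lemma poly_act_alt: "degree p \<le> N \<Longrightarrow> poly_act M p v = (\<Sum>k\<le>N. coeff p k *s ((*v) M ^^ k) v)"
  unfolding poly_act_def by (rule sum.mono_neutral_left) (auto simp: coeff_eq_0)

lemma funpow_mult_add:
  fixes M :: "'a::semiring_1^'n^'n"
  shows "((*v) M ^^ k) (v + w) = ((*v) M ^^ k) v + ((*v) M ^^ k) w"
  by (induction k) (simp_all add: matrix_vector_right_distrib)

lemma funpow_mult_scale:
  fixes M :: "'a::comm_semiring_1^'n^'n"
  shows "((*v) M ^^ k) (c *s v) = c *s ((*v) M ^^ k) v"
  by (induction k) (simp_all add: matrix_vector_mult_def sum_distrib_left vec_eq_iff ac_simps)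

lemma poly_act_add: "poly_act M p (v + w) = poly_act M p v + poly_act M p w"
  by (simp add: poly_act_def funpow_mult_add vector_add_ldistrib sum.distrib)

lemma poly_act_scale: "poly_act M p (c *s v) = c *s poly_act M p v"
  by (simp add: poly_act_def funpow_mult_scale vec.scale_sum_right vector_smult_assoc mult.commute)

lemma poly_act_commute: "poly_act M p (M *v v) = M *v poly_act M p v"
  by (simp add: poly_act_def vec.linear_sum[OF matrix_vector_mul_linear_gen] vector_scalar_commute
      funpow_swap1)

text \<open>The coefficients of the product are those of \<open>q\<close> shifted by one, minus
  \<open>z\<close> times those of \<open>q\<close>; the shift is one more application of
  \<open>M\<close>. A root of a polynomial annihilating \<open>v\<close> is thereby traded for a
  lower degree at \<open>M *v v - z *s v\<close>.\<close>

lemma poly_act_linear_factor: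
  "poly_act M ([:- z, 1:] * q) v = poly_act M q (M *v v - z *s v)"
proof -
  define N where "N = Suc (degree q)"
  have c: "coeff ([:- z, 1:] * q) k = coeff (pCons 0 q) k - z * coeff q k" for k
    by simp
  have "degree ([:- z, 1:] * q) \<le> N" using degree_mult_le[of "[:- z, 1:]" q] by (simp add: N_def)
  then have "poly_act M ([:- z, 1:] * q) v
      = (\<Sum>k\<le>N. coeff (pCons 0 q) k *s ((*v) M ^^ k) v) - (\<Sum>k\<le>N. (z * coeff q k) *s ((*v) M ^^ k) v)"
    by (subst poly_act_alt) (simp_all only: c vec.scale_left_diff_distrib sum_subtractf)
  also have "(\<Sum>k\<le>N. coeff (pCons 0 q) k *s ((*v) M ^^ k) v) = poly_act M q (M *v v)"
    by (simp add: N_def sum.atMost_Suc_shift poly_act_def funpow_swap1 del: sum.atMost_Suc)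
  also have "(\<Sum>k\<le>N. (z * coeff q k) *s ((*v) M ^^ k) v) = z *s poly_act M q v"
    by (subst poly_act_alt[where N=N]) (simp_all add: N_def vec.scale_sum_right vector_smult_assoc)
  also have "poly_act M q (M *v v) - z *s poly_act M q v = poly_act M q (M *v v - z *s v)"
    using poly_act_add[of M q "M *v v - z *s v" "z *s v"] by (simp add: poly_act_scale)
  finally show ?thesis .
qed

text \<open>The matrices form a space of finite dimension \<open>D\<close>, so the powers of
  \<open>M\<close> with exponents 0 to \<open>D\<close> are linearly dependent, and the dependence
  is the polynomial.\<close>

lemma annihilating_poly:
  fixes M :: "real^'n^'n"
  obtains p where "p \<noteq> 0" "\<And>v. poly_act (cmat M) p v = 0"
proof -
  define W where "W k = ((**) M ^^ k) (mat 1)" for k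
  obtain c k where c: "k \<le> DIM(real^'n^'n)" "c k \<noteq> 0" "(\<Sum>k\<le>DIM(real^'n^'n). c k *\<^sub>R W k) = 0"
    by (rule euclidean_family_dependent)
  define D where "D = DIM(real^'n^'n)"
  define p where "p = (\<Sum>k\<le>D. monom (complex_of_real (c k)) k)"
  have cp: "coeff p k = (if k \<le> D then of_real (c k) else 0)" for k
    by (simp add: p_def coeff_sum)
  have W: "cmat (W k) *v v = ((*v) (cmat M) ^^ k) v" for k v
  proof (induction k)
    case 0
    have "cmat (mat 1 :: real^'n^'n) = mat 1" by (simp add: vec_eq_iff cmat_def mat_def)
    then show ?case by (simp add: W_def)
  next
    case (Suc k)
    then show ?case by (simp add: W_def cmat_mult)
  qed
  show ?thesis
  proof
    show "p \<noteq> 0" using c cp[of k] by (metis D_def coeff_0 of_real_eq_0_iff)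
    fix v
    have "degree p \<le> D" by (rule degree_le) (simp add: cp)
    then have "poly_act (cmat M) p v = (\<Sum>k\<le>D. of_real (c k) *s (cmat (W k) *v v))"
      by (subst poly_act_alt[where N=D]) (simp_all add: cp W)
    also have "\<dots> = cmat (\<Sum>k\<le>D. c k *\<^sub>R W k) *v v"
      by (simp add: vec_eq_iff cmat_def matrix_vector_mult_def sum_distrib_left sum_distrib_right
          mult.assoc sum.swap[of _ _ "{..D}"])
    also have "\<dots> = 0" using c by (simp add: D_def cmat_def matrix_vector_mult_def vec_eq_iff)
    finally show "poly_act (cmat M) p v = 0" .
  qed
qed

lemma funpow_mult_diff_scale:
  "((*v) M ^^ t) (M *v v - z *s v) = ((*v) M ^^ Suc t) v - z *s ((*v) M ^^ t) (v :: complex^'n)"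
proof -
  have "((*v) M ^^ t) (M *v v) = ((*v) M ^^ t) (M *v v - z *s v) + ((*v) M ^^ t) (z *s v)"
    by (simp flip: funpow_mult_add)
  then show ?thesis by (simp add: funpow_mult_scale funpow_swap1)
qed

lemma norm_scale_complex: "norm (z *s v) = cmod z * norm (v :: complex^'n)"
  by (simp add: norm_vec_def norm_mult L2_set_right_distrib[symmetric])

text \<open>Induction on the degree, splitting off a root \<open>z\<close>. If
  \<open>cmod z < 1\<close>, the orbit of \<open>v\<close> satisfies an affine recurrence with
  factor \<open>cmod z\<close>, forced by the orbit of \<open>M *v v - z *s v\<close>, which
  \<open>q\<close> annihilates. Otherwise \<open>poly_act M q v\<close> would be an eigenvector for
  \<open>z\<close> unless it is zero, so \<open>q\<close> already annihilates
  \<open>v\<close>.\<close>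

lemma annihilated_summable:
  fixes M :: "complex^'n^'n"
  assumes ev: "\<And>z v. v \<noteq> 0 \<Longrightarrow> M *v v = z *s v \<Longrightarrow> cmod z < 1"
    and "p \<noteq> 0" "poly_act M p v = 0"
  shows "summable (\<lambda>t. norm (((*v) M ^^ t) v))"
  using assms(2,3)
proof (induction "degree p" arbitrary: p v)
  case 0
  then obtain a where "p = [:a:]" by (metis degree_eq_zeroE)
  with 0 have "a \<noteq> 0" "a *s v = 0" by (auto simp: poly_act_def)
  then have "v = 0" by simp
  moreover have "((*v) M ^^ t) 0 = 0" for t by (induction t) simp_all
  ultimately show ?case by simp
next
  case (Suc n)
  then obtain z where "poly p z = 0"
    using fundamental_theorem_of_algebra[of p] by (auto simp: constant_degree)
  then obtain q where q: "p = [:- z, 1:] * q" by (metis dvdE poly_eq_0_iff_dvd)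
  with Suc have q0: "q \<noteq> 0" by auto
  then have dq: "n = degree q" using Suc q by (simp add: degree_mult_eq del: mult_pCons_left)
  let ?w = "M *v v - z *s v"
  have w: "poly_act M q ?w = 0" using Suc q by (simp only: poly_act_linear_factor)
  show ?case
  proof (cases "cmod z < 1")
    case True
    have s: "summable (\<lambda>t. norm (((*v) M ^^ t) ?w))" using Suc(1)[OF dq q0 w] .
    show ?thesis
    proof (rule summable_affine_recurrence[OF _ _ s _ True])
      fix t
      have "((*v) M ^^ Suc t) v = z *s ((*v) M ^^ t) v + ((*v) M ^^ t) ?w"
        by (simp add: funpow_mult_diff_scale)
      then show "norm (((*v) M ^^ Suc t) v) \<le> cmod z * norm (((*v) M ^^ t) v) + norm (((*v) M ^^ t) ?w)"
        by (metis norm_scale_complex norm_triangle_ineq)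
    qed simp_all
  next
    case False
    have "M *v poly_act M q v = z *s poly_act M q v"
      using w poly_act_add[of M q ?w "z *s v"] by (simp add: poly_act_commute poly_act_scale)
    with False ev have "poly_act M q v = 0" by blast
    then show ?thesis using Suc(1)[OF dq q0] by blast
  qed
qed

text \<open>\<open>Max\<close> bounds the moduli only for a finite spectrum; finiteness holds
  because every eigenvalue is a root of the annihilating polynomial.\<close>

lemma spectral_radius_less_1_summable:
  fixes M :: "real^'n^'n"
  assumes "spectral_radius M < 1"
  shows "summable (\<lambda>t. norm (((*v) M ^^ t) v))"
proof -
  obtain p where p: "p \<noteq> 0" "\<And>v. poly_act (cmat M) p v = 0" using annihilating_poly[of M] by auto
  have spec: "complex_spectrum M = {z. \<exists>v. v \<noteq> 0 \<and> cmat M *v v = z *s v}"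
    by (simp add: complex_spectrum_def cmat_def)
  have "complex_spectrum M \<subseteq> {z. poly p z = 0}"
  proof
    fix z assume "z \<in> complex_spectrum M"
    then obtain v where v: "v \<noteq> 0" "cmat M *v v = z *s v" by (auto simp: spec)
    have "((*v) (cmat M) ^^ k) v = z ^ k *s v" for k
      by (induction k) (simp_all add: v vector_scalar_commute vector_smult_assoc mult.commute)
    then have "poly_act (cmat M) p v = poly p z *s v"
      by (simp add: poly_act_def poly_altdef vec.scale_sum_left vector_smult_assoc)
    with p v show "z \<in> {z. poly p z = 0}" by simp
  qed
  then have fin: "finite (complex_spectrum M)" using poly_roots_finite[OF p(1)] by (rule finite_subset)
  have "cmod z < 1" if "v \<noteq> 0" "cmat M *v v = z *s v" for z v
  proof -
    have "cmod z \<le> spectral_radius M" unfolding spectral_radius_def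
      using that fin by (intro Max_ge) (auto simp: spec)
    then show ?thesis using assms by simp
  qed
  from annihilated_summable[OF this p(1) p(2)[of "cvec v"]]
  show ?thesis by (simp add: cmat_funpow_cvec norm_cvec)
qed

section \<open>Averages over the sphere\<close>

lemma sets_sphere_uniform [measurable_cong]: "sets sphere_uniform = sets borel"
  by (simp add: sphere_uniform_def)

lemma measure_unit_cball_pos: "0 < measure lborel (cball (0::'a::euclidean_space) 1)"
  by (simp add: content_cball unit_ball_vol_pos)

lemma integral_sphere_uniform:
  fixes q :: "'a::euclidean_space \<Rightarrow> real"
  assumes [measurable]: "q \<in> borel_measurable borel"
  shows "(\<integral>D. q D \<partial>sphere_uniform)
    = (\<integral>x. indicator (cball 0 1) x * q (sgn x) \<partial>lborel) / measure lborel (cball (0::'a) 1)"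
proof -
  let ?B = "cball (0::'a) 1"
  have [measurable]: "?B \<in> sets borel" by simp
  have e: "emeasure lborel ?B = ennreal (measure lborel ?B)"
    by (rule emeasure_eq_ennreal_measure) (use unit_cball_emeasure in \<open>simp add: top.not_eq_extremum\<close>)
  have u: "uniform_measure lborel ?B = density lborel (\<lambda>x. ennreal (indicator ?B x / measure lborel ?B))"
    unfolding uniform_measure_def e using measure_unit_cball_pos[where 'a='a]
    by (intro density_cong AE_I2) (auto simp: indicator_def divide_ennreal[symmetric])
  have "(\<integral>D. q D \<partial>sphere_uniform) = (\<integral>x. q (sgn x) \<partial>uniform_measure lborel ?B)"
    unfolding sphere_uniform_def by (intro integral_distr) simp_all
  also have "\<dots> = (\<integral>x. (indicator ?B x / measure lborel ?B) * q (sgn x) \<partial>lborel)"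
    unfolding u by (subst integral_density) auto
  also have "\<dots> = (\<integral>x. (indicator ?B x * q (sgn x)) / measure lborel ?B \<partial>lborel)"
    by (simp add: mult.commute)
  finally show ?thesis by simp
qed

lemma integral_cball_sgn:
  fixes q :: "'a::euclidean_space \<Rightarrow> real"
  assumes [measurable]: "q \<in> borel_measurable borel" and R: "0 < R"
  shows "(\<integral>x. indicator (cball 0 R) x * q (sgn x) \<partial>lborel)
    = R ^ DIM('a) * (\<integral>x. indicator (cball 0 1) x * q (sgn x) \<partial>lborel)"
proof -
  have [measurable]: "cball (0::'a) R \<in> sets borel" by simp
  have "(\<integral>x. indicator (cball 0 R) x * q (sgn x) \<partial>lborel)
    = (\<integral>x. indicator (cball 0 R) x * q (sgn x)
        \<partial>density (distr lborel borel (\<lambda>x::'a. 0 + R *\<^sub>R x)) (\<lambda>_. \<bar>R\<bar> ^ DIM('a)))"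
    using lborel_affine[of R "0::'a"] R by simp
  also have "\<dots> = R ^ DIM('a) * (\<integral>x. indicator (cball 0 R) x * q (sgn x)
        \<partial>distr lborel borel (\<lambda>x::'a. R *\<^sub>R x))"
    using R by (subst integral_density) auto
  also have "(\<integral>x. indicator (cball 0 R) x * q (sgn x) \<partial>distr lborel borel (\<lambda>x::'a. R *\<^sub>R x))
     = (\<integral>x. indicator (cball 0 R) (R *\<^sub>R x) * q (sgn (R *\<^sub>R x)) \<partial>lborel)"
    by (subst integral_distr) auto
  also have "\<dots> = (\<integral>x. indicator (cball 0 1) x * q (sgn x) \<partial>lborel)"
    using R by (intro Bochner_Integration.integral_cong) (auto simp: indicator_def sgn_scaleR)
  finally show ?thesis .
qed

section \<open>The first-moment estimate for Lipschitz functions on the sphere\<close>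

lemma closest_point_unit_cball:
  fixes x :: "'a::euclidean_space"
  assumes "1 \<le> norm x"
  shows "closest_point (cball 0 1) x = sgn x"
proof (rule closest_point_unique[symmetric])
  show "sgn x \<in> cball 0 1" by (simp add: norm_sgn)
  have "x \<noteq> 0" using assms by auto
  then have "x - sgn x = (norm x - 1) *\<^sub>R sgn x" by (simp add: sgn_div_norm algebra_simps)
  then have d: "dist x (sgn x) = norm x - 1"
    using assms \<open>x \<noteq> 0\<close> by (simp add: dist_norm norm_sgn)
  have "norm x - 1 \<le> dist x z" if "norm z \<le> 1" for z
    using norm_triangle_ineq2[of x z] that by (simp add: dist_norm)
  then show "\<forall>z\<in>cball 0 1. dist x (sgn x) \<le> dist x z" by (simp add: d)
qed simp_all

lemma integrable_continuous_support:
  fixes f :: "'a::euclidean_space \<Rightarrow> real"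
  assumes "continuous_on UNIV f" and "\<And>x. R < norm x \<Longrightarrow> f x = 0"
  shows "integrable lborel f"
proof -
  have "integrable lborel (\<lambda>x. indicator (cball 0 R) x *\<^sub>R f x)"
    using assms by (intro borel_integrable_compact) (auto intro: continuous_on_subset)
  moreover have "(\<lambda>x. indicator (cball 0 R) x *\<^sub>R f x) = f"
    using assms(2) by (auto simp: fun_eq_iff indicator_def)
  ultimately show ?thesis by simp
qed

lemma integral_lborel_translate:
  fixes f :: "'a::euclidean_space \<Rightarrow> real"
  assumes [measurable]: "f \<in> borel_measurable borel"
  shows "(\<integral>x. f (c + x) \<partial>lborel) = (\<integral>x. f x \<partial>lborel)"
proof -
  have "(\<integral>x. f x \<partial>lborel) = (\<integral>x. f x \<partial>distr lborel borel ((+) c))" by (simp add: lborel_distr_plus)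
  also have "\<dots> = (\<integral>x. f (c + x) \<partial>lborel)" by (rule integral_distr) simp_all
  finally show ?thesis by simp
qed

text \<open>For \<open>h > 0\<close> the piecewise linear profile that is 1 up to radius 1 and 0
  from radius \<open>1 + h\<close> on; composed with \<open>norm\<close> it is a Lipschitz
  substitute for the indicator of the ball.\<close>

definition cutoff :: "real \<Rightarrow> real \<Rightarrow> real" where
  "cutoff h \<rho> = min 1 (max 0 ((1 + h - \<rho>) / h))"

lemma cutoff_bounds: "0 \<le> cutoff h \<rho>" "cutoff h \<rho> \<le> 1"
  by (auto simp: cutoff_def)

lemma cutoff_eq_0: "0 < h \<Longrightarrow> 1 + h \<le> \<rho> \<Longrightarrow> cutoff h \<rho> = 0"
  by (auto simp: cutoff_def divide_simps)

lemma cutoff_lipschitz: "0 < h \<Longrightarrow> \<bar>cutoff h \<rho> - cutoff h \<rho>'\<bar> \<le> \<bar>\<rho> - \<rho>'\<bar> / h"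
proof -
  assume h: "0 < h"
  have "\<bar>cutoff h \<rho> - cutoff h \<rho>'\<bar> \<le> \<bar>(1 + h - \<rho>) / h - (1 + h - \<rho>') / h\<bar>"
    by (auto simp: cutoff_def min_def max_def)
  also have "\<dots> = \<bar>\<rho> - \<rho>'\<bar> / h" using h by (simp flip: diff_divide_distrib add: abs_minus_commute)
  finally show ?thesis .
qed

lemma continuous_on_cutoff: "continuous_on A (cutoff h)"
  unfolding cutoff_def[abs_def] by (cases "h = 0") (auto intro!: continuous_intros)

lemma cutoff_deriv:
  assumes h: "0 < h" and "\<rho> \<noteq> 1" "\<rho> \<noteq> 1 + h"
  shows "(cutoff h has_real_derivative (if 1 < \<rho> \<and> \<rho> < 1 + h then - 1 / h else 0)) (at \<rho>)"
proof -
  consider "\<rho> < 1" | "1 < \<rho>" "\<rho> < 1 + h" | "1 + h < \<rho>" using assms by linarith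
  then show ?thesis
  proof cases
    case 1
    have "((\<lambda>_. 1) has_real_derivative 0) (at \<rho>)" by simp
    then have "(cutoff h has_real_derivative 0) (at \<rho>)"
      by (rule has_field_derivative_transform_within_open[where S="{..<1}"])
        (use 1 h in \<open>auto simp: cutoff_def min_def max_def divide_simps\<close>)
    with 1 show ?thesis by simp
  next
    case 2
    have "((\<lambda>\<rho>. (1 + h - \<rho>) / h) has_real_derivative - 1 / h) (at \<rho>)"
      using h by (auto intro!: derivative_eq_intros)
    then have "(cutoff h has_real_derivative - 1 / h) (at \<rho>)"
      by (rule has_field_derivative_transform_within_open[where S="{1<..<1+h}"])
        (use 2 h in \<open>auto simp: cutoff_def min_def max_def divide_simps\<close>)
    with 2 show ?thesis by simp
  next
    case 3
    have "((\<lambda>_. 0) has_real_derivative 0) (at \<rho>)" by simp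
    then have "(cutoff h has_real_derivative 0) (at \<rho>)"
      by (rule has_field_derivative_transform_within_open[where S="{1+h<..}"])
        (use 3 h in \<open>auto simp: cutoff_def min_def max_def divide_simps\<close>)
    with 3 show ?thesis by simp
  qed
qed

lemma AE_norm_neq: "AE x in lborel. norm (x::'a::euclidean_space) \<noteq> c"
proof -
  have "negligible {x::'a. norm x = c}" using negligible_sphere[of "0::'a" c] by (simp add: sphere_def)
  then have "{x::'a. norm x = c} \<in> null_sets lebesgue" by (simp add: negligible_iff_null_sets)
  moreover have "{x::'a. norm x = c} \<in> sets lborel" by simp
  ultimately have "{x::'a. norm x = c} \<in> null_sets lborel" by (metis null_sets_completion_iff)
  from AE_not_in[OF this] show ?thesis by simp
qed

text \<open>
  A divergence theorem for the ball in disguise. A cutoff of the ball of radius \<open>1 + h\<close> is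
  moved along \<open>v\<close>: the derivative of the integral of \<open>f\<close> is at most the Lipschitz constant
  times the volume on the one hand, and an average over the shell \<open>1 < |x| < 1 + h\<close>, where
  \<open>f\<close> may be taken radially constant, on the other.
\<close>

lemma sphere_lipschitz_shell:
  fixes f :: "'a::euclidean_space \<Rightarrow> real"
  assumes lip: "L-lipschitz_on (cball 0 1) f" and [measurable]: "f \<in> borel_measurable borel"
    and h: "0 < h"
  shows "DIM('a) * \<bar>\<integral>D. f D * (D \<bullet> v) \<partial>sphere_uniform\<bar> \<le> L * norm v * (1 + h) ^ DIM('a)"
proof -
  let ?B = "\<lambda>R. cball (0::'a) R"
  have [measurable]: "?B R \<in> sets borel" for R by simp
  have ib: "integrable lborel (indicator (?B R) :: 'a \<Rightarrow> real)" for R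
    by (intro integrable_real_indicator emeasure_bounded_finite) auto
  define V where "V = measure lborel (?B 1)"
  have V: "0 < V" unfolding V_def by (rule measure_unit_cball_pos)
  have L: "0 \<le> L" using lip by (rule lipschitz_on_nonneg)
  \<comment> \<open>Projecting to the ball first keeps the Lipschitz constant \<open>L\<close> on
    the whole space and makes \<open>g\<close> radially constant outside the ball, where it equals
    \<open>f (sgn x)\<close>.\<close>
  define g where "g = (\<lambda>x. f (closest_point (?B 1) x))"
  have cp: "closest_point (?B 1) x \<in> ?B 1" for x by (intro closest_point_in_set) auto
  have gl: "\<bar>g x - g y\<bar> \<le> L * norm (x - y)" for x y
  proof -
    have "\<bar>g x - g y\<bar> \<le> L * dist (closest_point (?B 1) x) (closest_point (?B 1) y)"
      unfolding g_def using lipschitz_onD[OF lip cp cp] by (simp add: dist_real_def)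
    also have "\<dots> \<le> L * dist x y" using L by (intro mult_left_mono closest_point_lipschitz) auto
    finally show ?thesis by (simp add: dist_norm)
  qed
  have gcont: "continuous_on UNIV g"
    unfolding g_def
    by (rule continuous_on_compose2[OF lipschitz_on_continuous_on[OF lip]])
      (use cp in \<open>auto intro!: continuous_on_closest_point simp del: mem_cball\<close>)
  then have gm [measurable]: "g \<in> borel_measurable borel" by (rule borel_measurable_continuous_onI)
  have "compact (f ` ?B 1)" using lipschitz_on_continuous_on[OF lip] by (intro compact_continuous_image) auto
  then have "bounded (f ` ?B 1)" by (rule compact_imp_bounded)
  then obtain C where C: "\<And>x. x \<in> ?B 1 \<Longrightarrow> \<bar>f x\<bar> \<le> C"
    unfolding bounded_iff by force
  have gC: "\<bar>g x\<bar> \<le> C" for x unfolding g_def by (rule C[OF cp])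
  have gs: "g x = f (sgn x)" if "1 \<le> norm x" for x
    using that by (simp add: g_def closest_point_unit_cball)
  define \<phi> where "\<phi> = (\<lambda>x::'a. cutoff h (norm x))"
  have phc: "continuous_on UNIV \<phi>" unfolding \<phi>_def
    using continuous_on_compose2[OF continuous_on_cutoff[of UNIV h] continuous_on_norm_id[of "UNIV :: 'a set"]]
    by simp
  then have [measurable]: "\<phi> \<in> borel_measurable borel" by (rule borel_measurable_continuous_onI)
  have ph0: "\<phi> x = 0" if "1 + h < norm x" for x using that h by (simp add: \<phi>_def cutoff_eq_0)
  have phi: "integrable lborel \<phi>" by (rule integrable_continuous_support[OF phc ph0])
  have phv: "(\<integral>x. \<phi> x \<partial>lborel) \<le> (1 + h) ^ DIM('a) * V"
  proof -
    have "(\<integral>x. \<phi> x \<partial>lborel) \<le> (\<integral>x. indicator (?B (1 + h)) x \<partial>lborel)"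
    proof (rule integral_mono[OF phi])
      show "integrable lborel (indicator (?B (1 + h)) :: 'a \<Rightarrow> real)" by (rule ib)
      show "\<phi> x \<le> indicator (?B (1 + h)) x" for x
        using ph0[of x] cutoff_bounds(2) by (auto simp: \<phi>_def indicator_def not_le)
    qed
    also have "\<dots> = (1 + h) ^ DIM('a) * V"
      using integral_cball_sgn[of "\<lambda>_::'a. 1" "1 + h"] h by (simp add: V_def)
    finally show ?thesis .
  qed
  define t where "t n = 1 / real (Suc n)" for n
  have t: "0 < t n" "t n \<le> 1" for n by (auto simp: t_def)
  have tlim: "t \<longlonglongrightarrow> 0" unfolding t_def by (rule LIMSEQ_Suc[OF lim_const_over_n[of 1]])
  \<comment> \<open>Difference quotient of the cutoff moved along \<open>v\<close>. Its integral is
    bounded by moving the translation onto \<open>g\<close>, its pointwise limit by differentiating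
    the cutoff.\<close>
  define s where "s n y = g y * ((\<phi> (y - t n *\<^sub>R v) - \<phi> y) / t n)" for n y
  define q where "q D = f D * (D \<bullet> v)" for D
  have [measurable]: "q \<in> borel_measurable borel" unfolding q_def by measurable
  \<comment> \<open>Almost everywhere this is the limit of \<open>s n\<close>: on the shell the
    slope \<open>- 1 / h\<close> of the cutoff meets the minus sign of the translation.\<close>
  define \<Phi> where "\<Phi> y = (indicator (?B (1 + h)) y * q (sgn y) - indicator (?B 1) y * q (sgn y)) / h" for y
  have s_bound: "\<bar>\<integral>y. s n y \<partial>lborel\<bar> \<le> L * norm v * ((1 + h) ^ DIM('a) * V)" for n
  proof -
    let ?w = "t n *\<^sub>R v"
    have i1: "integrable lborel (\<lambda>y. g y * \<phi> (y - ?w))"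
    proof (rule integrable_continuous_support)
      show "continuous_on UNIV (\<lambda>y. g y * \<phi> (y - ?w))"
        by (intro continuous_on_mult gcont continuous_on_compose2[OF phc]) (auto intro!: continuous_intros)
      show "g y * \<phi> (y - ?w) = 0" if "1 + h + norm ?w < norm y" for y
        using norm_triangle_ineq2[of y ?w] that by (subst ph0) auto
    qed
    have i2: "integrable lborel (\<lambda>y. g y * \<phi> y)"
      by (rule integrable_continuous_support[of _ "1 + h"]) (auto intro!: continuous_on_mult gcont phc simp: ph0)
    have i3: "integrable lborel (\<lambda>y. g (?w + y) * \<phi> y)"
    proof (rule integrable_continuous_support[of _ "1 + h"])
      show "continuous_on UNIV (\<lambda>y. g (?w + y) * \<phi> y)"
        by (intro continuous_on_mult phc continuous_on_compose2[OF gcont]) (auto intro!: continuous_intros)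
    qed (simp add: ph0)
    \<comment> \<open>Translation invariance turns the increment of the cutoff into the increment of
      \<open>g\<close>, to which the Lipschitz bound applies.\<close>
    have "(\<integral>y. g y * \<phi> (y - ?w) \<partial>lborel) = (\<integral>y. g (?w + y) * \<phi> y \<partial>lborel)"
      using integral_lborel_translate[of "\<lambda>y. g y * \<phi> (y - ?w)" ?w] by simp
    moreover have "t n * (\<integral>y. s n y \<partial>lborel) = (\<integral>y. g y * \<phi> (y - ?w) - g y * \<phi> y \<partial>lborel)"
    proof -
      have "t n * (\<integral>y. s n y \<partial>lborel) = (\<integral>y. t n * s n y \<partial>lborel)" by simp
      also have "(\<lambda>y. t n * s n y) = (\<lambda>y. g y * \<phi> (y - ?w) - g y * \<phi> y)"
        using t[of n] by (auto simp: s_def field_simps)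
      finally show ?thesis .
    qed
    ultimately have "t n * (\<integral>y. s n y \<partial>lborel) = (\<integral>y. (g (?w + y) - g y) * \<phi> y \<partial>lborel)"
      using i1 i2 i3 by (simp add: left_diff_distrib)
    moreover have "\<bar>\<integral>y. (g (?w + y) - g y) * \<phi> y \<partial>lborel\<bar> \<le> (\<integral>y. L * norm ?w * \<phi> y \<partial>lborel)"
    proof (rule integral_abs_bound_integral)
      show "integrable lborel (\<lambda>y. (g (?w + y) - g y) * \<phi> y)" using i2 i3 by (simp add: left_diff_distrib)
      show "\<bar>(g (?w + y) - g y) * \<phi> y\<bar> \<le> L * norm ?w * \<phi> y" for y
        unfolding abs_mult using gl[of "?w + y" y] cutoff_bounds(1)[of h "norm y"]
        by (intro mult_mono) (auto simp: \<phi>_def)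
    qed (use phi in simp)
    moreover have "(\<integral>y. L * norm ?w * \<phi> y \<partial>lborel) = t n * (L * norm v * (\<integral>y. \<phi> y \<partial>lborel))"
      using t[of n] by simp
    ultimately have "t n * \<bar>\<integral>y. s n y \<partial>lborel\<bar> \<le> t n * (L * norm v * (\<integral>y. \<phi> y \<partial>lborel))"
      using t[of n] by (metis abs_mult abs_of_pos)
    then have "\<bar>\<integral>y. s n y \<partial>lborel\<bar> \<le> L * norm v * (\<integral>y. \<phi> y \<partial>lborel)" using t[of n] by simp
    also have "\<dots> \<le> L * norm v * ((1 + h) ^ DIM('a) * V)" using L by (intro mult_left_mono phv) simp
    finally show ?thesis .
  qed
  have s_lim: "AE y in lborel. (\<lambda>n. s n y) \<longlonglongrightarrow> \<Phi> y"
    using AE_norm_neq[of 0] AE_norm_neq[of 1] AE_norm_neq[of "1 + h"]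
  proof eventually_elim
    case (elim y)
    let ?D = "if 1 < norm y \<and> norm y < 1 + h then - 1 / h else 0"
    have d1: "((\<lambda>t. y - t *\<^sub>R v) has_derivative (\<lambda>t. - (t *\<^sub>R v))) (at 0)"
      by (auto intro!: derivative_eq_intros)
    have "(norm has_derivative (\<lambda>z. z \<bullet> sgn y)) (at (y - 0 *\<^sub>R v))"
      using has_derivative_norm[of y] elim by (simp add: inner_commute)
    from has_derivative_compose[OF d1 this]
    have "((\<lambda>t. norm (y - t *\<^sub>R v)) has_real_derivative - (v \<bullet> sgn y)) (at 0)"
      unfolding has_field_derivative_def by (rule has_derivative_eq_rhs) (simp add: fun_eq_iff)
    from DERIV_chain2[OF _ this, of "cutoff h" ?D] elim cutoff_deriv[OF h, of "norm y"]
    have "((\<lambda>t. \<phi> (y - t *\<^sub>R v)) has_real_derivative ?D * - (v \<bullet> sgn y)) (at 0)"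
      by (simp add: \<phi>_def)
    then have "((\<lambda>t. (\<phi> (y - t *\<^sub>R v) - \<phi> y) / t) \<longlongrightarrow> ?D * - (v \<bullet> sgn y)) (at 0)"
      by (simp add: DERIV_def)
    then have "(\<lambda>n. (\<phi> (y - t n *\<^sub>R v) - \<phi> y) / t n) \<longlonglongrightarrow> ?D * - (v \<bullet> sgn y)"
      by (rule filterlim_compose)
        (use tlim t in \<open>auto simp: filterlim_at less_imp_neq[symmetric] intro!: eventuallyI\<close>)
    then have "(\<lambda>n. s n y) \<longlonglongrightarrow> g y * (?D * - (v \<bullet> sgn y))"
      unfolding s_def by (rule tendsto_mult_left)
    moreover have "g y * (?D * - (v \<bullet> sgn y)) = \<Phi> y"
      using elim h by (auto simp: \<Phi>_def q_def gs inner_commute indicator_def)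
    ultimately show ?case by simp
  qed
  have "(\<lambda>n. \<integral>y. s n y \<partial>lborel) \<longlonglongrightarrow> (\<integral>y. \<Phi> y \<partial>lborel)"
  proof (rule integral_dominated_convergence[OF _ _ _ s_lim])
    let ?w = "\<lambda>y. C * (norm v / h) * indicator (?B (1 + h + norm v)) y"
    show "\<Phi> \<in> borel_measurable lborel" unfolding \<Phi>_def by measurable
    show "s n \<in> borel_measurable lborel" for n unfolding s_def by measurable
    show "integrable lborel ?w" by (intro integrable_mult_right ib)
    show "AE y in lborel. norm (s n y) \<le> ?w y" for n
    proof (rule AE_I2)
      fix y
      show "norm (s n y) \<le> ?w y"
      proof (cases "norm y \<le> 1 + h + norm v")
        case True
        have "\<bar>\<phi> (y - t n *\<^sub>R v) - \<phi> y\<bar> \<le> \<bar>norm (y - t n *\<^sub>R v) - norm y\<bar> / h"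
          unfolding \<phi>_def by (rule cutoff_lipschitz[OF h])
        also have "\<dots> \<le> norm (t n *\<^sub>R v) / h"
          using norm_triangle_ineq3[of "y - t n *\<^sub>R v" y] h by (intro divide_right_mono) auto
        finally have "\<bar>(\<phi> (y - t n *\<^sub>R v) - \<phi> y) / t n\<bar> \<le> norm v / h"
          using t[of n] h by (simp add: field_simps)
        then have "\<bar>s n y\<bar> \<le> C * (norm v / h)"
          unfolding s_def abs_mult using gC[of y] by (intro mult_mono) auto
        with True show ?thesis by simp
      next
        case False
        have "norm (t n *\<^sub>R v) \<le> norm v" using t[of n] by (simp add: mult_left_le_one_le)
        then have "1 + h < norm (y - t n *\<^sub>R v)" "1 + h < norm y"
          using False norm_triangle_ineq2[of y "t n *\<^sub>R v"] norm_ge_zero[of v] by linarith+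
        with False show ?thesis by (simp add: s_def ph0)
      qed
    qed
  qed
  then have "(\<lambda>n. \<bar>\<integral>y. s n y \<partial>lborel\<bar>) \<longlonglongrightarrow> \<bar>\<integral>y. \<Phi> y \<partial>lborel\<bar>" by (rule tendsto_rabs)
  then have "\<bar>\<integral>y. \<Phi> y \<partial>lborel\<bar> \<le> L * norm v * ((1 + h) ^ DIM('a) * V)"
    by (rule LIMSEQ_le_const2) (use s_bound in blast)
  moreover have "(\<integral>y. \<Phi> y \<partial>lborel) = ((1 + h) ^ DIM('a) - 1) / h * V * (\<integral>D. q D \<partial>sphere_uniform)"
  proof -
    have "integrable lborel (\<lambda>y. indicator (?B R) y * q (sgn y))" for R
    proof (rule Bochner_Integration.integrable_bound[where f="\<lambda>y. (C * norm v) * indicator (?B R) y"])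
      show "integrable lborel (\<lambda>y. (C * norm v) * indicator (?B R) y)"
        by (intro integrable_mult_right ib)
      have "\<bar>q (sgn y)\<bar> \<le> C * norm v" for y
      proof -
        have 1: "sgn y \<in> ?B 1" by (simp add: norm_sgn)
        then have "norm (sgn y) * norm v \<le> 1 * norm v" by (intro mult_right_mono) auto
        then have "\<bar>sgn y \<bullet> v\<bar> \<le> norm v"
          using Cauchy_Schwarz_ineq2[of "sgn y" v] by simp
        then show ?thesis unfolding q_def abs_mult using C[OF 1] by (intro mult_mono) auto
      qed
      then show "AE y in lborel. norm (indicator (?B R) y * q (sgn y)) \<le> norm ((C * norm v) * indicator (?B R) y)"
        by (intro AE_I2) (auto simp: indicator_def intro: order_trans[OF _ abs_ge_self])
    qed measurable
    then have "(\<integral>y. \<Phi> y \<partial>lborel) = ((\<integral>y. indicator (?B (1+h)) y * q (sgn y) \<partial>lborel)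
        - (\<integral>y. indicator (?B 1) y * q (sgn y) \<partial>lborel)) / h"
      unfolding \<Phi>_def by simp
    also have "\<dots> = ((1 + h) ^ DIM('a) - 1) / h * (\<integral>y. indicator (?B 1) y * q (sgn y) \<partial>lborel)"
      using h by (subst integral_cball_sgn) (auto simp: left_diff_distrib)
    also have "(\<integral>y. indicator (?B 1) y * q (sgn y) \<partial>lborel) = V * (\<integral>D. q D \<partial>sphere_uniform)"
      using V by (simp add: integral_sphere_uniform V_def)
    finally show ?thesis by simp
  qed
  \<comment> \<open>The factor is the volume of the shell relative to the ball, divided by
    \<open>h\<close>; Bernoulli's inequality supplies the dimension.\<close>
  moreover have bern: "DIM('a) \<le> ((1 + h) ^ DIM('a) - 1) / h"
    using Bernoulli_inequality[of h "DIM('a)"] h by (simp add: pos_le_divide_eq)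
  ultimately have "((1 + h) ^ DIM('a) - 1) / h * \<bar>\<integral>D. q D \<partial>sphere_uniform\<bar> * V \<le> L * norm v * (1 + h) ^ DIM('a) * V"
    using V h by (simp add: abs_mult mult_ac)
  then have "((1 + h) ^ DIM('a) - 1) / h * \<bar>\<integral>D. q D \<partial>sphere_uniform\<bar> \<le> L * norm v * (1 + h) ^ DIM('a)"
    by (rule mult_right_le_imp_le) (rule V)
  with mult_right_mono[OF bern abs_ge_zero, of "\<integral>D. q D \<partial>sphere_uniform"] show ?thesis
    by (simp add: q_def)
qed

text \<open>The shell is shrunk: as \<open>h\<close> tends to 0 from the right, the factor
  \<open>(1 + h) ^ DIM('a)\<close> tends to 1.\<close>

lemma sphere_lipschitz_integral:
  fixes f :: "'a::euclidean_space \<Rightarrow> real"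
  assumes "L-lipschitz_on (cball 0 1) f" "f \<in> borel_measurable borel"
  shows "\<bar>\<integral>D. f D * (D \<bullet> v) \<partial>sphere_uniform\<bar> \<le> L * norm v / DIM('a)"
proof -
  let ?I = "DIM('a) * \<bar>\<integral>D. f D * (D \<bullet> v) \<partial>sphere_uniform\<bar>"
  have "((\<lambda>h. L * norm v * (1 + h) ^ DIM('a)) \<longlongrightarrow> L * norm v * (1 + 0) ^ DIM('a)) (at_right 0)"
    by (intro tendsto_intros)
  moreover have "\<forall>\<^sub>F h in at_right 0. ?I \<le> L * norm v * (1 + h) ^ DIM('a)"
    using sphere_lipschitz_shell[OF assms, of _ v] by (auto simp: eventually_at_right_less intro: eventually_mono[OF eventually_at_right_less])
  ultimately have "?I \<le> L * norm v" by (metis (no_types) tendsto_lowerbound trivial_limit_at_right_real add.right_neutral power_one mult.right_neutral)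
  then show ?thesis by (simp add: pos_le_divide_eq mult.commute)
qed

section \<open>Moments of a uniform direction\<close>

lemma integrable_sphere_uniform:
  fixes q :: "'a::euclidean_space \<Rightarrow> 'b::{banach, second_countable_topology}"
  assumes [measurable]: "q \<in> borel_measurable borel" and "\<And>D. norm D = 1 \<Longrightarrow> norm (q D) \<le> C"
  shows "integrable sphere_uniform q"
proof -
  interpret prob_space "sphere_uniform :: 'a measure" by (rule prob_space_sphere_uniform)
  show ?thesis
    by (rule integrable_const_bound[where B=C]) (use AE_sphere_uniform assms(2) in \<open>auto elim!: eventually_mono\<close>)
qed

lemma abs_inner_unit: "norm D = 1 \<Longrightarrow> \<bar>D \<bullet> v\<bar> \<le> norm v"
  using Cauchy_Schwarz_ineq2[of D v] by simp

lemma integrable_sphere_inner: "integrable sphere_uniform (\<lambda>D. (D::'a::euclidean_space) \<bullet> v)"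
  by (rule integrable_sphere_uniform[where C="norm v"]) (auto intro: abs_inner_unit)

lemma integrable_sphere_inner_mult:
  "integrable sphere_uniform (\<lambda>D. ((D::'a::euclidean_space) \<bullet> a) * (D \<bullet> b))"
  by (rule integrable_sphere_uniform[where C="norm a * norm b"])
    (auto simp: abs_mult intro!: mult_mono abs_inner_unit)

lemma integral_sphere_orthogonal:
  fixes q :: "'a::euclidean_space \<Rightarrow> 'b::{banach, second_countable_topology}" and f :: "'a \<Rightarrow> 'a"
  assumes f: "orthogonal_transformation f" and [measurable]: "q \<in> borel_measurable borel"
  shows "(\<integral>D. q (f D) \<partial>sphere_uniform) = (\<integral>D. q D \<partial>sphere_uniform)"
proof -
  have lin: "linear f" using f by (simp add: orthogonal_transformation_linear)
  have [measurable]: "f \<in> borel_measurable borel"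
    using lin by (intro borel_measurable_continuous_onI linear_continuous_on)
      (simp add: linear_conv_bounded_linear)
  have "(\<integral>D. q D \<partial>sphere_uniform) = (\<integral>D. q D \<partial>distr sphere_uniform borel f)"
    by (simp add: sphere_uniform_orthogonal[OF f])
  also have "\<dots> = (\<integral>D. q (f D) \<partial>sphere_uniform)"
    by (rule integral_distr) measurable
  finally show ?thesis by simp
qed

lemma orthogonal_transformation_uminus: "orthogonal_transformation (uminus :: 'a::euclidean_space \<Rightarrow> 'a)"
  by (simp add: orthogonal_transformation_def linear_iff)

lemma integral_sphere_uminus:
  fixes q :: "'a::euclidean_space \<Rightarrow> 'b::{banach, second_countable_topology}"
  assumes "q \<in> borel_measurable borel"
  shows "(\<integral>D. q (- D) \<partial>sphere_uniform) = (\<integral>D. q D \<partial>sphere_uniform)"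
  using integral_sphere_orthogonal[OF orthogonal_transformation_uminus assms] .

lemma integral_sphere_id: "(\<integral>D. (D::'a::euclidean_space) \<partial>sphere_uniform) = 0"
proof -
  have "(\<integral>D. - (D::'a) \<partial>sphere_uniform) = (\<integral>D. (D::'a) \<partial>sphere_uniform)"
    using integral_sphere_uminus[of "\<lambda>D::'a. D"] by simp
  then have "(2::real) *\<^sub>R (\<integral>D. (D::'a) \<partial>sphere_uniform) = 0"
    by (simp only: integral_minus scaleR_2 neg_eq_iff_add_eq_0)
  then show ?thesis by simp
qed

lemma integral_sphere_inner: "(\<integral>D. (D::'a::euclidean_space) \<bullet> v \<partial>sphere_uniform) = 0"
proof -
  have "(\<integral>D. (- D) \<bullet> v \<partial>sphere_uniform) = (\<integral>D. (D::'a) \<bullet> v \<partial>sphere_uniform)"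
    using integral_sphere_uminus[of "\<lambda>D::'a. D \<bullet> v"] by simp
  then show ?thesis by simp
qed

text \<open>By orthogonal invariance the moment depends on \<open>norm v\<close> only, and the
  moments along an orthonormal basis add up to 1.\<close>

lemma integral_sphere_inner_square:
  fixes v :: "'a::euclidean_space"
  shows "(\<integral>D. (D \<bullet> v)\<^sup>2 \<partial>sphere_uniform) = (norm v)\<^sup>2 / DIM('a)"
proof -
  interpret prob_space "sphere_uniform :: 'a measure" by (rule prob_space_sphere_uniform)
  define m where "m v = (\<integral>D. (D \<bullet> v)\<^sup>2 \<partial>sphere_uniform)" for v :: 'a
  have m_eq: "m a = m b" if ab: "norm a = norm b" for a b :: 'a
  proof (cases "a = b")
    case False
    define n where "n = a - b"
    have n: "n \<bullet> n \<noteq> 0" using False by (simp add: n_def)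
    \<comment> \<open>Reflection in the hyperplane orthogonal to \<open>a - b\<close>; since
      \<open>norm a = norm b\<close>, it maps \<open>a\<close> to \<open>b\<close>.\<close>
    define f where "f x = x - (2 * (x \<bullet> n) / (n \<bullet> n)) *\<^sub>R n" for x
    have lin: "linear f"
      by (rule linearI) (simp_all add: f_def inner_add_left add_divide_distrib algebra_simps)
    have inn: "f x \<bullet> y = x \<bullet> f y" for x y by (simp add: f_def inner_diff inner_commute)
    have "f x \<bullet> n = - (x \<bullet> n)" for x using n by (simp add: f_def inner_diff_left)
    then have ff: "f (f x) = x" for x by (subst f_def) (simp add: f_def)
    have orth: "orthogonal_transformation f"
      unfolding orthogonal_transformation_def using lin by (simp add: inn ff)
    have "2 * (a \<bullet> n) = n \<bullet> n"
      using ab by (simp add: n_def inner_diff inner_commute norm_eq)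
    then have "f a = b" using n by (simp add: f_def) (simp add: n_def)
    then have "m b = (\<integral>D. (f D \<bullet> a)\<^sup>2 \<partial>sphere_uniform)" by (simp add: m_def inn)
    also have "\<dots> = m a" unfolding m_def
      by (rule integral_sphere_orthogonal[OF orth, where q="\<lambda>D. (D \<bullet> a)\<^sup>2"]) simp
    finally show ?thesis by simp
  qed simp
  have int: "integrable sphere_uniform (\<lambda>D. (D \<bullet> v)\<^sup>2)" for v :: 'a
    using integrable_sphere_inner_mult[of v v] by (simp add: power2_eq_square)
  have scale: "m v = (norm v)\<^sup>2 * m b" if "b \<in> Basis" for v b
  proof -
    have "m v = m (norm v *\<^sub>R b)" using that by (intro m_eq) simp
    then show ?thesis by (simp add: m_def power_mult_distrib)
  qed
  obtain b :: 'a where b: "b \<in> Basis" using nonempty_Basis by blast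
  have "real DIM('a) * m b = (\<Sum>i\<in>Basis. m i)"
    using m_eq[OF trans[OF norm_Basis norm_Basis[OF b, symmetric]]] by simp
  also have "\<dots> = (\<integral>D. (\<Sum>i\<in>Basis. ((D::'a) \<bullet> i)\<^sup>2) \<partial>sphere_uniform)"
    unfolding m_def using int by simp
  also have "\<dots> = (\<integral>D. 1 \<partial>(sphere_uniform :: 'a measure))"
  proof (rule integral_cong_AE)
    show "AE D in sphere_uniform. (\<Sum>i\<in>Basis. ((D::'a) \<bullet> i)\<^sup>2) = (1::real)"
      using AE_sphere_uniform
    proof eventually_elim
      case (elim D)
      then have "D \<bullet> D = 1" by (simp add: norm_eq_1)
      then show ?case by (subst (asm) euclidean_inner) (simp add: power2_eq_square)
    qed
  qed measurable
  also have "\<dots> = 1" using prob_space by simp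
  finally have "m b = 1 / DIM('a)" by (simp add: field_simps)
  then show ?thesis using scale[OF b, of v] by (simp add: m_def)
qed

text \<open>Polarization of \<open>integral_sphere_inner_square\<close>.\<close>

lemma integral_sphere_inner_mult:
  fixes a b :: "'a::euclidean_space"
  shows "(\<integral>D. (D \<bullet> a) * (D \<bullet> b) \<partial>sphere_uniform) = (a \<bullet> b) / DIM('a)"
proof -
  have int: "integrable sphere_uniform (\<lambda>D. (D \<bullet> v)\<^sup>2)" for v :: 'a
    using integrable_sphere_inner_mult[of v v] by (simp add: power2_eq_square)
  have "(\<lambda>D. (D \<bullet> a) * (D \<bullet> b)) = (\<lambda>D. ((D \<bullet> (a + b))\<^sup>2 - (D \<bullet> (a - b))\<^sup>2) / 4)"
    by (simp add: fun_eq_iff inner_add_right inner_diff_right power2_eq_square algebra_simps)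
  then have "(\<integral>D. (D \<bullet> a) * (D \<bullet> b) \<partial>sphere_uniform)
      = ((norm (a + b))\<^sup>2 / DIM('a) - (norm (a - b))\<^sup>2 / DIM('a)) / 4"
    using int by (simp add: integral_sphere_inner_square)
  also have "\<dots> = (a \<bullet> b) / DIM('a)"
    by (simp add: power2_norm_eq_inner inner_add inner_diff inner_commute flip: diff_divide_distrib)
  finally show ?thesis .
qed

section \<open>Smooth functions\<close>

text \<open>The gradient bound compares \<open>y\<close> with the centre only, not two arbitrary
  points of the ball; this is the form in which the constants \<open>phiK\<close> are given.\<close>

definition smooth_at :: "('a::real_inner \<Rightarrow> real) \<Rightarrow> ('a \<Rightarrow> 'a) \<Rightarrow> real \<Rightarrow> real \<Rightarrow> 'a \<Rightarrow> bool" where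
  "smooth_at f g \<phi> \<rho> x \<longleftrightarrow>
     (\<forall>y. norm (y - x) \<le> \<rho> \<longrightarrow> GDERIV f y :> g y \<and> norm (g y - g x) \<le> \<phi> * norm (y - x))"

lemma smooth_atD:
  assumes "smooth_at f g \<phi> \<rho> x" "norm (y - x) \<le> \<rho>"
  shows "GDERIV f y :> g y" "norm (g y - g x) \<le> \<phi> * norm (y - x)"
  using assms by (auto simp: smooth_at_def)

lemma smooth_at_quadratic_bound:
  assumes s: "smooth_at f g \<phi> \<rho> x" and y: "norm (y - x) \<le> \<rho>"
  shows "\<bar>f y - f x - g x \<bullet> (y - x)\<bar> \<le> \<phi> / 2 * (norm (y - x))\<^sup>2"
proof -
  define w where "w = y - x"
  define u where "u t = f (x + t *\<^sub>R w) - t * (g x \<bullet> w)" for t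
  have seg: "norm ((x + t *\<^sub>R w) - x) \<le> \<rho>" if "0 \<le> t" "t \<le> 1" for t
    using that y mult_left_le_one_le[of "norm w" t] by (simp add: w_def)
  have du: "(u has_real_derivative (g (x + t *\<^sub>R w) - g x) \<bullet> w) (at t)" if "0 \<le> t" "t \<le> 1" for t
  proof -
    have "(f has_derivative (\<lambda>h. h \<bullet> g (x + t *\<^sub>R w))) (at (x + t *\<^sub>R w))"
      using smooth_atD(1)[OF s seg[OF that]] by (simp add: gderiv_def)
    then have "((\<lambda>t. f (x + t *\<^sub>R w)) has_derivative (\<lambda>h. (h *\<^sub>R w) \<bullet> g (x + t *\<^sub>R w))) (at t)"
      by (rule has_derivative_compose[rotated]) (auto intro!: derivative_eq_intros)
    then have "((\<lambda>t. f (x + t *\<^sub>R w)) has_real_derivative (w \<bullet> g (x + t *\<^sub>R w))) (at t)"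
      unfolding has_field_derivative_def by (rule has_derivative_eq_rhs) (simp add: fun_eq_iff mult.commute)
    then show ?thesis unfolding u_def
      by (auto intro!: derivative_eq_intros simp: inner_diff_left inner_diff_right inner_commute)
  qed
  have bd: "\<bar>(g (x + t *\<^sub>R w) - g x) \<bullet> w\<bar> \<le> \<phi> * t * (norm w)\<^sup>2" if "0 \<le> t" "t \<le> 1" for t
  proof -
    have "\<bar>(g (x + t *\<^sub>R w) - g x) \<bullet> w\<bar> \<le> norm (g (x + t *\<^sub>R w) - g x) * norm w"
      by (rule Cauchy_Schwarz_ineq2)
    also have "\<dots> \<le> (\<phi> * norm ((x + t *\<^sub>R w) - x)) * norm w"
      by (intro mult_right_mono smooth_atD(2)[OF s seg[OF that]]) simp
    finally show ?thesis using that by (simp add: power2_eq_square mult_ac)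
  qed
  define q where "q t = \<phi> / 2 * t\<^sup>2 * (norm w)\<^sup>2" for t
  have dq: "(q has_real_derivative \<phi> * t * (norm w)\<^sup>2) (at t)" for t
    unfolding q_def by (auto intro!: derivative_eq_intros)
  \<comment> \<open>By \<open>bd\<close> the derivative of \<open>q\<close> dominates the modulus of
    that of \<open>u\<close>, so both \<open>q - u\<close> and \<open>q + u\<close> are
    nondecreasing along the segment.\<close>
  have "q 0 - u 0 \<le> q 1 - u 1"
    by (rule DERIV_nonneg_imp_nondecreasing)
      (use bd in \<open>force intro!: exI DERIV_diff[OF dq du]\<close>)+
  moreover have "q 0 + u 0 \<le> q 1 + u 1"
    by (rule DERIV_nonneg_imp_nondecreasing)
      (use bd in \<open>force intro!: exI DERIV_add[OF dq du]\<close>)+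
  ultimately have "\<bar>u 1 - u 0\<bar> \<le> q 1 - q 0" by simp
  moreover have "u 1 - u 0 = f y - f x - g x \<bullet> (y - x)" by (simp add: u_def w_def)
  ultimately show ?thesis by (simp add: q_def w_def)
qed

text \<open>The gradient of the remainder in \<open>D\<close> is \<open>r\<close> times
  \<open>g (x + r *\<^sub>R D) - g x\<close>, and the difference has norm at most
  \<open>\<phi> * r\<close>.\<close>

lemma smooth_at_remainder_lipschitz:
  assumes s: "smooth_at f g \<phi> \<rho> x" and r: "0 < r" "r \<le> \<rho>" and \<phi>: "0 \<le> \<phi>"
  shows "(\<phi> * r\<^sup>2)-lipschitz_on (cball 0 1) (\<lambda>D. f (x + r *\<^sub>R D) - f x - r * (g x \<bullet> D))"
proof (rule lipschitz_onI)
  show "0 \<le> \<phi> * r\<^sup>2" using \<phi> by simp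
  let ?h = "\<lambda>D. f (x + r *\<^sub>R D) - f x - r * (g x \<bullet> D)"
  fix D D' :: 'a assume DD: "D \<in> cball 0 1" "D' \<in> cball 0 1"
  have "norm (?h D - ?h D') \<le> (\<phi> * r\<^sup>2) * norm (D - D')"
  proof (rule differentiable_bound[OF convex_cball _ _ DD])
    fix E :: 'a assume "E \<in> cball 0 1"
    then have E: "norm ((x + r *\<^sub>R E) - x) \<le> r" using r mult_left_mono[of "norm E" 1 r] by simp
    then have E': "norm ((x + r *\<^sub>R E) - x) \<le> \<rho>" using r(2) by linarith
    have "(f has_derivative (\<lambda>h. h \<bullet> g (x + r *\<^sub>R E))) (at (x + r *\<^sub>R E))"
      using smooth_atD(1)[OF s E'] by (simp add: gderiv_def)
    then have "((\<lambda>E. f (x + r *\<^sub>R E)) has_derivative (\<lambda>h. (r *\<^sub>R h) \<bullet> g (x + r *\<^sub>R E))) (at E)"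
      by (rule has_derivative_compose[rotated]) (auto intro!: derivative_eq_intros)
    then have "(?h has_derivative (\<lambda>h. r * ((g (x + r *\<^sub>R E) - g x) \<bullet> h))) (at E)"
      by (auto intro!: derivative_eq_intros simp: inner_diff_left inner_diff_right inner_commute right_diff_distrib)
    then show "(?h has_derivative (\<lambda>h. r * ((g (x + r *\<^sub>R E) - g x) \<bullet> h))) (at E within cball 0 1)"
      by (rule has_derivative_at_withinI)
    show "onorm (\<lambda>h. r * ((g (x + r *\<^sub>R E) - g x) \<bullet> h)) \<le> \<phi> * r\<^sup>2"
    proof (rule onorm_bound)
      fix h
      have "norm (g (x + r *\<^sub>R E) - g x) \<le> \<phi> * r"
        using smooth_atD(2)[OF s E'] mult_left_mono[OF E \<phi>] by linarith
      then have "\<bar>(g (x + r *\<^sub>R E) - g x) \<bullet> h\<bar> \<le> (\<phi> * r) * norm h"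
        by (meson Cauchy_Schwarz_ineq2 mult_right_mono norm_ge_zero order_trans)
      then have "r * \<bar>(g (x + r *\<^sub>R E) - g x) \<bullet> h\<bar> \<le> r * ((\<phi> * r) * norm h)"
        using r by (intro mult_left_mono) auto
      then show "norm (r * ((g (x + r *\<^sub>R E) - g x) \<bullet> h)) \<le> \<phi> * r\<^sup>2 * norm h"
        using r by (simp add: abs_mult power2_eq_square mult_ac)
    qed (use \<phi> in simp)
  qed
  then show "dist (?h D) (?h D') \<le> \<phi> * r\<^sup>2 * dist D D'" by (simp add: dist_norm)
qed

lemma smooth_at_value_bound:
  assumes s: "smooth_at f g \<phi> \<rho> x" and r: "0 < r" "r \<le> \<rho>" and D: "norm D = 1"
  shows "\<bar>f (x + r *\<^sub>R D) - f x\<bar> \<le> r * norm (g x) + \<phi> / 2 * r\<^sup>2"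
proof -
  have "\<bar>f (x + r *\<^sub>R D) - f x - g x \<bullet> (r *\<^sub>R D)\<bar> \<le> \<phi> / 2 * r\<^sup>2"
    using smooth_at_quadratic_bound[OF s, of "x + r *\<^sub>R D"] r D by simp
  moreover have "\<bar>g x \<bullet> (r *\<^sub>R D)\<bar> \<le> r * norm (g x)"
    using Cauchy_Schwarz_ineq2[of "g x" "r *\<^sub>R D"] r D by (simp add: mult.commute)
  ultimately show ?thesis by linarith
qed

text \<open>In the first-order expansion of \<open>f\<close> the constant term averages out, and the
  linear term reproduces \<open>g x\<close> because the second moment of \<open>D\<close> is the
  identity over the dimension. Bounding the remainder by its size would leave a factor of the
  dimension; using its Lipschitz constant in \<open>sphere_lipschitz_integral\<close> cancels that
  factor.\<close>

lemma smoothing_bias: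
  fixes f :: "'a::euclidean_space \<Rightarrow> real"
  assumes s: "smooth_at f g \<phi> \<rho> x" and r: "0 < r" "r \<le> \<rho>" and \<phi>: "0 \<le> \<phi>"
    and [measurable]: "f \<in> borel_measurable borel"
  shows "integrable sphere_uniform (\<lambda>D. (f (x + r *\<^sub>R D) * (DIM('a) / r)) *\<^sub>R D)"
    and "norm ((\<integral>D. (f (x + r *\<^sub>R D) * (DIM('a) / r)) *\<^sub>R D \<partial>sphere_uniform) - g x) \<le> \<phi> * r"
proof -
  let ?d = "real DIM('a)"
  define C where "C = \<bar>f x\<bar> + r * norm (g x) + \<phi> / 2 * r\<^sup>2"
  have C: "\<bar>f (x + r *\<^sub>R D)\<bar> \<le> C" if "norm D = 1" for D
    using smooth_at_value_bound[OF s r that] by (simp add: C_def)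
  show int: "integrable sphere_uniform (\<lambda>D. (f (x + r *\<^sub>R D) * (?d / r)) *\<^sub>R D)"
  proof (rule integrable_sphere_uniform[where C="C * (?d / r)"])
    show "norm ((f (x + r *\<^sub>R D) * (?d / r)) *\<^sub>R D) \<le> C * (?d / r)" if "norm D = 1" for D
      using C[OF that] that r by (simp add: abs_mult divide_right_mono mult_right_mono)
  qed measurable
  define h where "h D = f (x + r *\<^sub>R D) - f x - r * (g x \<bullet> D)" for D
  have [measurable]: "h \<in> borel_measurable borel" unfolding h_def by measurable
  \<comment> \<open>The bias vector itself is the test direction, so the bound on
    \<open>w \<bullet> w\<close> is a bound on its norm.\<close>
  define w where "w = (\<integral>D. (f (x + r *\<^sub>R D) * (?d / r)) *\<^sub>R D \<partial>sphere_uniform) - g x"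
  have ih: "integrable sphere_uniform (\<lambda>D. h D * (D \<bullet> w))"
  proof (rule integrable_sphere_uniform[where C="(C + \<bar>f x\<bar> + r * norm (g x)) * norm w"])
    fix D :: 'a assume D: "norm D = 1"
    have "\<bar>g x \<bullet> D\<bar> \<le> norm (g x)" using Cauchy_Schwarz_ineq2[of "g x" D] D by simp
    then have "\<bar>r * (g x \<bullet> D)\<bar> \<le> r * norm (g x)" using r by (simp add: abs_mult)
    then have "\<bar>h D\<bar> \<le> C + \<bar>f x\<bar> + r * norm (g x)" using C[OF D] by (simp add: h_def)
    then show "norm (h D * (D \<bullet> w)) \<le> (C + \<bar>f x\<bar> + r * norm (g x)) * norm w"
      using abs_inner_unit[OF D, of w] by (simp add: abs_mult mult_mono')
  qed measurable
  have "(\<integral>D. (f (x + r *\<^sub>R D) * (?d / r)) *\<^sub>R D \<partial>sphere_uniform) \<bullet> w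
      = (\<integral>D. ((f (x + r *\<^sub>R D) * (?d / r)) *\<^sub>R D) \<bullet> w \<partial>sphere_uniform)"
    by (rule integral_inner_left[symmetric]) (rule int)
  also have "\<dots> = (\<integral>D. (?d / r * f x) * (D \<bullet> w) + ?d * ((D \<bullet> g x) * (D \<bullet> w)) + ?d / r * (h D * (D \<bullet> w)) \<partial>sphere_uniform)"
    using r by (intro Bochner_Integration.integral_cong) (auto simp: h_def inner_commute field_simps)
  also have "\<dots> = g x \<bullet> w + ?d / r * (\<integral>D. h D * (D \<bullet> w) \<partial>sphere_uniform)"
    using ih integrable_sphere_inner[of w] integrable_sphere_inner_mult[of "g x" w]
    by (simp add: integral_sphere_inner integral_sphere_inner_mult)
  finally have "w \<bullet> w = ?d / r * (\<integral>D. h D * (D \<bullet> w) \<partial>sphere_uniform)"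
    by (simp add: w_def inner_diff_left)
  also have "\<dots> \<le> ?d / r * ((\<phi> * r\<^sup>2) * norm w / ?d)"
  proof (rule mult_left_mono)
    show "(\<integral>D. h D * (D \<bullet> w) \<partial>sphere_uniform) \<le> (\<phi> * r\<^sup>2) * norm w / ?d"
      using sphere_lipschitz_integral[OF smooth_at_remainder_lipschitz[OF s r \<phi>], of w]
      unfolding h_def[symmetric] by simp
  qed (use r in simp)
  also have "\<dots> = \<phi> * r * norm w" using r by (simp add: power2_eq_square)
  finally have "norm w * norm w \<le> \<phi> * r * norm w" by (simp add: power2_norm_eq_inner flip: power2_eq_square)
  then have "norm w \<le> \<phi> * r" using \<phi> r by (cases "norm w = 0") auto
  then show "norm ((\<integral>D. (f (x + r *\<^sub>R D) * (?d / r)) *\<^sub>R D \<partial>sphere_uniform) - g x) \<le> \<phi> * r"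
    by (simp add: w_def)
qed

text \<open>
  The smoothness radius \<open>\<rho>\<close> plays no role in the bound: gradient descent from \<open>x\<close> along the
  fixed direction \<open>g x\<close>, in steps shorter than \<open>\<rho>\<close>, decreases \<open>f\<close> and hence never leaves
  \<open>S\<close>, so it can be continued up to total length \<open>1 / \<phi>\<close>.
\<close>

lemma gradient_norm_square_le:
  assumes s: "\<And>x. x \<in> S \<Longrightarrow> smooth_at f g \<phi> \<rho> x"
    and sub: "\<And>x y. x \<in> S \<Longrightarrow> norm (y - x) \<le> \<rho> \<Longrightarrow> f y \<le> f x \<Longrightarrow> y \<in> S"
    and nonneg: "\<And>x. x \<in> S \<Longrightarrow> 0 \<le> f x" and \<rho>: "0 < \<rho>" and \<phi>: "0 < \<phi>" and x: "x \<in> S"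
  shows "(norm (g x))\<^sup>2 \<le> 2 * \<phi> * f x"
proof -
  define G where "G = norm (g x)"
  \<comment> \<open>\<open>N\<close> steps of size \<open>1 / (\<phi> * N)\<close> have total size
    \<open>1 / \<phi>\<close>, and \<open>N\<close> is large enough for each to be at most
    \<open>\<rho>\<close> long.\<close>
  obtain N :: nat where N: "G / (\<phi> * \<rho>) < real N" using reals_Archimedean2 by blast
  have "0 \<le> G / (\<phi> * \<rho>)" using \<rho> \<phi> by (simp add: G_def)
  with N have N0: "0 < real N" by linarith
  define h where "h = 1 / (\<phi> * N)"
  have h: "0 < h" using N0 \<phi> by (simp add: h_def)
  have hG: "h * G \<le> \<rho>" using N N0 \<phi> \<rho> by (simp add: h_def field_simps)
  define y where "y n = x - (real n * h) *\<^sub>R g x" for n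
  have step: "y (Suc n) - y n = - (h *\<^sub>R g x)" for n by (simp add: y_def algebra_simps)
  have nstep: "norm (y (Suc n) - y n) = h * G" for n using h by (simp add: step G_def)
  \<comment> \<open>Since \<open>smooth_at\<close> relates neighbouring points only, the distance
    from \<open>g (y n)\<close> to \<open>g x\<close> is accumulated step by step and carried in the
    invariant.\<close>
  have inv: "y n \<in> S \<and> f (y n) \<le> f x - real n * h * (1 - \<phi> * (real n * h) / 2) * G\<^sup>2
      \<and> norm (g (y n) - g x) \<le> \<phi> * (real n * h) * G" if "n \<le> N" for n
    using that
  proof (induction n)
    case 0
    then show ?case using x by (simp add: y_def)
  next
    case (Suc n)
    then have IH: "y n \<in> S" "f (y n) \<le> f x - real n * h * (1 - \<phi> * (real n * h) / 2) * G\<^sup>2"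
      "norm (g (y n) - g x) \<le> \<phi> * (real n * h) * G" by auto
    note sn = s[OF IH(1)]
    have near: "norm (y (Suc n) - y n) \<le> \<rho>" using nstep hG by simp
    have "\<bar>(g (y n) - g x) \<bullet> g x\<bar> \<le> \<phi> * (real n * h) * G * G"
      using Cauchy_Schwarz_ineq2[of "g (y n) - g x" "g x"] mult_right_mono[OF IH(3), of G]
      by (simp add: G_def)
    then have inn: "g (y n) \<bullet> g x \<ge> G\<^sup>2 - \<phi> * (real n * h) * G\<^sup>2"
      by (simp add: G_def inner_diff_left power2_eq_square flip: norm_eq_square power2_norm_eq_inner) 
    have "f (y (Suc n)) \<le> f (y n) + g (y n) \<bullet> (y (Suc n) - y n) + \<phi> / 2 * (h * G)\<^sup>2"
      using smooth_at_quadratic_bound[OF sn near] unfolding nstep by linarith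
    also have "g (y n) \<bullet> (y (Suc n) - y n) = - h * (g (y n) \<bullet> g x)" by (simp add: step)
    also have "\<dots> \<le> - h * (G\<^sup>2 - \<phi> * (real n * h) * G\<^sup>2)"
      using inn h by (simp add: mult_left_mono)
    finally have one: "f (y (Suc n)) \<le> f (y n) - h * (1 - \<phi> * (real n * h) - \<phi> * h / 2) * G\<^sup>2"
      by (simp add: algebra_simps power_mult_distrib power2_eq_square)
    have "\<phi> * (real (Suc n) * h) \<le> 1"
      using Suc.prems \<phi> N0 by (simp add: h_def field_simps del: of_nat_Suc)
    moreover have "0 \<le> \<phi> * h" using \<phi> h by simp
    ultimately have "0 \<le> 1 - \<phi> * (real n * h) - \<phi> * h / 2" by (simp add: algebra_simps)
    then have "0 \<le> h * (1 - \<phi> * (real n * h) - \<phi> * h / 2) * G\<^sup>2" using h by simp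
    with one have "f (y (Suc n)) \<le> f (y n)" by linarith
    then have "y (Suc n) \<in> S" using sub[OF IH(1) near] by simp
    moreover have "f (y (Suc n)) \<le> f x - real (Suc n) * h * (1 - \<phi> * (real (Suc n) * h) / 2) * G\<^sup>2"
      using one IH(2) by (simp add: field_simps)
    moreover have "norm (g (y (Suc n)) - g x) \<le> \<phi> * (real (Suc n) * h) * G"
      using smooth_atD(2)[OF sn near] IH(3) norm_triangle_ineq[of "g (y (Suc n)) - g (y n)" "g (y n) - g x"]
      unfolding nstep by (simp add: algebra_simps)
    ultimately show ?case by blast
  qed
  have Nh: "real N * h = 1 / \<phi>" using N0 by (simp add: h_def)
  have "0 \<le> f (y N)" "f (y N) \<le> f x - (1 / \<phi>) * (1 - \<phi> * (1 / \<phi>) / 2) * G\<^sup>2"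
    using inv[of N] nonneg unfolding Nh by auto
  then have "0 \<le> f x - G\<^sup>2 / (2 * \<phi>)" using \<phi> by simp
  then show ?thesis using \<phi> by (simp add: G_def field_simps)
qed

section \<open>Expected decrease of a noisy gradient step\<close>

lemma (in prob_space) integrable_bounded:
  fixes h :: "'a \<Rightarrow> 'b::{banach, second_countable_topology}"
  assumes "h \<in> borel_measurable M" "AE z in M. norm (h z) \<le> b"
  shows "integrable M h"
  using integrable_const_bound[OF assms(2,1)] .

lemma (in prob_space) norm_integral_le_const:
  fixes h :: "'a \<Rightarrow> 'b::{banach, second_countable_topology}"
  assumes "h \<in> borel_measurable M" "AE z in M. norm (h z) \<le> b"
  shows "norm (\<integral>z. h z \<partial>M) \<le> b"
proof -
  have "norm (\<integral>z. h z \<partial>M) \<le> (\<integral>z. norm (h z) \<partial>M)" by (rule integral_norm_bound)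
  also have "\<dots> \<le> (\<integral>z. b \<partial>M)"
    using assms integrable_bounded[OF assms] by (intro integral_mono_AE) auto
  finally show ?thesis by (simp add: prob_space)
qed

lemma (in prob_space) integrable_norm_square_bounded:
  fixes h :: "'a \<Rightarrow> 'b::euclidean_space"
  assumes [measurable]: "h \<in> borel_measurable M" and b: "AE z in M. norm (h z) \<le> b"
  shows "integrable M (\<lambda>z. (norm (h z))\<^sup>2)"
proof (rule integrable_bounded)
  show "AE z in M. norm ((norm (h z))\<^sup>2) \<le> b\<^sup>2"
    using b by eventually_elim (simp add: power_mono)
qed measurable

lemma (in prob_space) norm_square_integral_decompose:
  fixes h :: "'a \<Rightarrow> 'b::euclidean_space"
  assumes [measurable]: "h \<in> borel_measurable M" and b: "AE z in M. norm (h z) \<le> b"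
  shows "(\<integral>z. (norm (h z - c))\<^sup>2 \<partial>M)
    = (\<integral>z. (norm (h z - (\<integral>z. h z \<partial>M)))\<^sup>2 \<partial>M) + (norm ((\<integral>z. h z \<partial>M) - c))\<^sup>2"
proof -
  define m where "m = (\<integral>z. h z \<partial>M)"
  have h: "integrable M h" by (rule integrable_bounded) fact+
  have h2: "integrable M (\<lambda>z. (norm (h z))\<^sup>2)" by (rule integrable_norm_square_bounded) fact+
  have "(\<integral>z. (norm (h z - c))\<^sup>2 \<partial>M) = (\<integral>z. (norm (h z))\<^sup>2 \<partial>M) - 2 * (m \<bullet> c) + (norm c)\<^sup>2" for c
  proof -
    have "(\<lambda>z. (norm (h z - c))\<^sup>2) = (\<lambda>z. (norm (h z))\<^sup>2 - 2 * (h z \<bullet> c) + (norm c)\<^sup>2)"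
      by (simp add: fun_eq_iff power2_norm_eq_inner inner_diff inner_commute)
    then show ?thesis using h h2 by (simp add: m_def prob_space)
  qed
  from this[of c] this[of m] show ?thesis
    by (simp add: m_def[symmetric] power2_norm_eq_inner inner_diff inner_commute)
qed

text \<open>The mean minimises the mean squared distance, so the perturbed variable may be centred
  at the mean of \<open>h\<close> instead of its own; Young's inequality then separates the noise
  from the perturbation.\<close>

lemma (in prob_space) perturbed_second_moment:
  fixes h e :: "'a \<Rightarrow> 'b::euclidean_space"
  assumes [measurable]: "h \<in> borel_measurable M" "e \<in> borel_measurable M"
    and b: "AE z in M. norm (h z) \<le> b" and e: "AE z in M. norm (e z) \<le> c"
  shows "(\<integral>z. (norm (h z - e z))\<^sup>2 \<partial>M)
    \<le> (norm (\<integral>z. h z - e z \<partial>M))\<^sup>2 + 3 / 2 * (\<integral>z. (norm (h z - (\<integral>z. h z \<partial>M)))\<^sup>2 \<partial>M) + 3 * c\<^sup>2"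
proof -
  define m where "m = (\<integral>z. h z \<partial>M)"
  let ?k = "\<lambda>z. h z - e z"
  have k: "AE z in M. norm (?k z) \<le> b + c"
    using b e by eventually_elim (rule norm_triangle_le_diff, simp)
  have hm: "AE z in M. norm (h z - m) \<le> b + norm m"
    using b by eventually_elim (rule norm_triangle_le_diff, simp)
  have km: "AE z in M. norm (?k z - m) \<le> b + c + norm m"
    using k by eventually_elim (rule norm_triangle_le_diff, simp)
  have "(\<integral>z. (norm (?k z))\<^sup>2 \<partial>M) = (\<integral>z. (norm (?k z - (\<integral>z. ?k z \<partial>M)))\<^sup>2 \<partial>M) + (norm (\<integral>z. ?k z \<partial>M))\<^sup>2"
    using norm_square_integral_decompose[OF _ k, of 0] by simp
  also have "(\<integral>z. (norm (?k z - (\<integral>z. ?k z \<partial>M)))\<^sup>2 \<partial>M) \<le> (\<integral>z. (norm (?k z - m))\<^sup>2 \<partial>M)"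
    using norm_square_integral_decompose[OF _ k, of m] by simp
  also have "\<dots> \<le> (\<integral>z. 3 / 2 * (norm (h z - m))\<^sup>2 + 3 * c\<^sup>2 \<partial>M)"
  proof (rule integral_mono_AE)
    show "integrable M (\<lambda>z. (norm (?k z - m))\<^sup>2)" by (rule integrable_norm_square_bounded[OF _ km]) measurable
    show "integrable M (\<lambda>z. 3 / 2 * (norm (h z - m))\<^sup>2 + 3 * c\<^sup>2)"
      using integrable_norm_square_bounded[OF _ hm] by simp
    show "AE z in M. (norm (?k z - m))\<^sup>2 \<le> 3 / 2 * (norm (h z - m))\<^sup>2 + 3 * c\<^sup>2"
      using e
    proof eventually_elim
      case (elim z)
      have "norm (?k z - m) \<le> norm (h z - m) + c"
        using norm_triangle_ineq4[of "h z - m" "e z"] elim by (simp add: algebra_simps)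
      then have "(norm (?k z - m))\<^sup>2 \<le> (norm (h z - m) + c)\<^sup>2" by (simp add: power_mono)
      \<comment> \<open>The difference of the two sides is half the square of
        \<open>norm (h z - m) - 2 * c\<close>.\<close>
      also have "\<dots> \<le> 3 / 2 * (norm (h z - m))\<^sup>2 + 3 * c\<^sup>2"
        using zero_le_power2[of "norm (h z - m) - 2 * c"] by (simp add: power2_eq_square algebra_simps)
      finally show ?case .
    qed
  qed
  also have "\<dots> = 3 / 2 * (\<integral>z. (norm (h z - m))\<^sup>2 \<partial>M) + 3 * c\<^sup>2"
    using integrable_norm_square_bounded[OF _ hm] by (simp add: prob_space)
  finally show ?thesis by (simp add: m_def)
qed

text \<open>The quadratic bound is integrated over the step. The bias costs at most
  \<open>norm (g x) * e\<close> in the first-order term, and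
  \<open>\<phi> * \<eta> \<le> 1 / 4\<close> reduces the second-order term to
  \<open>\<eta> / 8\<close> times \<open>(norm (g x) + e)\<^sup>2\<close>, apart from the variance
  part \<open>V\<close>.\<close>

lemma (in prob_space) expected_descent:
  fixes f :: "'b::euclidean_space \<Rightarrow> real" and h :: "'a \<Rightarrow> 'b"
  assumes s: "smooth_at f g \<phi> \<rho> x" and f [measurable]: "f \<in> borel_measurable borel"
    and h [measurable]: "h \<in> borel_measurable M" and bd: "AE z in M. \<eta> * norm (h z) \<le> \<rho>"
    and \<eta>: "0 < \<eta>" and \<phi>: "0 < \<phi>" "\<phi> * \<eta> \<le> 1 / 4"
    and bias: "norm ((\<integral>z. h z \<partial>M) - g x) \<le> e"
    and second: "(\<integral>z. (norm (h z))\<^sup>2 \<partial>M) \<le> (norm (g x) + e)\<^sup>2 + V"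
  shows "integrable M (\<lambda>z. f (x - \<eta> *\<^sub>R h z))"
    and "(\<integral>z. f (x - \<eta> *\<^sub>R h z) \<partial>M)
      \<le> f x + \<eta> * (5 / 4 * norm (g x) * e + e\<^sup>2 / 8 - 7 / 8 * (norm (g x))\<^sup>2) + \<phi> * \<eta>\<^sup>2 / 2 * V"
proof -
  define G where "G = norm (g x)"
  have hb: "AE z in M. norm (h z) \<le> \<rho> / \<eta>"
    using bd by eventually_elim (use \<eta> in \<open>simp add: field_simps\<close>)
  have hi: "integrable M h" by (rule integrable_bounded[OF h hb])
  have h2: "integrable M (\<lambda>z. (norm (h z))\<^sup>2)" by (rule integrable_norm_square_bounded[OF h hb])
  have q: "AE z in M. \<bar>f (x - \<eta> *\<^sub>R h z) - f x + \<eta> * (g x \<bullet> h z)\<bar> \<le> \<phi> * \<eta>\<^sup>2 / 2 * (norm (h z))\<^sup>2"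
    using bd
  proof eventually_elim
    case (elim z)
    then show ?case
      using smooth_at_quadratic_bound[OF s, of "x - \<eta> *\<^sub>R h z"] \<eta> by (simp add: power_mult_distrib)
  qed
  show int: "integrable M (\<lambda>z. f (x - \<eta> *\<^sub>R h z))"
  proof (rule Bochner_Integration.integrable_bound)
    show "integrable M (\<lambda>z. \<bar>f x\<bar> + \<eta> * \<bar>g x \<bullet> h z\<bar> + \<phi> * \<eta>\<^sup>2 / 2 * (norm (h z))\<^sup>2)"
      using hi h2 by (intro Bochner_Integration.integrable_add integrable_mult_right integrable_abs) auto
    show "AE z in M. norm (f (x - \<eta> *\<^sub>R h z)) \<le> norm (\<bar>f x\<bar> + \<eta> * \<bar>g x \<bullet> h z\<bar> + \<phi> * \<eta>\<^sup>2 / 2 * (norm (h z))\<^sup>2)"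
      using q
    proof eventually_elim
      case (elim z)
      moreover have "\<bar>\<eta> * (g x \<bullet> h z)\<bar> = \<eta> * \<bar>g x \<bullet> h z\<bar>" using \<eta> by (simp add: abs_mult)
      ultimately show ?case by (smt (verit) real_norm_def)
    qed
  qed measurable
  have "(\<integral>z. f (x - \<eta> *\<^sub>R h z) \<partial>M) \<le> (\<integral>z. f x - \<eta> * (g x \<bullet> h z) + \<phi> * \<eta>\<^sup>2 / 2 * (norm (h z))\<^sup>2 \<partial>M)"
  proof (rule integral_mono_AE[OF int])
    show "integrable M (\<lambda>z. f x - \<eta> * (g x \<bullet> h z) + \<phi> * \<eta>\<^sup>2 / 2 * (norm (h z))\<^sup>2)"
      using hi h2 by simp
    show "AE z in M. f (x - \<eta> *\<^sub>R h z) \<le> f x - \<eta> * (g x \<bullet> h z) + \<phi> * \<eta>\<^sup>2 / 2 * (norm (h z))\<^sup>2"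
      using q by eventually_elim linarith
  qed
  also have "\<dots> = f x - \<eta> * (g x \<bullet> (\<integral>z. h z \<partial>M)) + \<phi> * \<eta>\<^sup>2 / 2 * (\<integral>z. (norm (h z))\<^sup>2 \<partial>M)"
    using hi h2 by (simp add: prob_space)
  finally have 1: "(\<integral>z. f (x - \<eta> *\<^sub>R h z) \<partial>M) \<le> \<dots>" .
  have 2: "G\<^sup>2 - G * e \<le> g x \<bullet> (\<integral>z. h z \<partial>M)"
  proof -
    have "\<bar>g x \<bullet> ((\<integral>z. h z \<partial>M) - g x)\<bar> \<le> G * e"
      unfolding G_def by (rule order_trans[OF Cauchy_Schwarz_ineq2 mult_left_mono[OF bias]]) simp
    then show ?thesis by (simp add: inner_diff_right G_def power2_norm_eq_inner abs_le_iff)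
  qed
  have 3: "\<phi> * \<eta>\<^sup>2 / 2 * (\<integral>z. (norm (h z))\<^sup>2 \<partial>M) \<le> \<eta> / 8 * (G + e)\<^sup>2 + \<phi> * \<eta>\<^sup>2 / 2 * V"
  proof -
    have "\<phi> * \<eta>\<^sup>2 / 2 * (\<integral>z. (norm (h z))\<^sup>2 \<partial>M) \<le> \<phi> * \<eta>\<^sup>2 / 2 * ((G + e)\<^sup>2 + V)"
      unfolding G_def using second \<phi> by (intro mult_left_mono) auto
    also have "\<dots> = (\<phi> * \<eta>) * (\<eta> / 2 * (G + e)\<^sup>2) + \<phi> * \<eta>\<^sup>2 / 2 * V"
      by (simp add: power2_eq_square algebra_simps)
    also have "(\<phi> * \<eta>) * (\<eta> / 2 * (G + e)\<^sup>2) \<le> 1 / 4 * (\<eta> / 2 * (G + e)\<^sup>2)"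
      using \<phi>(2) \<eta> by (intro mult_right_mono) auto
    finally show ?thesis by simp
  qed
  from 1 3 mult_left_mono[OF 2, of \<eta>] \<eta>
  have "(\<integral>z. f (x - \<eta> *\<^sub>R h z) \<partial>M) \<le> f x - \<eta> * (G\<^sup>2 - G * e) + (\<eta> / 8 * (G + e)\<^sup>2 + \<phi> * \<eta>\<^sup>2 / 2 * V)"
    by linarith
  also have "\<dots> = f x + \<eta> * (5 / 4 * G * e + e\<^sup>2 / 8 - 7 / 8 * G\<^sup>2) + \<phi> * \<eta>\<^sup>2 / 2 * V"
    by (simp add: power2_eq_square algebra_simps)
  finally show "(\<integral>z. f (x - \<eta> *\<^sub>R h z) \<partial>M)
      \<le> f x + \<eta> * (5 / 4 * norm (g x) * e + e\<^sup>2 / 8 - 7 / 8 * (norm (g x))\<^sup>2) + \<phi> * \<eta>\<^sup>2 / 2 * V"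
    by (simp add: G_def)
qed

text \<open>Both bounds complete the square in \<open>G\<close>; the second one first sets \<open>G\<^sup>2 / 4\<close> aside.\<close>

lemma drift_bounds:
  fixes G e w \<mu> \<epsilon> :: real
  assumes "e\<^sup>2 \<le> \<mu> * \<epsilon> / 80" "w \<le> 9 / 3840 * (\<mu> * \<epsilon>)" "0 \<le> \<mu> * \<epsilon>"
  shows "5 / 4 * G * e + e\<^sup>2 / 8 - 7 / 8 * G\<^sup>2 + w \<le> \<mu> * \<epsilon> / 100"
    and "5 / 4 * G * e + e\<^sup>2 / 8 - 7 / 8 * G\<^sup>2 + w \<le> \<mu> * \<epsilon> / 80 - G\<^sup>2 / 4"
proof -
  have "0 \<le> 7 / 8 * (G - 5 / 7 * e)\<^sup>2" "0 \<le> 5 / 8 * (G - e)\<^sup>2" by simp_all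
  then have "5 / 4 * G * e \<le> 7 / 8 * G\<^sup>2 + 25 / 56 * e\<^sup>2" "5 / 4 * G * e \<le> 5 / 8 * G\<^sup>2 + 5 / 8 * e\<^sup>2"
    by (simp_all add: power2_eq_square algebra_simps)
  \<comment> \<open>The numbers are \<open>(25/56 + 1/8) / 80 + 9/3840 < 1/100\<close> and
    \<open>(5/8 + 1/8) / 80 + 9/3840 < 1/80\<close>; in the second bound \<open>5/8 - 7/8\<close>
    leaves \<open>- 1/4\<close> in front of the square of \<open>G\<close>.\<close>
  with assms show "5 / 4 * G * e + e\<^sup>2 / 8 - 7 / 8 * G\<^sup>2 + w \<le> \<mu> * \<epsilon> / 100"
    and "5 / 4 * G * e + e\<^sup>2 / 8 - 7 / 8 * G\<^sup>2 + w \<le> \<mu> * \<epsilon> / 80 - G\<^sup>2 / 4"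
    by linarith+
qed

section \<open>Recursions driven by independent samples\<close>

primrec noisy_iterate :: "('s \<Rightarrow> 'z \<Rightarrow> 's) \<Rightarrow> 's \<Rightarrow> (nat \<Rightarrow> 'z) \<Rightarrow> nat \<Rightarrow> 's" where
  "noisy_iterate \<Phi> k z 0 = k"
| "noisy_iterate \<Phi> k z (Suc s) = \<Phi> (noisy_iterate \<Phi> k z s) (z s)"

lemma noisy_iterate_cong:
  "(\<And>i. i < s \<Longrightarrow> z i = z' i) \<Longrightarrow> noisy_iterate \<Phi> k z s = noisy_iterate \<Phi> k z' s"
  by (induction s) simp_all

lemma measurable_noisy_iterate:
  fixes \<Phi> :: "'s::topological_space \<Rightarrow> 'z \<Rightarrow> 's"
  assumes \<Phi>: "case_prod \<Phi> \<in> borel_measurable (borel \<Otimes>\<^sub>M N)" and "s \<le> n"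
  shows "(\<lambda>z. noisy_iterate \<Phi> k z s) \<in> borel_measurable (PiM {..<n} (\<lambda>_. N))"
  using \<open>s \<le> n\<close>
proof (induction s)
  case (Suc s)
  then have [measurable]: "(\<lambda>z. noisy_iterate \<Phi> k z s) \<in> borel_measurable (PiM {..<n} (\<lambda>_. N))" by simp
  have [measurable]: "(\<lambda>z. z s) \<in> PiM {..<n} (\<lambda>_. N) \<rightarrow>\<^sub>M N"
    using Suc.prems by (intro measurable_component_singleton) auto
  have "(\<lambda>z. case_prod \<Phi> (noisy_iterate \<Phi> k z s, z s)) \<in> borel_measurable (PiM {..<n} (\<lambda>_. N))"
    by (rule measurable_compose[OF _ \<Phi>]) measurable
  then show ?case by simp
qed simp

context prob_space
begin

lemma measurable_noisy_iterate_samples: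
  fixes \<Phi> :: "'s::topological_space \<Rightarrow> 'z \<Rightarrow> 's"
  assumes Z: "\<And>s. s < T \<Longrightarrow> Z s \<in> M \<rightarrow>\<^sub>M N" and s: "s \<le> T"
    and \<Phi>: "case_prod \<Phi> \<in> borel_measurable (borel \<Otimes>\<^sub>M N)"
  shows "(\<lambda>\<omega>. noisy_iterate \<Phi> k (\<lambda>i. Z i \<omega>) s) \<in> borel_measurable M"
proof -
  have "(\<lambda>\<omega>. noisy_iterate \<Phi> k (restrict (\<lambda>i. Z i \<omega>) {..<s}) s) \<in> borel_measurable M"
    using Z s by (intro measurable_compose[OF _ measurable_noisy_iterate[OF \<Phi> order.refl]] measurable_restrict) auto
  also have "(\<lambda>\<omega>. noisy_iterate \<Phi> k (restrict (\<lambda>i. Z i \<omega>) {..<s}) s) = (\<lambda>\<omega>. noisy_iterate \<Phi> k (\<lambda>i. Z i \<omega>) s)"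
    by (intro ext noisy_iterate_cong) auto
  finally show ?thesis .
qed

text \<open>The iterate at time \<open>s\<close> is a function of the samples before
  \<open>s\<close>, hence independent of sample \<open>s\<close>, and their joint law is a product;
  Tonelli's theorem takes the place of a conditional expectation. Values in \<open>ennreal\<close>
  avoid integrability questions.\<close>

lemma noisy_iterate_nn_integral_step:
  fixes \<Phi> :: "'s::topological_space \<Rightarrow> 'z \<Rightarrow> 's" and W :: "'s \<Rightarrow> ennreal"
  assumes indep: "indep_vars (\<lambda>_. N) Z {..<T}" and s: "s < T" and law: "distr M N (Z s) = \<mu>"
    and \<Phi>: "case_prod \<Phi> \<in> borel_measurable (borel \<Otimes>\<^sub>M N)"
    and W [measurable]: "W \<in> borel_measurable borel"
    and step: "\<And>k. (\<integral>\<^sup>+z. W (\<Phi> k z) \<partial>\<mu>) \<le> a * W k + c"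
  shows "(\<integral>\<^sup>+\<omega>. W (noisy_iterate \<Phi> k (\<lambda>i. Z i \<omega>) (Suc s)) \<partial>M)
    \<le> a * (\<integral>\<^sup>+\<omega>. W (noisy_iterate \<Phi> k (\<lambda>i. Z i \<omega>) s) \<partial>M) + c"
proof -
  let ?P = "PiM {..<s} (\<lambda>_. N)" and ?Q = "PiM {s} (\<lambda>_. N)"
  let ?x = "\<lambda>\<omega>. restrict (\<lambda>i. Z i \<omega>) {..<s}" and ?y = "\<lambda>\<omega>. restrict (\<lambda>i. Z i \<omega>) {s}"
  let ?f = "\<lambda>x. noisy_iterate \<Phi> k x s"
  have ind: "indep_var ?P ?x ?Q ?y"
    using s by (intro indep_var_restrict[OF indep]) auto
  have [measurable]: "?x \<in> M \<rightarrow>\<^sub>M ?P" "?y \<in> M \<rightarrow>\<^sub>M ?Q"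
    using indep_var_rv1[OF ind] indep_var_rv2[OF ind] by auto
  have [measurable]: "Z s \<in> M \<rightarrow>\<^sub>M N" using indep s by (auto simp: indep_vars_def)
  have fm [measurable]: "?f \<in> borel_measurable ?P" by (rule measurable_noisy_iterate[OF \<Phi> order.refl])
  have cm [measurable]: "(\<lambda>y. y s) \<in> ?Q \<rightarrow>\<^sub>M N" by (intro measurable_component_singleton) auto
  have fx: "?f (?x \<omega>) = noisy_iterate \<Phi> k (\<lambda>i. Z i \<omega>) s" for \<omega> by (intro noisy_iterate_cong) auto
  interpret L: prob_space "distr M ?P ?x" by (rule prob_space_distr) measurable
  interpret R: prob_space "distr M ?Q ?y" by (rule prob_space_distr) measurable
  have m: "(\<lambda>p. W (case_prod \<Phi> p)) \<in> borel_measurable (borel \<Otimes>\<^sub>M N)"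
    by (rule measurable_compose[OF \<Phi> W])
  have m2: "(\<lambda>p. W (\<Phi> (?f (fst p)) (snd p s))) \<in> borel_measurable (?P \<Otimes>\<^sub>M ?Q)"
  proof -
    have "(\<lambda>p. (?f (fst p), snd p s)) \<in> ?P \<Otimes>\<^sub>M ?Q \<rightarrow>\<^sub>M borel \<Otimes>\<^sub>M N" by measurable
    from measurable_compose[OF this m] show ?thesis by simp
  qed
  have inner: "(\<integral>\<^sup>+y. W (\<Phi> x (y s)) \<partial>distr M ?Q ?y) \<le> a * W x + c" for x
  proof -
    have mx: "(\<lambda>z. W (\<Phi> x z)) \<in> borel_measurable N"
      using measurable_compose[OF measurable_Pair1' m, of x] by simp
    have "(\<integral>\<^sup>+y. W (\<Phi> x (y s)) \<partial>distr M ?Q ?y) = (\<integral>\<^sup>+\<omega>. W (\<Phi> x (Z s \<omega>)) \<partial>M)"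
      using measurable_compose[OF cm mx] by (subst nn_integral_distr) auto
    also have "\<dots> = (\<integral>\<^sup>+z. W (\<Phi> x z) \<partial>\<mu>)"
      unfolding law[symmetric] using mx by (subst nn_integral_distr) auto
    finally show ?thesis using step[of x] by simp
  qed
  have "(\<integral>\<^sup>+\<omega>. W (noisy_iterate \<Phi> k (\<lambda>i. Z i \<omega>) (Suc s)) \<partial>M)
      = (\<integral>\<^sup>+p. W (\<Phi> (?f (fst p)) (snd p s)) \<partial>distr M (?P \<Otimes>\<^sub>M ?Q) (\<lambda>\<omega>. (?x \<omega>, ?y \<omega>)))"
    by (subst nn_integral_distr) (use m2 in \<open>auto simp: fx\<close>)
  also have "distr M (?P \<Otimes>\<^sub>M ?Q) (\<lambda>\<omega>. (?x \<omega>, ?y \<omega>)) = distr M ?P ?x \<Otimes>\<^sub>M distr M ?Q ?y"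
    using ind unfolding indep_var_distribution_eq by simp
  also have "(\<integral>\<^sup>+p. W (\<Phi> (?f (fst p)) (snd p s)) \<partial>(distr M ?P ?x \<Otimes>\<^sub>M distr M ?Q ?y))
      = (\<integral>\<^sup>+x. \<integral>\<^sup>+y. W (\<Phi> (?f x) (y s)) \<partial>distr M ?Q ?y \<partial>distr M ?P ?x)"
  proof -
    have "(\<lambda>p. W (\<Phi> (?f (fst p)) (snd p s))) \<in> borel_measurable (distr M ?P ?x \<Otimes>\<^sub>M distr M ?Q ?y)"
      using m2 by (simp cong: measurable_cong_sets)
    from R.nn_integral_fst[OF this] show ?thesis by simp
  qed
  also have "\<dots> \<le> (\<integral>\<^sup>+x. a * W (?f x) + c \<partial>distr M ?P ?x)"
    by (intro nn_integral_mono inner)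
  also have "\<dots> = a * (\<integral>\<^sup>+x. W (?f x) \<partial>distr M ?P ?x) + c"
    using L.emeasure_space_1 by (simp add: nn_integral_add nn_integral_cmult)
  also have "(\<integral>\<^sup>+x. W (?f x) \<partial>distr M ?P ?x) = (\<integral>\<^sup>+\<omega>. W (noisy_iterate \<Phi> k (\<lambda>i. Z i \<omega>) s) \<partial>M)"
    unfolding fx[symmetric] by (rule nn_integral_distr) measurable
  finally show ?thesis .
qed

end

section \<open>Differentiability of the cost\<close>

lemma norm_matrix_vector_mult_le: "norm ((M :: real^'n^'m) *v x) \<le> norm M * norm x"
proof -
  have "norm (M *v x) = L2_set (\<lambda>i. \<bar>M $ i \<bullet> x\<bar>) UNIV"
    unfolding norm_vec_def[of "M *v x"] by (simp add: matrix_vector_mult_def inner_vec_def)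
  also have "\<dots> \<le> L2_set (\<lambda>i. norm (M $ i) * norm x) UNIV"
    by (intro L2_set_mono Cauchy_Schwarz_ineq2) auto
  also have "\<dots> = norm M * norm x"
    by (simp add: norm_vec_def[of M] L2_set_left_distrib)
  finally show ?thesis .
qed

lemma bounded_bilinear_matrix_vector_mult: "bounded_bilinear ((*v) :: real^'n^'m \<Rightarrow> _)"
proof
  show "(a + a') *v b = a *v b + a' *v b" for a a' :: "real^'n^'m" and b
    by (rule matrix_vector_mult_add_rdistrib)
  show "a *v (b + b') = a *v b + a *v b'" for a :: "real^'n^'m" and b b'
    by (rule matrix_vector_right_distrib)
  show "(r *\<^sub>R a) *v b = r *\<^sub>R (a *v b)" for r and a :: "real^'n^'m" and b
    by (simp add: scaleR_matrix_vector_assoc)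
  show "a *v (r *\<^sub>R b) = r *\<^sub>R (a *v b)" for r and a :: "real^'n^'m" and b
    by (simp add: matrix_vector_mult_scaleR)
  show "\<exists>K. \<forall>(a :: real^'n^'m) b. norm (a *v b) \<le> norm a * norm b * K"
    by (rule exI[of _ 1]) (simp add: norm_matrix_vector_mult_le)
qed

lemmas has_derivative_matrix_vector_mult [derivative_intros] =
  bounded_bilinear.FDERIV[OF bounded_bilinear_matrix_vector_mult]

lemmas continuous_on_matrix_vector_mult [continuous_intros] =
  bounded_bilinear.continuous_on[OF bounded_bilinear_matrix_vector_mult]

text \<open>The summable bounds \<open>c\<close> make the tails of the derivative series small as
  operators in \<open>h\<close>, uniformly over \<open>S\<close>, as termwise differentiation
  requires.\<close>

lemma has_derivative_suminf:
  fixes f :: "nat \<Rightarrow> 'a::real_normed_vector \<Rightarrow> real"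
  assumes S: "convex S" "open S" "x \<in> S"
    and d: "\<And>n x. x \<in> S \<Longrightarrow> (f n has_derivative f' n x) (at x)"
    and bd: "\<And>n x h. x \<in> S \<Longrightarrow> \<bar>f' n x h\<bar> \<le> c n * norm h" and c: "summable c"
    and sf: "summable (\<lambda>n. f n x)"
  shows "((\<lambda>x. \<Sum>n. f n x) has_derivative (\<lambda>h. \<Sum>n. f' n x h)) (at x)"
proof -
  have "\<exists>g. \<forall>x\<in>S. (\<lambda>n. f n x) sums (g x) \<and> (g has_derivative (\<lambda>h. \<Sum>n. f' n x h)) (at x within S)"
  proof (rule has_derivative_series[where f=f and f'=f' and g'="\<lambda>x h. \<Sum>n. f' n x h", OF S(1) _ _ S(3) summable_sums[OF sf]])
    show "(f n has_derivative f' n x) (at x within S)" if "x \<in> S" for n x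
      using d[OF that] by (rule has_derivative_at_withinI)
    fix e :: real assume "0 < e"
    then obtain N where N: "\<And>n. n \<ge> N \<Longrightarrow> norm (\<Sum>i. c (i + n)) < e"
      using suminf_exist_split[OF _ c] by blast
    have "norm ((\<Sum>i<n. f' i x h) - (\<Sum>i. f' i x h)) \<le> e * norm h" if "n \<ge> N" "x \<in> S" for n x h
    proof -
      have ch: "summable (\<lambda>i. c i * norm h)" using c by (rule summable_mult2)
      have s: "summable (\<lambda>i. f' i x h)" "summable (\<lambda>i. \<bar>f' i x h\<bar>)"
        using summable_comparison_test'[OF ch, of 0 "\<lambda>i. f' i x h"]
          summable_comparison_test'[OF ch, of 0 "\<lambda>i. \<bar>f' i x h\<bar>"] bd[OF that(2)] by auto
      have "norm ((\<Sum>i<n. f' i x h) - (\<Sum>i. f' i x h)) = \<bar>\<Sum>i. f' (i + n) x h\<bar>"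
        using suminf_split_initial_segment[OF s(1), of n] by simp
      also have "\<dots> \<le> (\<Sum>i. \<bar>f' (i + n) x h\<bar>)"
        by (rule summable_rabs) (use s(2) summable_iff_shift[of "\<lambda>i. \<bar>f' i x h\<bar>" n] in simp)
      also have "\<dots> \<le> (\<Sum>i. c (i + n) * norm h)"
      proof (rule suminf_le)
        show "summable (\<lambda>i. \<bar>f' (i + n) x h\<bar>)" using s(2) summable_iff_shift[of "\<lambda>i. \<bar>f' i x h\<bar>" n] by simp
        show "summable (\<lambda>i. c (i + n) * norm h)" using ch summable_iff_shift[of "\<lambda>i. c i * norm h" n] by simp
      qed (rule bd[OF that(2)])
      also have "\<dots> = (\<Sum>i. c (i + n)) * norm h"
        using c summable_iff_shift[of c n] by (simp add: suminf_mult2)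
      also have "\<dots> \<le> e * norm h" using N[OF that(1)] by (intro mult_right_mono) auto
      finally show ?thesis .
    qed
    then show "\<forall>\<^sub>F n in sequentially. \<forall>x\<in>S. \<forall>h. norm ((\<Sum>i<n. f' i x h) - (\<Sum>i. f' i x h)) \<le> e * norm h"
      unfolding eventually_sequentially by blast
  qed
  then obtain g where g: "\<And>y. y \<in> S \<Longrightarrow> (\<lambda>n. f n y) sums (g y)"
    "\<And>y. y \<in> S \<Longrightarrow> (g has_derivative (\<lambda>h. \<Sum>n. f' n y h)) (at y within S)" by blast
  have "(g has_derivative (\<lambda>h. \<Sum>n. f' n x h)) (at x)"
    using g(2)[OF S(3)] at_within_open[OF S(3,2)] by simp
  then show ?thesis
    by (rule has_derivative_transform_within_open[OF _ S(2,3)]) (use g(1) in \<open>simp add: sums_iff\<close>)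
qed

section \<open>Closed-loop trajectories near a stabilizing gain\<close>

lemma lqr_state_closed_loop: "lqr_state A B K x t = ((*v) (A - B ** K) ^^ t) x"
proof (induction t)
  case (Suc t)
  have "A *v y + B *v (- (K *v y)) = (A - B ** K) *v y" for y :: "real^'a"
    by (simp add: matrix_vector_mult_diff_rdistrib vec.neg flip: matrix_vector_mul_assoc)
  then show ?case using Suc by simp
qed simp

text \<open>
  The norm \<open>N x = (\<Sum>t. norm (L^t x))\<close> contracts strictly under \<open>L\<close>, because \<open>N (L x) = N x - norm x\<close>;
  the contraction survives small perturbations of the gain.
\<close>

lemma stabilizing_adapted_norm:
  fixes A :: "real^'n^'n" and B :: "real^'m^'n"
  assumes K: "K \<in> stabilizing A B"
  obtains N :: "real^'n \<Rightarrow> real" and C q e :: real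
  where "0 < e" "0 < q" "q < 1" "1 \<le> C"
    and "\<And>x. norm x \<le> N x" "\<And>x. N x \<le> C * norm x" "\<And>x y. N (x + y) \<le> N x + N y"
    and "\<And>K' x. norm (K' - K) < e \<Longrightarrow> N (A *v x + B *v (- (K' *v x))) \<le> q * N x"
proof -
  define L where "L = A - B ** K"
  define a where "a x t = norm (((*v) L ^^ t) x)" for x t
  have sm: "summable (a x)" for x
    unfolding a_def using K by (intro spectral_radius_less_1_summable) (simp add: stabilizing_def L_def)
  define N where "N x = suminf (a x)" for x
  have tri: "N (x + y) \<le> N x + N y" for x y
  proof -
    have "N (x + y) \<le> (\<Sum>t. a x t + a y t)"
      unfolding N_def by (intro suminf_le sm summable_add) (simp add: a_def funpow_mult_add norm_triangle_ineq)
    then show ?thesis by (simp add: N_def suminf_add sm)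
  qed
  have scale: "N (c *\<^sub>R x) = \<bar>c\<bar> * N x" for c x
  proof -
    have "a (c *\<^sub>R x) = (\<lambda>t. \<bar>c\<bar> * a x t)"
      using funpow_mult_scale[where M=L and c=c and v=x] by (simp add: a_def scalar_mult_eq_scaleR fun_eq_iff)
    then show ?thesis unfolding N_def using suminf_mult[OF sm[of x]] by simp
  qed
  have step: "N (L *v x) = N x - norm x" for x
  proof -
    have "a (L *v x) = (\<lambda>t. a x (Suc t))" by (simp add: a_def funpow_swap1 fun_eq_iff)
    moreover have "a x 0 = norm x" by (simp add: a_def)
    ultimately show ?thesis unfolding N_def using suminf_split_head[OF sm[of x]] by simp
  qed
  have N0: "0 \<le> N x" for x unfolding N_def by (intro suminf_nonneg sm) (simp add: a_def)
  have ge: "norm x \<le> N x" for x using step[of x] N0[of "L *v x"] by simp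
  \<comment> \<open>Expanding \<open>x\<close> in the standard basis shows that \<open>N\<close> is
    at most a constant times the Euclidean norm; the added 1 makes \<open>C \<ge> 1\<close>.\<close>
  define C where "C = 1 + (\<Sum>i\<in>UNIV. N (axis i 1))"
  have C: "1 \<le> C" by (simp add: C_def sum_nonneg N0)
  have le: "N x \<le> C * norm x" for x
  proof -
    have sums: "N (\<Sum>i\<in>I. v i) \<le> (\<Sum>i\<in>I. N (v i))" for I and v :: "'n \<Rightarrow> real^'n"
    proof (induction I rule: infinite_finite_induct)
      case (insert i I)
      then show ?case using tri[of "v i" "sum v I"] by simp
    qed (use scale[of 0 0] in simp_all)
    have "N x = N (\<Sum>i\<in>UNIV. x $ i *\<^sub>R axis i 1)"
      using basis_expansion[of x] by (simp add: scalar_mult_eq_scaleR)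
    also have "\<dots> \<le> (\<Sum>i\<in>UNIV. \<bar>x $ i\<bar> * N (axis i 1))" using sums[of "\<lambda>i. x $ i *\<^sub>R axis i 1" UNIV] by (simp add: scale)
    also have "\<dots> \<le> (\<Sum>i\<in>UNIV. norm x * N (axis i 1))"
      by (intro sum_mono mult_right_mono component_le_norm_cart N0)
    also have "\<dots> \<le> C * norm x" by (simp add: C_def sum_distrib_left algebra_simps)
    finally show ?thesis .
  qed
  define b where "b = norm B + 1"
  have b: "0 < b" by (simp add: b_def add_nonneg_pos)
  \<comment> \<open>With this radius the change of gain costs at most
    \<open>norm x / (2 * C)\<close>, no more than half of the decrease \<open>norm x\<close> found
    in \<open>step\<close>; \<open>b\<close> exceeds \<open>norm B\<close> by 1 so that it is
    positive even for \<open>B = 0\<close>.\<close>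
  define e where "e = 1 / (2 * C\<^sup>2 * b)"
  have e: "0 < e" using b C by (simp add: e_def)
  have contr: "N (A *v x + B *v (- (K' *v x))) \<le> (1 - 1 / (2 * C)) * N x" if "norm (K' - K) < e" for K' x
  proof -
    have eq: "A *v x + B *v (- (K' *v x)) = L *v x + B *v ((K - K') *v x)"
      by (simp add: L_def matrix_vector_mult_diff_rdistrib matrix_vector_mult_diff_distrib
          vec.neg flip: matrix_vector_mul_assoc)
    have "N (B *v ((K - K') *v x)) \<le> C * norm (B *v ((K - K') *v x))" by (rule le)
    also have "\<dots> \<le> C * (b * (e * norm x))"
    proof (intro mult_left_mono)
      have "norm (B *v ((K - K') *v x)) \<le> norm B * (norm (K - K') * norm x)"
        by (meson norm_matrix_vector_mult_le mult_left_mono norm_ge_zero order_trans)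
      also have "\<dots> \<le> b * (e * norm x)"
        using that b e by (intro mult_mono) (auto simp: b_def norm_minus_commute)
      finally show "norm (B *v ((K - K') *v x)) \<le> b * (e * norm x)" .
    qed (use C in simp)
    also have "\<dots> = norm x / (2 * C)" using b C by (simp add: e_def power2_eq_square)
    finally have "N (B *v ((K - K') *v x)) \<le> norm x / (2 * C)" .
    then have "N (A *v x + B *v (- (K' *v x))) \<le> N x - norm x + norm x / (2 * C)"
      unfolding eq using tri[of "L *v x"] step[of x] by (smt (verit, best))
    also have "\<dots> = N x - (1 - 1 / (2 * C)) * norm x" by (simp add: algebra_simps)
    also have "\<dots> \<le> N x - (1 / 2) * (N x / C)"
    proof -
      have "1 / 2 \<le> 1 - 1 / (2 * C)" using C by (simp add: field_simps)
      moreover have "N x / C \<le> norm x" using le[of x] C by (simp add: pos_divide_le_eq mult.commute)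
      moreover have "0 \<le> N x / C" using N0 C by simp
      ultimately show ?thesis by (intro diff_left_mono mult_mono) auto
    qed
    finally show ?thesis by (simp add: algebra_simps)
  qed
  show ?thesis
  proof (rule that[OF _ _ _ C ge le tri contr])
    show "0 < e" by (rule e)
    show "0 < 1 - 1 / (2 * C)" "1 - 1 / (2 * C) < 1" using C by (simp_all add: field_simps)
  qed
qed

text \<open>The derivative of the state with respect to the gain in direction \<open>H\<close>,
  obtained by differentiating the closed-loop recursion.\<close>

primrec lqr_state_deriv ::
    "real^'n^'n \<Rightarrow> real^'m^'n \<Rightarrow> real^'n^'m \<Rightarrow> real^'n \<Rightarrow> real^'n^'m \<Rightarrow> nat \<Rightarrow> real^'n" where
  "lqr_state_deriv A B K x H 0 = 0"
| "lqr_state_deriv A B K x H (Suc t) =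
     A *v lqr_state_deriv A B K x H t
     + B *v (- (K *v lqr_state_deriv A B K x H t + H *v lqr_state A B K x t))"

lemma lqr_state_has_derivative:
  "((\<lambda>K. lqr_state A B K x t) has_derivative (\<lambda>H. lqr_state_deriv A B K x H t)) (at K)"
proof (induction t)
  case (Suc t)
  then show ?case
    by (auto intro!: derivative_eq_intros)
qed simp

definition lqr_stage_deriv ::
    "real^'n^'n \<Rightarrow> real^'m^'n \<Rightarrow> real^'n^'n \<Rightarrow> real^'m^'m
      \<Rightarrow> real^'n^'m \<Rightarrow> real^'n \<Rightarrow> nat \<Rightarrow> real^'n^'m \<Rightarrow> real" where
  "lqr_stage_deriv A B Q R K x t H =
     (let s = lqr_state A B K x t; y = lqr_state_deriv A B K x H t;
          u = K *v s; w = K *v y + H *v s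
      in s \<bullet> (Q *v y) + y \<bullet> (Q *v s) + (u \<bullet> (R *v w) + w \<bullet> (R *v u)))"

lemma lqr_stage_alt:
  "lqr_stage A B Q R K x t =
     lqr_state A B K x t \<bullet> (Q *v lqr_state A B K x t)
     + (K *v lqr_state A B K x t) \<bullet> (R *v (K *v lqr_state A B K x t))"
  by (simp add: lqr_stage_def stage_cost_def vec.neg)

lemma lqr_stage_has_derivative:
  "((\<lambda>K. lqr_stage A B Q R K x t) has_derivative lqr_stage_deriv A B Q R K x t) (at K)"
  unfolding lqr_stage_alt lqr_stage_deriv_def Let_def
  by (auto intro!: derivative_eq_intros lqr_state_has_derivative)

lemma inner_matrix_vector_bound: "\<bar>x \<bullet> (M *v y)\<bar> \<le> norm M * norm x * norm (y :: real^'n)"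
proof -
  have "\<bar>x \<bullet> (M *v y)\<bar> \<le> norm x * norm (M *v y)" by (rule Cauchy_Schwarz_ineq2)
  also have "\<dots> \<le> norm x * (norm M * norm y)" by (intro mult_left_mono norm_matrix_vector_mult_le) simp
  finally show ?thesis by (simp add: mult_ac)
qed

lemma abs_inner_matrix_le:
  fixes x y :: "real^'n"
  assumes "norm x \<le> a" "norm y \<le> b"
  shows "\<bar>x \<bullet> (M *v y)\<bar> \<le> norm M * a * b"
proof -
  have "\<bar>x \<bullet> (M *v y)\<bar> \<le> norm M * (norm x * norm y)"
    using inner_matrix_vector_bound[of x M y] by (simp add: mult.assoc)
  also have "\<dots> \<le> norm M * (a * b)"
    using assms by (intro mult_left_mono mult_mono) (auto intro: order_trans[OF norm_ge_zero])
  finally show ?thesis by (simp add: mult.assoc)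
qed

text \<open>In the adapted norm the state decays like \<open>q ^ t\<close>. Its derivative obeys the
  same contracting recursion with the state as forcing term, which costs a factor \<open>t\<close>.
  All bounds are uniform on a ball of gains.\<close>

lemma lqr_local_bounds:
  fixes A :: "real^'n^'n" and B :: "real^'m^'n"
  assumes K: "K \<in> stabilizing A B"
  obtains e q D F :: real where "0 < e" "0 < q" "q < 1"
    and "\<And>K' x t. norm (K' - K) < e \<Longrightarrow> \<bar>lqr_stage A B Q R K' x t\<bar> \<le> D * q ^ t * (norm x)\<^sup>2"
    and "\<And>K' x t H. norm (K' - K) < e \<Longrightarrow>
      \<bar>lqr_stage_deriv A B Q R K' x t H\<bar> \<le> F * (real (Suc t) * q ^ t) * (norm x)\<^sup>2 * norm H"
proof -
  obtain N :: "real^'n \<Rightarrow> real" and C q e where e: "0 < e" and q: "0 < q" "q < 1" and C: "1 \<le> C"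
    and ge: "\<And>x. norm x \<le> N x" and le: "\<And>x. N x \<le> C * norm x"
    and tri: "\<And>x y. N (x + y) \<le> N x + N y"
    and contr: "\<And>K' x. norm (K' - K) < e \<Longrightarrow> N (A *v x + B *v (- (K' *v x))) \<le> q * N x"
    using stabilizing_adapted_norm[OF K] by metis
  define k where "k = norm K + e"
  define E where "E = C\<^sup>2 * norm B / q"
  have E0: "0 \<le> E" using q by (simp add: E_def)
  have k: "norm K' \<le> k" if "norm (K' - K) < e" for K'
    using that norm_triangle_ineq2[of K' K] by (simp add: k_def)
  have k0: "0 \<le> k" using e by (simp add: k_def)
  have qt: "0 \<le> q ^ t" "q ^ t \<le> 1" for t using q by (simp_all add: power_le_one)
  have Ns: "N (lqr_state A B K' x t) \<le> q ^ t * (C * norm x)" if "norm (K' - K) < e" for K' x t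
  proof (induction t)
    case (Suc t)
    have "N (lqr_state A B K' x (Suc t)) \<le> q * N (lqr_state A B K' x t)" using contr[OF that] by simp
    also have "\<dots> \<le> q * (q ^ t * (C * norm x))" using Suc q by (intro mult_left_mono) auto
    finally show ?case by simp
  qed (simp add: le)
  have s: "norm (lqr_state A B K' x t) \<le> q ^ t * (C * norm x)" if "norm (K' - K) < e" for K' x t
    using ge Ns[OF that] by (rule order_trans)
  have Ny: "N (lqr_state_deriv A B K' x H t) \<le> real t * q ^ t * (E * norm H * norm x)"
    if K': "norm (K' - K) < e" for K' x H t
  proof (induction t)
    case 0
    show ?case using le[of 0] ge[of "0::real^'n"] by simp
  next
    case (Suc t)
    let ?y = "lqr_state_deriv A B K' x H t" and ?s = "lqr_state A B K' x t"
    have eq: "lqr_state_deriv A B K' x H (Suc t) = (A *v ?y + B *v (- (K' *v ?y))) + B *v (- (H *v ?s))"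
      by (simp add: vec.neg matrix_vector_right_distrib matrix_vector_mult_diff_distrib)
    have "N (lqr_state_deriv A B K' x H (Suc t)) \<le> q * N ?y + N (B *v (- (H *v ?s)))"
      unfolding eq by (rule order_trans[OF tri add_right_mono[OF contr[OF K']]])
    also have "N (B *v (- (H *v ?s))) \<le> C * norm (B *v (- (H *v ?s)))" by (rule le)
    also have "norm (B *v (- (H *v ?s))) \<le> norm B * (norm H * norm ?s)"
      by (rule order_trans[OF norm_matrix_vector_mult_le]) (simp add: mult_left_mono norm_matrix_vector_mult_le)
    also have "norm ?s \<le> q ^ t * (C * norm x)" by (rule s[OF K'])
    also have "q * N ?y \<le> q * (real t * q ^ t * (E * norm H * norm x))" using Suc q by (intro mult_left_mono) auto
    finally have "N (lqr_state_deriv A B K' x H (Suc t))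
        \<le> q * (real t * q ^ t * (E * norm H * norm x)) + C * (norm B * (norm H * (q ^ t * (C * norm x))))"
      using C by (simp add: mult_left_mono)
    also have "C * (norm B * (norm H * (q ^ t * (C * norm x)))) = q ^ Suc t * (E * norm H * norm x)"
      using q by (simp add: E_def power2_eq_square)
    finally show ?case by (simp add: algebra_simps)
  qed
  have y: "norm (lqr_state_deriv A B K' x H t) \<le> real t * q ^ t * (E * norm H * norm x)"
    if "norm (K' - K) < e" for K' x H t
    using ge Ny[OF that] by (rule order_trans)
  have u: "norm (K' *v lqr_state A B K' x t) \<le> k * (q ^ t * (C * norm x))" if "norm (K' - K) < e" for K' x t
  proof -
    have "norm (K' *v lqr_state A B K' x t) \<le> norm K' * norm (lqr_state A B K' x t)"
      by (rule norm_matrix_vector_mult_le)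
    also have "\<dots> \<le> k * (q ^ t * (C * norm x))" using k[OF that] s[OF that] k0 by (intro mult_mono) auto
    finally show ?thesis .
  qed
  show ?thesis
  proof
    show "0 < e" "0 < q" "q < 1" by fact+
    fix K' x t assume K': "norm (K' - K) < e"
    let ?s = "lqr_state A B K' x t"
    have "\<bar>lqr_stage A B Q R K' x t\<bar>
        \<le> norm Q * (q ^ t * (C * norm x)) * (q ^ t * (C * norm x))
          + norm R * (k * (q ^ t * (C * norm x))) * (k * (q ^ t * (C * norm x)))"
      unfolding lqr_stage_alt
      by (rule order_trans[OF abs_triangle_ineq add_mono[OF abs_inner_matrix_le abs_inner_matrix_le]])
        (rule s[OF K'] u[OF K'])+
    also have "\<dots> = ((norm Q + norm R * k\<^sup>2) * C\<^sup>2) * q ^ t * (norm x)\<^sup>2 * q ^ t"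
      by (simp add: algebra_simps power2_eq_square)
    also have "\<dots> \<le> ((norm Q + norm R * k\<^sup>2) * C\<^sup>2) * q ^ t * (norm x)\<^sup>2"
      using qt by (intro mult_left_le) auto
    finally show "\<bar>lqr_stage A B Q R K' x t\<bar> \<le> ((norm Q + norm R * k\<^sup>2) * C\<^sup>2) * q ^ t * (norm x)\<^sup>2" .
    fix H
    let ?y = "lqr_state_deriv A B K' x H t"
    let ?T = "real (Suc t) * q ^ t"
    \<comment> \<open>Only \<open>S\<close> and \<open>U\<close> keep their power of
      \<open>q\<close>; \<open>Y\<close> and \<open>W\<close> give theirs up and keep
      \<open>Suc t\<close>. Each product in the derivative pairs one of either kind, hence the
      factor \<open>Suc t * q ^ t\<close>.\<close>
    define S Y U W where "S = q ^ t * (C * norm x)" and "Y = real (Suc t) * (E * norm H * norm x)"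
      and "U = k * (q ^ t * (C * norm x))" and "W = real (Suc t) * ((k * E + C) * norm H * norm x)"
    have S: "norm ?s \<le> S" unfolding S_def by (rule s[OF K'])
    have U: "norm (K' *v ?s) \<le> U" unfolding U_def by (rule u[OF K'])
    have Y: "norm ?y \<le> Y"
    proof -
      have "real t * q ^ t * (E * norm H * norm x) \<le> (real (Suc t) * 1) * (E * norm H * norm x)"
        using qt E0 by (intro mult_right_mono mult_mono) auto
      with y[OF K', of x H t] show ?thesis by (simp add: Y_def)
    qed
    have W: "norm (K' *v ?y + H *v ?s) \<le> W"
    proof -
      have "norm (K' *v ?y + H *v ?s) \<le> norm K' * norm ?y + norm H * norm ?s"
        by (intro norm_triangle_le add_mono norm_matrix_vector_mult_le)
      also have "\<dots> \<le> k * Y + norm H * (real (Suc t) * (C * norm x))"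
      proof (intro add_mono mult_mono mult_left_mono)
        have "q ^ t * (C * norm x) \<le> real (Suc t) * (C * norm x)"
          using qt[of t] C by (intro mult_right_mono) auto
        with S show "norm ?s \<le> real (Suc t) * (C * norm x)" by (simp add: S_def)
      qed (use Y k[OF K'] k0 in auto)
      also have "\<dots> = W" by (simp add: W_def Y_def algebra_simps)
      finally show ?thesis .
    qed
    have "\<bar>lqr_stage_deriv A B Q R K' x t H\<bar>
      \<le> (norm Q * S * Y + norm Q * Y * S) + (norm R * U * W + norm R * W * U)"
      unfolding lqr_stage_deriv_def Let_def
      by (intro order_trans[OF abs_triangle_ineq] add_mono abs_inner_matrix_le S Y U W)
    also have "\<dots> = (2 * norm Q * C * E + 2 * norm R * k * C * (k * E + C)) * ?T * (norm x)\<^sup>2 * norm H"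
      by (simp add: S_def Y_def U_def W_def algebra_simps power2_eq_square del: of_nat_Suc)
    finally show "\<bar>lqr_stage_deriv A B Q R K' x t H\<bar>
      \<le> (2 * norm Q * C * E + 2 * norm R * k * C * (k * E + C)) * ?T * (norm x)\<^sup>2 * norm H" .
  qed
qed

lemma has_derivative_imp_GDERIV:
  fixes f :: "'a::euclidean_space \<Rightarrow> real"
  assumes "(f has_derivative f') (at x)"
  shows "GDERIV f x :> (\<Sum>b\<in>Basis. f' b *\<^sub>R b)"
proof -
  have lin: "linear f'" using assms by (rule has_derivative_linear)
  have "f' = (\<lambda>h. h \<bullet> (\<Sum>b\<in>Basis. f' b *\<^sub>R b))"
  proof
    fix h
    have "f' h = f' (\<Sum>b\<in>Basis. (h \<bullet> b) *\<^sub>R b)" by (simp add: euclidean_representation)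
    also have "\<dots> = (\<Sum>b\<in>Basis. (h \<bullet> b) * f' b)" by (simp add: linear_sum[OF lin] linear_scale[OF lin])
    finally show "f' h = h \<bullet> (\<Sum>b\<in>Basis. f' b *\<^sub>R b)" by (simp add: inner_sum_right mult.commute)
  qed
  with assms show ?thesis by (simp add: gderiv_def)
qed

text \<open>Uniqueness of the derivative makes the description in \<open>gradient\<close>
  definite.\<close>

lemma GDERIV_gradient: "GDERIV f x :> g \<Longrightarrow> GDERIV f x :> gradient f x"
  unfolding gradient_def
proof (rule theI)
  fix h assume "GDERIV f x :> g" "GDERIV f x :> h"
  then have "(\<lambda>y. y \<bullet> g) = (\<lambda>y. y \<bullet> h)" unfolding gderiv_def by (rule has_derivative_unique)
  then have "(h - g) \<bullet> g = (h - g) \<bullet> h" by metis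
  then have "(h - g) \<bullet> (h - g) = 0" by (simp add: inner_diff_right)
  then show "h = g" by simp
qed

lemma lqr_stage_sum_differentiable:
  assumes K: "K \<in> stabilizing A B"
  shows "(\<lambda>K. \<Sum>t. lqr_stage A B Q R K x t) differentiable (at K)"
proof -
  obtain e q D F where e: "0 < e" and q: "0 < q" "q < 1"
    and b1: "\<And>K' x t. norm (K' - K) < e \<Longrightarrow> \<bar>lqr_stage A B Q R K' x t\<bar> \<le> D * q ^ t * (norm x)\<^sup>2"
    and b2: "\<And>K' x t H. norm (K' - K) < e \<Longrightarrow>
      \<bar>lqr_stage_deriv A B Q R K' x t H\<bar> \<le> F * (real (Suc t) * q ^ t) * (norm x)\<^sup>2 * norm H"
    using lqr_local_bounds[OF K, of Q R] by metis
  have "((\<lambda>K. \<Sum>t. lqr_stage A B Q R K x t) has_derivative (\<lambda>H. \<Sum>t. lqr_stage_deriv A B Q R K x t H)) (at K)"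
  proof (rule has_derivative_suminf[where S="ball K e" and c="\<lambda>t. F * (real (Suc t) * q ^ t) * (norm x)\<^sup>2"])
    show "\<bar>lqr_stage_deriv A B Q R K' x t H\<bar> \<le> F * (real (Suc t) * q ^ t) * (norm x)\<^sup>2 * norm H"
      if "K' \<in> ball K e" for t K' H
      using that by (intro b2) (simp add: dist_norm norm_minus_commute)
    show "summable (\<lambda>t. F * (real (Suc t) * q ^ t) * (norm x)\<^sup>2)"
      using q sums_summable[OF geometric_deriv_sums[of q]] by (intro summable_mult summable_mult2) auto
    show "summable (lqr_stage A B Q R K x)"
      by (rule summable_comparison_test'[where N=0 and g="\<lambda>t. D * q ^ t * (norm x)\<^sup>2"])
        (use b1[of K] e q in \<open>auto intro!: summable_mult summable_mult2 summable_geometric\<close>)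
  qed (use e in \<open>auto intro: lqr_stage_has_derivative\<close>)
  then show ?thesis by (rule differentiableI)
qed

section \<open>The expected cost as a trace\<close>

lemma quadratic_expectation:
  fixes b :: "real^'n \<Rightarrow> real^'n \<Rightarrow> real"
  assumes bil: "bilinear b"
    and cov: "(\<integral>v. (\<chi> i j. v $ i * v $ j) \<partial>Dist) = (mat 1 :: real^'n^'n)"
  shows "integrable Dist (\<lambda>v. b v v)"
    and "(\<integral>v. b v v \<partial>Dist) = (\<Sum>i\<in>UNIV. b (axis i 1) (axis i 1))"
proof -
  have int: "integrable Dist (\<lambda>v. \<chi> i j. v $ i * v $ j)"
  \<comment> \<open>A non-integrable function has Bochner integral 0, which is not the identity
    matrix; so the covariance condition itself yields integrability.\<close>
  proof (rule ccontr)
    assume "\<not> ?thesis"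
    then have "(mat 1 :: real^'n^'n) = 0" using cov by (simp add: not_integrable_integral_eq)
    then have "(mat 1 :: real^'n^'n) $ undefined $ undefined = 0" by simp
    then show False by (simp add: mat_def)
  qed
  have bl: "bounded_linear (\<lambda>M::real^'n^'n. M $ i $ j)" for i j
    by (rule bounded_linear_compose[OF bounded_linear_vec_nth bounded_linear_vec_nth])
  have int2: "integrable Dist (\<lambda>v. v $ i * v $ j)" for i j
    using integrable_bounded_linear[OF bl int, of i j] by simp
  have cov2: "(\<integral>v. v $ i * v $ j \<partial>Dist) = (if i = j then 1 else 0)" for i j
    using integral_bounded_linear[OF bl int, of i j] cov by (simp add: mat_def)
  have expand: "b v v = (\<Sum>i\<in>UNIV. \<Sum>j\<in>UNIV. (v $ i * v $ j) * b (axis i 1) (axis j 1))" for v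
  proof -
    have l: "linear (b x)" "linear (\<lambda>x. b x y)" for x y using bil by (auto simp: bilinear_def)
    have v: "v = (\<Sum>i\<in>UNIV. v $ i *\<^sub>R axis i 1)"
      using basis_expansion[of v] by (simp add: scalar_mult_eq_scaleR)
    have "b v v = b (\<Sum>i\<in>UNIV. v $ i *\<^sub>R axis i 1) v" using v by simp
    also have "\<dots> = (\<Sum>i\<in>UNIV. v $ i * b (axis i 1) v)"
      by (simp add: linear_sum[OF l(2)] linear_scale[OF l(2)])
    also have "\<dots> = (\<Sum>i\<in>UNIV. v $ i * (\<Sum>j\<in>UNIV. v $ j * b (axis i 1) (axis j 1)))"
    proof (rule sum.cong[OF refl])
      fix i
      have "b (axis i 1) v = b (axis i 1) (\<Sum>j\<in>UNIV. v $ j *\<^sub>R axis j 1)" using v by simp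
      then show "v $ i * b (axis i 1) v = v $ i * (\<Sum>j\<in>UNIV. v $ j * b (axis i 1) (axis j 1))"
        by (simp add: linear_sum[OF l(1)] linear_scale[OF l(1)])
    qed
    finally show ?thesis by (simp add: sum_distrib_left mult.assoc)
  qed
  show "integrable Dist (\<lambda>v. b v v)"
    unfolding expand using int2 by (intro Bochner_Integration.integrable_sum integrable_mult_left)
  have "(\<integral>v. b v v \<partial>Dist) = (\<Sum>i\<in>UNIV. \<Sum>j\<in>UNIV. (if i = j then 1 else 0) * b (axis i 1) (axis j 1))"
    unfolding expand using int2 by (simp add: cov2)
  then show "(\<integral>v. b v v \<partial>Dist) = (\<Sum>i\<in>UNIV. b (axis i 1) (axis i 1))"
    by (simp add: if_distrib[of "\<lambda>c. c * _"] cong: if_cong)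
qed

lemma linear_lqr_state: "linear (\<lambda>x. lqr_state A B K x t)"
proof (induction t)
  case (Suc t)
  from linear_compose[OF Suc matrix_vector_mul_linear[of "A - B ** K"]] show ?case
    by (simp add: o_def lqr_state_closed_loop)
qed (simp add: linear_iff)

lemma lqr_stage_bilinear:
  obtains b where "bilinear b" "\<And>x. lqr_stage A B Q R K x t = b x x"
proof -
  let ?s = "\<lambda>x. lqr_state A B K x t"
  let ?b = "\<lambda>x y. ?s x \<bullet> (Q *v ?s y) + (K *v ?s x) \<bullet> (R *v (K *v ?s y))"
  have "bilinear ?b"
    by (simp add: bilinear_def linear_iff linear_add[OF linear_lqr_state] linear_scale[OF linear_lqr_state]
        matrix_vector_right_distrib inner_add_left inner_add_right matrix_vector_mult_scaleR algebra_simps)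
  then show ?thesis by (rule that) (rule lqr_stage_alt)
qed

lemma lqr_stage_nonneg:
  assumes "symmetric_psd Q" "symmetric_pd R"
  shows "0 \<le> lqr_stage A B Q R K x t"
proof -
  have "0 \<le> y \<bullet> (R *v y)" for y
    using assms(2) by (cases "y = 0") (auto simp: symmetric_pd_def less_imp_le)
  then show ?thesis using assms(1) unfolding lqr_stage_alt symmetric_psd_def by (simp add: add_nonneg_nonneg)
qed

lemma lqr_cost_from_eq:
  assumes "summable (lqr_stage A B Q R K x)"
  shows "lqr_cost_from A B Q R K x = ereal (\<Sum>t. lqr_stage A B Q R K x t)"
  unfolding lqr_cost_from_def by (rule suminf_ereal'[OF assms])

lemma stabilizing_summable:
  assumes K: "K \<in> stabilizing A B"
  shows "summable (lqr_stage A B Q R K x)"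
proof -
  obtain e q D F where e: "0 < e" and q: "0 < q" "q < 1"
    and b1: "\<And>K' x t. norm (K' - K) < e \<Longrightarrow> \<bar>lqr_stage A B Q R K' x t\<bar> \<le> D * q ^ t * (norm x)\<^sup>2"
    using lqr_local_bounds[OF K, of Q R] by metis
  show ?thesis
    by (rule summable_comparison_test'[where N=0 and g="\<lambda>t. D * q ^ t * (norm x)\<^sup>2"])
      (use b1[of K] e q in \<open>auto intro!: summable_mult summable_mult2 summable_geometric\<close>)
qed

lemma continuous_on_lqr_state:
  "continuous_on UNIV (\<lambda>(K, x). lqr_state A B K x t)"
  by (induction t) (auto simp: case_prod_beta intro!: continuous_intros)

lemma continuous_on_lqr_stage:
  "continuous_on UNIV (\<lambda>(K, x). lqr_stage A B Q R K x t)"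
  unfolding lqr_stage_alt case_prod_beta
  using continuous_on_lqr_state[of A B t] by (auto simp: case_prod_beta intro!: continuous_intros)

lemma borel_measurable_lqr_stage:
  "(\<lambda>(K, x). lqr_stage A B Q R K x t) \<in> borel_measurable borel"
  by (rule borel_measurable_continuous_onI[OF continuous_on_lqr_stage])

lemma measurable_lqr_stage [measurable (raw)]:
  assumes "f \<in> borel_measurable M" "g \<in> borel_measurable M"
  shows "(\<lambda>w. lqr_stage A B Q R (f w) (g w) t) \<in> borel_measurable M"
  using measurable_compose[OF borel_measurable_Pair[OF assms] borel_measurable_lqr_stage[of A B Q R t]] by simp

lemma measurable_lqr_cost_from [measurable (raw)]:
  assumes "f \<in> borel_measurable M" "g \<in> borel_measurable M"
  shows "(\<lambda>w. lqr_cost_from A B Q R (f w) (g w)) \<in> borel_measurable M"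
  unfolding lqr_cost_from_def using assms by measurable

lemma measurable_lqr_cost_horizon [measurable (raw)]:
  assumes "f \<in> borel_measurable M" "g \<in> borel_measurable M"
  shows "(\<lambda>w. lqr_cost_horizon A B Q R N (f w) (g w)) \<in> borel_measurable M"
  unfolding lqr_cost_horizon_def using assms by measurable

text \<open>Each expected stage is a sum over basis vectors, and the bound
  \<open>D * Cm * q ^ t\<close> allows expectation and series to be exchanged. The result plays the
  role of the trace of the cost matrix, as a finite sum of functions already known to be
  differentiable in the gain.\<close>

lemma lqr_cost_from_integral:
  fixes A :: "real^'n^'n"
  assumes Q: "symmetric_psd Q" and R: "symmetric_pd R"
    and "prob_space Dist" and sets [measurable_cong]: "sets Dist = sets borel"
    and cov: "(\<integral>v. (\<chi> i j. v $ i * v $ j) \<partial>Dist) = (mat 1 :: real^'n^'n)"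
    and bd: "AE v in Dist. (norm v)\<^sup>2 \<le> Cm"
    and K: "K \<in> stabilizing A B"
  shows "integrable Dist (\<lambda>x. real_of_ereal (lqr_cost_from A B Q R K x))"
    and "(\<integral>x. real_of_ereal (lqr_cost_from A B Q R K x) \<partial>Dist)
      = (\<Sum>i\<in>UNIV. \<Sum>t. lqr_stage A B Q R K (axis i 1) t)"
proof -
  interpret prob_space Dist by fact
  obtain e q D F where e: "0 < e" and q: "0 < q" "q < 1"
    and b1: "\<And>K' x t. norm (K' - K) < e \<Longrightarrow> \<bar>lqr_stage A B Q R K' x t\<bar> \<le> D * q ^ t * (norm x)\<^sup>2"
    using lqr_local_bounds[OF K, of Q R] by metis
  have b: "\<bar>lqr_stage A B Q R K x t\<bar> \<le> D * q ^ t * (norm x)\<^sup>2" for x t using b1[of K] e by simp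
  have nn: "0 \<le> lqr_stage A B Q R K x t" for x t by (rule lqr_stage_nonneg[OF Q R])
  have D: "0 \<le> D"
  proof -
    have "0 \<le> D * q ^ 0 * (norm (axis undefined 1 :: real^'n))\<^sup>2" by (rule order_trans[OF abs_ge_zero b])
    then show ?thesis by simp
  qed
  have sm: "summable (lqr_stage A B Q R K x)" for x by (rule stabilizing_summable[OF K])
  have eq: "real_of_ereal (lqr_cost_from A B Q R K x) = (\<Sum>t. lqr_stage A B Q R K x t)" for x
    by (simp add: lqr_cost_from_eq[OF sm])
  have st: "integrable Dist (\<lambda>x. lqr_stage A B Q R K x t)"
    "(\<integral>x. lqr_stage A B Q R K x t \<partial>Dist) = (\<Sum>i\<in>UNIV. lqr_stage A B Q R K (axis i 1) t)" for t
  proof -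
    obtain b where b: "bilinear b" "\<And>x. lqr_stage A B Q R K x t = b x x"
      using lqr_stage_bilinear[of A B Q R K t] by blast
    show "integrable Dist (\<lambda>x. lqr_stage A B Q R K x t)"
      "(\<integral>x. lqr_stage A B Q R K x t \<partial>Dist) = (\<Sum>i\<in>UNIV. lqr_stage A B Q R K (axis i 1) t)"
      unfolding b(2) by (rule quadratic_expectation[OF b(1) cov])+
  qed
  have le: "(\<integral>x. norm (lqr_stage A B Q R K x t) \<partial>Dist) \<le> D * Cm * q ^ t" for t
  proof -
    have "(\<integral>x. norm (lqr_stage A B Q R K x t) \<partial>Dist) \<le> (\<integral>x. D * Cm * q ^ t \<partial>Dist)"
    proof (rule integral_mono_AE)
      show "AE x in Dist. norm (lqr_stage A B Q R K x t) \<le> D * Cm * q ^ t"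
        using bd
      proof eventually_elim
        case (elim x)
        have "D * q ^ t * (norm x)\<^sup>2 \<le> D * q ^ t * Cm" using elim D q by (intro mult_left_mono) auto
        with b[of x t] show ?case by (simp add: mult_ac)
      qed
    qed (use st in simp_all)
    then show ?thesis by (simp add: prob_space)
  qed
  have sn: "summable (\<lambda>t. \<integral>x. norm (lqr_stage A B Q R K x t) \<partial>Dist)"
    by (rule summable_comparison_test'[where N=0 and g="\<lambda>t. D * Cm * q ^ t"])
      (use le q in \<open>auto intro!: summable_mult summable_geometric\<close>)
  have ae: "AE x in Dist. summable (\<lambda>t. norm (lqr_stage A B Q R K x t))"
    using sm nn by simp
  show "integrable Dist (\<lambda>x. real_of_ereal (lqr_cost_from A B Q R K x))"
    unfolding eq by (rule integrable_suminf[OF st(1) ae sn])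
  have "(\<integral>x. real_of_ereal (lqr_cost_from A B Q R K x) \<partial>Dist) = (\<Sum>t. \<integral>x. lqr_stage A B Q R K x t \<partial>Dist)"
    unfolding eq by (rule integral_suminf[OF st(1) ae sn])
  also have "\<dots> = (\<Sum>i\<in>UNIV. \<Sum>t. lqr_stage A B Q R K (axis i 1) t)"
    unfolding st(2) by (rule suminf_sum) (rule sm)
  finally show "(\<integral>x. real_of_ereal (lqr_cost_from A B Q R K x) \<partial>Dist)
      = (\<Sum>i\<in>UNIV. \<Sum>t. lqr_stage A B Q R K (axis i 1) t)" .
qed

section \<open>Sublevel sets of the cost\<close>

lemma norm_square_matrix: "(norm (M :: real^'n^'m))\<^sup>2 = (\<Sum>i\<in>UNIV. \<Sum>j\<in>UNIV. (M $ i $ j)\<^sup>2)"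
  unfolding power2_norm_eq_inner by (simp add: inner_vec_def power2_eq_square)

lemma norm_transpose: "norm (transpose M) = norm (M :: real^'n^'m)"
proof -
  have "(norm (transpose M))\<^sup>2 = (norm M)\<^sup>2"
    unfolding norm_square_matrix by (subst sum.swap) (simp add: transpose_def)
  then show ?thesis by simp
qed

lemma norm_square_columns: "(norm (M :: real^'n^'m))\<^sup>2 = (\<Sum>j\<in>UNIV. (norm (M *v axis j 1))\<^sup>2)"
proof -
  have "(norm (M *v axis j 1))\<^sup>2 = (\<Sum>i\<in>UNIV. (M $ i $ j)\<^sup>2)" for j
    unfolding power2_norm_eq_inner
    by (simp add: inner_vec_def matrix_vector_mult_basis column_def power2_eq_square)
  then show ?thesis unfolding norm_square_matrix by (subst sum.swap) simp
qed

lemma inner_transpose: "x \<bullet> (transpose M *v y) = (M *v x) \<bullet> (y :: real^'m)"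
  for M :: "real^'n^'m"
  by (metis dot_lmul_matrix inner_commute transpose_matrix_vector)

text \<open>The form attains a positive minimum on the compact unit sphere; homogeneity does the
  rest.\<close>

lemma symmetric_pd_lower_bound:
  fixes R :: "real^'m^'m"
  assumes "symmetric_pd R"
  obtains c where "0 < c" "\<And>u. c * (norm u)\<^sup>2 \<le> u \<bullet> (R *v u)"
proof -
  let ?q = "\<lambda>u. u \<bullet> (R *v u)"
  have "continuous_on (sphere 0 1) ?q" by (intro continuous_intros)
  moreover have "sphere (0::real^'m) 1 \<noteq> {}" by (simp add: sphere_eq_empty)
  ultimately obtain w where w: "w \<in> sphere 0 1" "\<And>u. u \<in> sphere 0 1 \<Longrightarrow> ?q w \<le> ?q u"
    using continuous_attains_inf[OF compact_sphere] by blast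
  have "w \<noteq> 0" using w by auto
  then have pos: "0 < ?q w" using assms by (simp add: symmetric_pd_def)
  have "?q w * (norm u)\<^sup>2 \<le> ?q u" for u
  proof (cases "u = 0")
    case False
    have "?q w \<le> ?q (sgn u)" using False by (intro w) (simp add: norm_sgn)
    also have "\<dots> = ?q u / (norm u)\<^sup>2"
      by (simp add: sgn_div_norm matrix_vector_mult_scaleR power2_eq_square divide_simps)
    finally show ?thesis using False by (simp add: field_simps)
  qed simp
  with pos that show ?thesis by blast
qed

text \<open>Openness of the stabilizing set is an assumption here; the final theorem derives it from
  the smoothness hypothesis, whose balls of radius \<open>betaK\<close> stay inside the set.\<close>

locale lqr =
  fixes A :: "real^'n^'n" and B :: "real^'m^'n" and Q :: "real^'n^'n" and R :: "real^'m^'m"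
    and Dist :: "(real^'n) measure" and Cm :: real
  assumes Q: "symmetric_psd Q" and R: "symmetric_pd R"
    and prob_Dist: "prob_space Dist" and sets_Dist [measurable_cong]: "sets Dist = sets borel"
    and cov: "(\<integral>v. (\<chi> i j. v $ i * v $ j) \<partial>Dist) = (mat 1 :: real^'n^'n)"
    and Cm: "AE v in Dist. (norm v)\<^sup>2 \<le> Cm"
    and open_stabilizing: "open (stabilizing A B)"
begin

abbreviation "J \<equiv> lqr_cost A B Q R Dist"
abbreviation "Jx \<equiv> lqr_cost_from A B Q R"

definition "Jr K = real_of_ereal (J K)"
definition "jx K x = real_of_ereal (Jx K x)"

lemma J_stabilizing: "K \<in> stabilizing A B \<Longrightarrow> J K = ereal (Jr K)"
  and J_not_stabilizing: "K \<notin> stabilizing A B \<Longrightarrow> J K = \<infinity>"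
  by (simp_all add: Jr_def lqr_cost_def)

lemma integral_jx: "K \<in> stabilizing A B \<Longrightarrow> (\<integral>x. jx K x \<partial>Dist) = Jr K"
  by (simp add: Jr_def jx_def lqr_cost_def)

lemma stage_nonneg: "0 \<le> lqr_stage A B Q R K x t"
  by (rule lqr_stage_nonneg[OF Q R])

lemma Jr_sum:
  assumes "K \<in> stabilizing A B"
  shows "Jr K = (\<Sum>i\<in>UNIV. \<Sum>t. lqr_stage A B Q R K (axis i 1) t)"
  using lqr_cost_from_integral(2)[OF Q R prob_Dist sets_Dist cov Cm assms] integral_jx[OF assms]
  by (simp add: jx_def)

lemma GDERIV_Jr:
  assumes K: "K \<in> stabilizing A B"
  shows "GDERIV Jr K :> gradient Jr K"
proof -
  have "(\<lambda>K. \<Sum>i\<in>UNIV. \<Sum>t. lqr_stage A B Q R K (axis i 1) t) differentiable (at K)"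
    by (intro differentiable_sum ballI lqr_stage_sum_differentiable K) simp
  then obtain f' where "((\<lambda>K. \<Sum>i\<in>UNIV. \<Sum>t. lqr_stage A B Q R K (axis i 1) t) has_derivative f') (at K)"
    by (auto simp: differentiable_def)
  then have "(Jr has_derivative f') (at K)"
    by (rule has_derivative_transform_within_open[OF _ open_stabilizing K]) (simp add: Jr_sum)
  from GDERIV_gradient[OF has_derivative_imp_GDERIV[OF this]] show ?thesis .
qed

lemma continuous_on_Jr: "continuous_on (stabilizing A B) Jr"
  using GDERIV_Jr
  by (intro continuous_at_imp_continuous_on ballI has_derivative_continuous) (auto simp: gderiv_def)

lemma measurable_Jr [measurable]: "Jr \<in> borel_measurable borel"
proof -
  let ?S = "stabilizing A B"
  have "(\<lambda>K. indicator ?S K *\<^sub>R Jr K) \<in> borel_measurable borel"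
    by (intro borel_measurable_continuous_on_indicator continuous_on_Jr) (use open_stabilizing in auto)
  \<comment> \<open>\<open>real_of_ereal\<close> sends infinity to 0, so \<open>Jr\<close> vanishes
    off the stabilizing set.\<close>
  also have "(\<lambda>K. indicator ?S K *\<^sub>R Jr K) = Jr"
    by (auto simp: fun_eq_iff indicator_def Jr_def lqr_cost_def)
  finally show ?thesis .
qed

text \<open>The input cost of stage 0, started from each basis vector, already pays for every column
  of \<open>K\<close>. This makes sublevel sets bounded, so that the supremum \<open>beta\<close> is
  one of a bounded family.\<close>

lemma Jr_lower_bound:
  obtains c where "0 < c" "\<And>K. K \<in> stabilizing A B \<Longrightarrow> c * (norm K)\<^sup>2 \<le> Jr K"
proof -
  obtain c where c: "0 < c" "\<And>u. c * (norm u)\<^sup>2 \<le> u \<bullet> (R *v u)"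
    using symmetric_pd_lower_bound[OF R] by blast
  have "c * (norm K)\<^sup>2 \<le> Jr K" if K: "K \<in> stabilizing A B" for K
  proof -
    have "c * (norm K)\<^sup>2 = (\<Sum>i\<in>UNIV. c * (norm (K *v axis i 1))\<^sup>2)"
      by (simp add: norm_square_columns sum_distrib_left)
    also have "\<dots> \<le> (\<Sum>i\<in>UNIV. \<Sum>t. lqr_stage A B Q R K (axis i 1) t)"
    proof (rule sum_mono)
      fix i
      have "c * (norm (K *v axis i 1))\<^sup>2 \<le> lqr_stage A B Q R K (axis i 1) 0"
        using c(2)[of "K *v axis i 1"] Q by (simp add: lqr_stage_alt symmetric_psd_def add_increasing)
      also have "\<dots> \<le> (\<Sum>t. lqr_stage A B Q R K (axis i 1) t)"
        using sum_le_suminf[OF stabilizing_summable[OF K], of "{0}" Q R "axis i 1"] stage_nonneg by simp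
      finally show "c * (norm (K *v axis i 1))\<^sup>2 \<le> (\<Sum>t. lqr_stage A B Q R K (axis i 1) t)" .
    qed
    finally show ?thesis by (simp add: Jr_sum[OF K])
  qed
  with c that show ?thesis by blast
qed

end

text \<open>\<open>lev\<close> is instantiated with \<open>10 * Delta0\<close>, which turns the
  assumptions into statements about the set \<open>G0\<close>.\<close>

locale lqr_sublevel = lqr A B Q R Dist Cm
  for A :: "real^'n^'n" and B :: "real^'m^'n" and Q R Dist Cm +
  fixes Kstar :: "real^'n^'m" and lev phi0 rho0 gam M :: real
  assumes Kstar: "Kstar \<in> stabilizing A B" "\<And>K. K \<in> stabilizing A B \<Longrightarrow> Jr Kstar \<le> Jr K"
    and phi0: "0 < phi0" and rho0: "0 < rho0"
    and nbhd: "\<And>K1 K2. K1 \<in> stabilizing A B \<Longrightarrow> Jr K1 - Jr Kstar \<le> lev \<Longrightarrow> norm (K2 - K1) \<le> rho0 \<Longrightarrow>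
      K2 \<in> stabilizing A B \<and> norm (gradient Jr K2 - gradient Jr K1) \<le> phi0 * norm (K2 - K1)"
    and gam: "0 < gam" "gam < 1" and M: "0 < M"
    and decay: "\<And>K1 x t. K1 \<in> stabilizing A B \<Longrightarrow> Jr K1 - Jr Kstar \<le> lev \<Longrightarrow>
      (norm (lqr_state A B K1 x t))\<^sup>2 \<le> M * gam ^ (2 * t) * (norm x)\<^sup>2"
begin

definition "gap K = Jr K - Jr Kstar"
definition "sublevel b = {K \<in> stabilizing A B. gap K \<le> b}"
definition "beta = (SUP K\<in>sublevel lev. onorm ((*v) (Q + transpose K ** R ** K)))"

lemma gap_nonneg: "K \<in> stabilizing A B \<Longrightarrow> 0 \<le> gap K"
  using Kstar(2) by (simp add: gap_def)

lemma measurable_gap [measurable]: "gap \<in> borel_measurable borel"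
  unfolding gap_def[abs_def] by measurable

lemma sets_stabilizing [measurable]: "stabilizing A B \<in> sets borel"
  using open_stabilizing by simp

lemma sets_sublevel [measurable]: "sublevel b \<in> sets borel"
proof -
  have "sublevel b = stabilizing A B \<inter> {K \<in> space borel. gap K \<le> b}" by (auto simp: sublevel_def)
  also have "\<dots> \<in> sets borel" by measurable
  finally show ?thesis .
qed

lemma smooth_gap: "K \<in> sublevel lev \<Longrightarrow> smooth_at gap (gradient Jr) phi0 rho0 K"
  unfolding smooth_at_def
proof (intro allI impI conjI)
  fix K2 assume K: "K \<in> sublevel lev" and K2: "norm (K2 - K) \<le> rho0"
  have n: "K2 \<in> stabilizing A B" "norm (gradient Jr K2 - gradient Jr K) \<le> phi0 * norm (K2 - K)"
    using nbhd[of K K2] K K2 by (auto simp: sublevel_def gap_def)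
  then show "norm (gradient Jr K2 - gradient Jr K) \<le> phi0 * norm (K2 - K)" by simp
  show "GDERIV gap K2 :> gradient Jr K2"
    using GDERIV_Jr[OF n(1)] unfolding gderiv_def gap_def by (auto intro!: derivative_eq_intros)
qed

lemma near_sublevel: "K \<in> sublevel lev \<Longrightarrow> norm (K2 - K) \<le> rho0 \<Longrightarrow> K2 \<in> stabilizing A B"
  using nbhd[of K K2] by (auto simp: sublevel_def gap_def)

text \<open>Instance of \<open>gradient_norm_square_le\<close>: a point within \<open>rho0\<close>
  is still stabilizing, and if the gap has not increased it is again in the sublevel set.\<close>

lemma gradient_le: "K \<in> sublevel lev \<Longrightarrow> (norm (gradient Jr K))\<^sup>2 \<le> 2 * phi0 * gap K"
proof (rule gradient_norm_square_le[where S="sublevel lev", OF smooth_gap _ _ rho0 phi0])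
  show "K2 \<in> sublevel lev" if "K1 \<in> sublevel lev" "norm (K2 - K1) \<le> rho0" "gap K2 \<le> gap K1" for K1 K2
    using near_sublevel[OF that(1,2)] that by (simp add: sublevel_def)
qed (auto simp: sublevel_def gap_nonneg)

text \<open>With the gradient bounded by \<open>sqrt (2 * phi0 * b)\<close>, the quadratic upper
  bound is a perfect square: a query raises the square root of the gap bound by at most
  \<open>r * sqrt (phi0 / 2)\<close>. Hence the form of the condition on \<open>b\<close>.\<close>

lemma sublevel_step:
  assumes K: "K \<in> sublevel b" and r: "0 < r" "r \<le> rho0" and D: "norm D = 1"
    and b: "(sqrt b + r * sqrt (phi0 / 2))\<^sup>2 \<le> lev" and b0: "0 \<le> b"
  shows "K + r *\<^sub>R D \<in> sublevel lev"
proof -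
  have r': "0 \<le> r * sqrt (phi0 / 2)" using r phi0 by simp
  have "b \<le> (sqrt b + r * sqrt (phi0 / 2))\<^sup>2"
    using b0 power_mono[of "sqrt b" "sqrt b + r * sqrt (phi0 / 2)" 2] r' by simp
  then have KL: "K \<in> sublevel lev" using K b by (simp add: sublevel_def)
  have st: "K + r *\<^sub>R D \<in> stabilizing A B" using near_sublevel[OF KL] r D by simp
  have "norm (gradient Jr K) \<le> sqrt (2 * phi0 * gap K)"
    using real_sqrt_le_mono[OF gradient_le[OF KL]] by simp
  also have "\<dots> \<le> sqrt (2 * phi0 * b)" using K phi0 by (simp add: sublevel_def)
  finally have g: "norm (gradient Jr K) \<le> sqrt (2 * phi0 * b)" .
  have "gap (K + r *\<^sub>R D) \<le> gap K + r * norm (gradient Jr K) + phi0 / 2 * r\<^sup>2"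
    using smooth_at_value_bound[OF smooth_gap[OF KL] r D] by linarith
  also have "\<dots> \<le> b + r * sqrt (2 * phi0 * b) + phi0 / 2 * r\<^sup>2"
    using K g r phi0 by (intro add_mono mult_left_mono) (auto simp: sublevel_def)
  also have "\<dots> = (sqrt b + r * sqrt (phi0 / 2))\<^sup>2"
  proof -
    have "sqrt (2 * phi0 * b) = 2 * sqrt b * sqrt (phi0 / 2)"
    proof -
      have "2 * phi0 * b = 2\<^sup>2 * b * (phi0 / 2)" by simp
      then show ?thesis by (simp only: real_sqrt_mult real_sqrt_abs)
    qed
    then show ?thesis using b0 phi0 by (simp add: power2_sum power_mult_distrib mult_ac)
  qed
  also have "\<dots> \<le> lev" by (rule b)
  finally show ?thesis using st by (simp add: sublevel_def)
qed

lemma stage_le: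
  assumes K: "K \<in> sublevel lev"
  shows "lqr_stage A B Q R K x t \<le> beta * M * (gam\<^sup>2) ^ t * (norm x)\<^sup>2" and "0 \<le> beta"
proof -
  let ?S = "\<lambda>K. Q + transpose K ** R ** K"
  have bl: "bounded_linear ((*v) (M :: real^'n^'n))" for M
    by (simp add: linear_conv_bounded_linear[symmetric] matrix_vector_mul_linear)
  \<comment> \<open>The supremum in \<open>beta\<close> dominates its members only if the family is
    bounded; coercivity of the cost bounds the gains.\<close>
  have "bdd_above ((\<lambda>K. onorm ((*v) (?S K))) ` sublevel lev)"
  proof -
    obtain c where c: "0 < c" "\<And>K. K \<in> stabilizing A B \<Longrightarrow> c * (norm K)\<^sup>2 \<le> Jr K"
      using Jr_lower_bound by blast
    show ?thesis
    proof (rule bdd_aboveI2)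
      fix K assume K: "K \<in> sublevel lev"
      then have "c * (norm K)\<^sup>2 \<le> lev + Jr Kstar"
        using c(2)[of K] by (simp add: sublevel_def gap_def)
      then have K2: "(norm K)\<^sup>2 \<le> (lev + Jr Kstar) / c" using c(1) by (simp add: field_simps)
      show "onorm ((*v) (?S K)) \<le> norm Q + norm R * ((lev + Jr Kstar) / c)"
      proof (rule onorm_le)
        fix x :: "real^'n"
        have "norm (?S K *v x) \<le> norm (Q *v x) + norm (transpose K *v (R *v (K *v x)))"
          by (simp add: matrix_vector_mult_add_rdistrib norm_triangle_ineq flip: matrix_vector_mul_assoc)
        also have "\<dots> \<le> norm Q * norm x + norm (transpose K) * (norm R * (norm K * norm x))"
          by (intro add_mono order_trans[OF norm_matrix_vector_mult_le] mult_left_mono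
              norm_matrix_vector_mult_le) auto
        also have "\<dots> = norm Q * norm x + norm R * (norm K)\<^sup>2 * norm x"
          by (simp add: norm_transpose power2_eq_square)
        also have "\<dots> \<le> norm Q * norm x + norm R * ((lev + Jr Kstar) / c) * norm x"
          using K2 by (intro add_left_mono mult_right_mono mult_left_mono) auto
        finally show "norm (?S K *v x) \<le> (norm Q + norm R * ((lev + Jr Kstar) / c)) * norm x"
          by (simp add: algebra_simps)
      qed
    qed
  qed
  then have le: "onorm ((*v) (?S K)) \<le> beta" unfolding beta_def by (rule cSUP_upper[OF K])
  have "0 \<le> onorm ((*v) (?S K))" by (rule onorm_pos_le[OF bl])
  with le show b0: "0 \<le> beta" by linarith
  let ?s = "lqr_state A B K x t"
  have "lqr_stage A B Q R K x t = ?s \<bullet> (?S K *v ?s)"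
    by (simp only: lqr_stage_alt matrix_vector_mult_add_rdistrib inner_add_right inner_transpose
        matrix_vector_mul_assoc[symmetric])
  also have "\<dots> \<le> norm ?s * norm (?S K *v ?s)"
    using Cauchy_Schwarz_ineq2 abs_le_D1 by blast
  also have "\<dots> \<le> norm ?s * (beta * norm ?s)"
    using onorm[OF bl, of "?S K" ?s] mult_right_mono[OF le, of "norm ?s"] by (intro mult_left_mono) auto
  also have "\<dots> = beta * (norm ?s)\<^sup>2" by (simp add: power2_eq_square)
  also have "\<dots> \<le> beta * (M * gam ^ (2 * t) * (norm x)\<^sup>2)"
    using K b0 decay[of K x t] by (intro mult_left_mono) (auto simp: sublevel_def gap_def)
  finally show "lqr_stage A B Q R K x t \<le> beta * M * (gam\<^sup>2) ^ t * (norm x)\<^sup>2"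
    by (simp add: power_mult mult.assoc)
qed

lemma gam2: "0 < gam\<^sup>2" "gam\<^sup>2 < 1"
  using gam by (auto simp: power_less_one_iff abs_square_less_1)

lemma jx_eq:
  assumes "K \<in> sublevel lev"
  shows "Jx K x = ereal (\<Sum>t. lqr_stage A B Q R K x t)" "jx K x = (\<Sum>t. lqr_stage A B Q R K x t)"
proof -
  have "summable (lqr_stage A B Q R K x)"
    using assms by (intro stabilizing_summable) (simp add: sublevel_def)
  from lqr_cost_from_eq[OF this] show "Jx K x = ereal (\<Sum>t. lqr_stage A B Q R K x t)"
    "jx K x = (\<Sum>t. lqr_stage A B Q R K x t)"
    by (simp_all add: jx_def)
qed

lemma tail_cost:
  assumes K: "K \<in> sublevel lev"
  shows "0 \<le> jx K x - lqr_cost_horizon A B Q R N K x"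
    and "jx K x - lqr_cost_horizon A B Q R N K x \<le> beta * M * gam ^ (2 * N) / (1 - gam\<^sup>2) * (norm x)\<^sup>2"
proof -
  have sm: "summable (lqr_stage A B Q R K x)"
    using K by (intro stabilizing_summable) (simp add: sublevel_def)
  have eq: "jx K x - lqr_cost_horizon A B Q R N K x = (\<Sum>t. lqr_stage A B Q R K x (t + N))"
    using suminf_split_initial_segment[OF sm, of N] by (simp add: jx_eq[OF K] lqr_cost_horizon_def)
  have sm': "summable (\<lambda>t. lqr_stage A B Q R K x (t + N))" using sm by (simp add: summable_iff_shift)
  show "0 \<le> jx K x - lqr_cost_horizon A B Q R N K x"
    unfolding eq by (rule suminf_nonneg[OF sm' stage_nonneg])
  let ?g = "\<lambda>t. beta * M * (gam\<^sup>2) ^ N * (norm x)\<^sup>2 * (gam\<^sup>2) ^ t"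
  have "(\<Sum>t. lqr_stage A B Q R K x (t + N)) \<le> suminf ?g"
  proof (rule suminf_le[OF _ sm'])
    show "lqr_stage A B Q R K x (t + N) \<le> ?g t" for t
      using stage_le(1)[OF K, of x "t + N"] by (simp add: power_add mult_ac)
    show "summable ?g" using gam2 by (intro summable_mult summable_geometric) auto
  qed
  also have "suminf ?g = beta * M * (gam\<^sup>2) ^ N * (norm x)\<^sup>2 * (1 / (1 - gam\<^sup>2))"
    using gam2 by (subst suminf_mult) (auto simp: suminf_geometric)
  finally show "jx K x - lqr_cost_horizon A B Q R N K x \<le> beta * M * gam ^ (2 * N) / (1 - gam\<^sup>2) * (norm x)\<^sup>2"
    unfolding eq by (simp add: power_mult)
qed

text \<open>With horizon 0 the tail in \<open>tail_cost\<close> is the whole cost.\<close>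

lemma jx_bounds:
  assumes K: "K \<in> sublevel lev"
  shows "0 \<le> jx K x" and "jx K x \<le> beta * M / (1 - gam\<^sup>2) * (norm x)\<^sup>2"
    and "0 \<le> lqr_cost_horizon A B Q R N K x"
  using tail_cost[OF K, of x 0] stage_nonneg by (auto simp: lqr_cost_horizon_def intro: sum_nonneg)

end

section \<open>The gradient estimates\<close>

text \<open>\<open>b\<close> is the freezing level, low enough for both queried gains to stay in
  \<open>sublevel lev\<close>. The bound \<open>tail\<close> is scaled so that the estimator's
  factor \<open>d / r\<close> turns each truncation error into at most \<open>delta\<close>.\<close>

locale lqr_estimator = lqr_sublevel A B Q R Dist Cm Kstar lev phi0 rho0 gam M
  for A :: "real^'n^'n" and B :: "real^'m^'n" and Q R Dist Cm and Kstar :: "real^'n^'m"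
    and lev phi0 rho0 gam M +
  fixes r delta b d :: real and Td :: nat and mode :: estimator
  assumes r: "0 < r" "r \<le> rho0" and d: "d = real (CARD('m) * CARD('n))"
    and b: "0 \<le> b" "(sqrt b + r * sqrt (phi0 / 2))\<^sup>2 \<le> lev"
    and tail: "AE x in Dist. beta * M * gam ^ (2 * Td) / (1 - gam\<^sup>2) * (norm x)\<^sup>2 \<le> delta * r / d"
begin

abbreviation "noise \<equiv> Dist \<Otimes>\<^sub>M (sphere_uniform :: (real^'n^'m) measure)"

definition "estimate K z = grad_estimate mode jx r K (snd z) (fst z)"
definition "estimate_trunc K z = grad_estimate mode (lqr_cost_horizon A B Q R Td) r K (snd z) (fst z)"
definition "err K z = jx K z - lqr_cost_horizon A B Q R Td K z"

lemma d_pos: "0 < d" by (simp add: d)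

lemma d_DIM: "d = real DIM(real^'n^'m)" by (simp add: d)

sublocale Dist: prob_space Dist by (rule prob_Dist)
sublocale sphere: prob_space "sphere_uniform :: (real^'n^'m) measure" by (rule prob_space_sphere_uniform)
sublocale pair_prob_space Dist "sphere_uniform :: (real^'n^'m) measure" ..

lemma sublevel_b: "K \<in> sublevel b \<Longrightarrow> K \<in> sublevel lev"
proof -
  have "sqrt b \<le> sqrt b + r * sqrt (phi0 / 2)" using r phi0 by simp
  from power_mono[OF this, of 2] b show "K \<in> sublevel b \<Longrightarrow> K \<in> sublevel lev" by (simp add: sublevel_def)
qed

lemma sublevel_sphere:
  assumes "K \<in> sublevel b" "norm D = 1"
  shows "K + r *\<^sub>R D \<in> sublevel lev" "K - r *\<^sub>R D \<in> sublevel lev"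
proof -
  show "K + r *\<^sub>R D \<in> sublevel lev" using sublevel_step[OF assms(1) r assms(2) b(2,1)] .
  show "K - r *\<^sub>R D \<in> sublevel lev"
    using sublevel_step[OF assms(1) r _ b(2,1), of "- D"] assms(2) by simp
qed

lemma measurable_jx [measurable (raw)]:
  assumes [measurable]: "f \<in> borel_measurable N" "g \<in> borel_measurable N"
  shows "(\<lambda>w. jx (f w) (g w)) \<in> borel_measurable N"
  unfolding jx_def by measurable

lemma measurable_err [measurable (raw)]:
  assumes [measurable]: "f \<in> borel_measurable N" "g \<in> borel_measurable N"
  shows "(\<lambda>w. err (f w) (g w)) \<in> borel_measurable N"
  unfolding err_def by measurable

lemma estimate_cases:
  shows "estimate K z = (case mode of
     OnePoint \<Rightarrow> (jx (K + r *\<^sub>R snd z) (fst z) * (d / r)) *\<^sub>R snd z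
   | TwoPoint \<Rightarrow> ((jx (K + r *\<^sub>R snd z) (fst z) - jx (K - r *\<^sub>R snd z) (fst z)) * (d / (2 * r))) *\<^sub>R snd z)"
    (is "_ = ?G")
  and "estimate_trunc K z = (let c = lqr_cost_horizon A B Q R Td in case mode of
     OnePoint \<Rightarrow> (c (K + r *\<^sub>R snd z) (fst z) * (d / r)) *\<^sub>R snd z
   | TwoPoint \<Rightarrow> ((c (K + r *\<^sub>R snd z) (fst z) - c (K - r *\<^sub>R snd z) (fst z)) * (d / (2 * r))) *\<^sub>R snd z)"
    (is "_ = ?T")
  and "estimate K z - estimate_trunc K z = (case mode of
     OnePoint \<Rightarrow> (err (K + r *\<^sub>R snd z) (fst z) * (d / r)) *\<^sub>R snd z
   | TwoPoint \<Rightarrow> ((err (K + r *\<^sub>R snd z) (fst z) - err (K - r *\<^sub>R snd z) (fst z)) * (d / (2 * r))) *\<^sub>R snd z)"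
    (is "_ = ?E")
proof -
  show 1: "estimate K z = ?G" unfolding estimate_def grad_estimate_def Let_def d ..
  show 2: "estimate_trunc K z = ?T" unfolding estimate_trunc_def grad_estimate_def Let_def d ..
  show "estimate K z - estimate_trunc K z = ?E"
    unfolding 1 2 Let_def err_def
    by (cases mode; simp only: estimator.case scaleR_left_diff_distrib[symmetric] left_diff_distrib[symmetric])
      (simp add: algebra_simps)
qed

lemma measurable_estimate [measurable]: "estimate K \<in> borel_measurable noise"
  unfolding estimate_cases(1)[abs_def] by (cases mode) simp_all

lemma measurable_estimate_trunc_pair [measurable]:
  "(\<lambda>(K, z). estimate_trunc K z) \<in> borel_measurable (borel \<Otimes>\<^sub>M (borel \<Otimes>\<^sub>M borel))"
  unfolding estimate_cases(2) Let_def case_prod_beta by (cases mode) simp_all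

lemma measurable_estimate_trunc [measurable]: "estimate_trunc K \<in> borel_measurable noise"
  unfolding estimate_cases(2)[abs_def] Let_def by (cases mode) simp_all

lemma AE_noise:
  "AE z in noise. norm (snd z) = 1 \<and> (norm (fst z))\<^sup>2 \<le> Cm
     \<and> beta * M * gam ^ (2 * Td) / (1 - gam\<^sup>2) * (norm (fst z))\<^sup>2 \<le> delta * r / d"
proof (rule AE_pair_measure)
  show "AE x in Dist. AE D in sphere_uniform. norm (snd (x, D :: real^'n^'m)) = 1 \<and> (norm (fst (x, D)))\<^sup>2 \<le> Cm
     \<and> beta * M * gam ^ (2 * Td) / (1 - gam\<^sup>2) * (norm (fst (x, D)))\<^sup>2 \<le> delta * r / d"
    using Cm tail
  proof eventually_elim
    case (elim x)
    show ?case using AE_sphere_uniform by eventually_elim (use elim in simp)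
  qed
qed measurable

text \<open>Truncation only drops nonnegative stages, so the scaled errors lie in the interval from
  0 to \<open>delta\<close>; their sign is what later saves a factor 2.\<close>

lemma AE_err:
  assumes K: "K \<in> sublevel b"
  shows "AE z in noise. norm (snd z) = 1
    \<and> 0 \<le> err (K + r *\<^sub>R snd z) (fst z) * (d / r) \<and> err (K + r *\<^sub>R snd z) (fst z) * (d / r) \<le> delta
    \<and> 0 \<le> err (K - r *\<^sub>R snd z) (fst z) * (d / r) \<and> err (K - r *\<^sub>R snd z) (fst z) * (d / r) \<le> delta"
  using AE_noise
proof eventually_elim
  case (elim z)
  have e: "0 \<le> err L (fst z) * (d / r) \<and> err L (fst z) * (d / r) \<le> delta" if "L \<in> sublevel lev" for L
  proof -
    have "0 \<le> err L (fst z)" "err L (fst z) \<le> delta * r / d"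
      using tail_cost[OF that, where x="fst z" and N=Td] elim by (auto simp: err_def)
    then show ?thesis using r d_pos by (simp add: field_simps)
  qed
  show ?case using elim e sublevel_sphere[OF K] by blast
qed

text \<open>Averaging over the initial state first replaces the sampled cost by \<open>Jr\<close>.
  The sign \<open>s\<close> covers both query points of the two-point estimate.\<close>

lemma one_point_mean:
  assumes K: "K \<in> sublevel b" and s: "\<bar>s\<bar> = 1"
  shows "integrable noise (\<lambda>z. (jx (K + (s * r) *\<^sub>R snd z) (fst z) * (d / r)) *\<^sub>R snd z)"
    and "(\<integral>z. (jx (K + (s * r) *\<^sub>R snd z) (fst z) * (d / r)) *\<^sub>R snd z \<partial>noise)
      = (\<integral>D. (Jr (K + (s * r) *\<^sub>R D) * (d / r)) *\<^sub>R D \<partial>sphere_uniform)"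
proof -
  let ?C = "beta * M / (1 - gam\<^sup>2)"
  have sub: "K + (s * r) *\<^sub>R D \<in> sublevel lev" if "norm D = 1" for D
    using sublevel_sphere[OF K that] s by (cases "s = 1") (auto simp: abs_if split: if_splits)
  show int: "integrable noise (\<lambda>z. (jx (K + (s * r) *\<^sub>R snd z) (fst z) * (d / r)) *\<^sub>R snd z)"
  proof (rule integrable_bounded)
    show "AE z in noise. norm ((jx (K + (s * r) *\<^sub>R snd z) (fst z) * (d / r)) *\<^sub>R snd z) \<le> ?C * Cm * (d / r)"
      using AE_noise
    proof eventually_elim
      case (elim z)
      have S: "K + (s * r) *\<^sub>R snd z \<in> sublevel lev" using elim by (intro sub) simp
      have "0 \<le> ?C" using stage_le(2)[OF S] M gam2 by simp
      then have "jx (K + (s * r) *\<^sub>R snd z) (fst z) \<le> ?C * Cm"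
        using jx_bounds(2)[OF S, of "fst z"] elim by (meson mult_left_mono order_trans)
      then have "jx (K + (s * r) *\<^sub>R snd z) (fst z) * (d / r) \<le> ?C * Cm * (d / r)"
        using r d_pos by (intro mult_right_mono) auto
      then show ?case using elim jx_bounds(1)[OF S, of "fst z"] r d_pos by simp
    qed
  qed measurable
  have "(\<integral>z. (jx (K + (s * r) *\<^sub>R snd z) (fst z) * (d / r)) *\<^sub>R snd z \<partial>noise)
      = (\<integral>D. (\<integral>x. (jx (K + (s * r) *\<^sub>R D) x * (d / r)) *\<^sub>R D \<partial>Dist) \<partial>sphere_uniform)"
    by (rule integral_snd[of "\<lambda>x D. (jx (K + (s * r) *\<^sub>R D) x * (d / r)) *\<^sub>R D",
        unfolded case_prod_unfold, OF int, symmetric])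
  also have "\<dots> = (\<integral>D. (Jr (K + (s * r) *\<^sub>R D) * (d / r)) *\<^sub>R D \<partial>sphere_uniform)"
  proof (rule integral_cong_AE)
    show "AE D in sphere_uniform. (\<integral>x. (jx (K + (s * r) *\<^sub>R D) x * (d / r)) *\<^sub>R D \<partial>Dist)
        = (Jr (K + (s * r) *\<^sub>R D) * (d / r)) *\<^sub>R D"
      using AE_sphere_uniform
    proof eventually_elim
      case (elim D)
      then have st: "K + (s * r) *\<^sub>R D \<in> stabilizing A B" using sub[of D] by (simp add: sublevel_def)
      then have "integrable Dist (jx (K + (s * r) *\<^sub>R D))"
        using lqr_cost_from_integral(1)[OF Q R prob_Dist sets_Dist cov Cm] by (simp add: jx_def[abs_def])
      then show ?case by (simp add: integral_jx[OF st])
    qed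
  qed measurable
  finally show "(\<integral>z. (jx (K + (s * r) *\<^sub>R snd z) (fst z) * (d / r)) *\<^sub>R snd z \<partial>noise)
      = (\<integral>D. (Jr (K + (s * r) *\<^sub>R D) * (d / r)) *\<^sub>R D \<partial>sphere_uniform)" .
qed

lemma smooth_Jr: "K \<in> sublevel lev \<Longrightarrow> smooth_at Jr (gradient Jr) phi0 rho0 K"
  using smooth_atD(2)[OF smooth_gap] near_sublevel GDERIV_Jr by (auto simp: smooth_at_def)

text \<open>The two-point estimate is half the difference of the one-point expressions at
  \<open>r\<close> and \<open>- r\<close>. Replacing \<open>D\<close> by \<open>- D\<close> shows
  that their means are opposite, so both settings have the same mean and
  \<open>smoothing_bias\<close> applies to either.\<close>

lemma estimate_mean:
  assumes K: "K \<in> sublevel b"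
  shows "integrable noise (estimate K)"
    and "norm ((\<integral>z. estimate K z \<partial>noise) - gradient Jr K) \<le> phi0 * r"
proof -
  let ?P = "\<lambda>s z. (jx (K + (s * r) *\<^sub>R snd z) (fst z) * (d / r)) *\<^sub>R snd z"
  let ?I = "\<lambda>s. \<integral>D. (Jr (K + (s * r) *\<^sub>R D) * (d / r)) *\<^sub>R D \<partial>sphere_uniform"
  have p: "integrable noise (?P s)" "(\<integral>z. ?P s z \<partial>noise) = ?I s" if "\<bar>s\<bar> = 1" for s
    by (rule one_point_mean[OF K that])+
  have opp: "?I (- 1) = - ?I 1"
  proof -
    have "- ?I (- 1) = ?I 1"
      using integral_sphere_uminus[of "\<lambda>D. (Jr (K + r *\<^sub>R D) * (d / r)) *\<^sub>R D"] by simp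
    from arg_cong[OF this, of uminus] show ?thesis by (simp only: minus_minus)
  qed
  have bias: "norm (?I 1 - gradient Jr K) \<le> phi0 * r"
    using smoothing_bias(2)[OF smooth_Jr[OF sublevel_b[OF K]] r _ measurable_Jr] phi0 by (simp add: d_DIM)
  have "integrable noise (estimate K) \<and> (\<integral>z. estimate K z \<partial>noise) = ?I 1"
  proof (cases mode)
    case OnePoint
    show ?thesis unfolding estimate_cases(1)[abs_def] using p[of 1] OnePoint by simp
  next
    case TwoPoint
    have e: "estimate K = (\<lambda>z. (1 / 2) *\<^sub>R (?P 1 z - ?P (- 1) z))"
      unfolding estimate_cases(1)[abs_def] using TwoPoint
      by (simp add: fun_eq_iff left_diff_distrib diff_divide_distrib scaleR_diff_left scaleR_diff_right)
    have "(\<integral>z. estimate K z \<partial>noise) = (1 / 2) *\<^sub>R (?I 1 - ?I (- 1))"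
      unfolding e integral_scaleR_right
      by (subst Bochner_Integration.integral_diff[OF p(1) p(1)]; simp only: p(2) abs_one abs_minus_cancel)
    also have "\<dots> = ?I 1" unfolding opp by (simp only: diff_minus_eq_add scaleR_half_double)
    finally have "(\<integral>z. estimate K z \<partial>noise) = ?I 1" .
    moreover have "integrable noise (estimate K)"
      unfolding e by (intro integrable_scaleR_right Bochner_Integration.integrable_diff p) simp_all
    ultimately show ?thesis by blast
  qed
  with bias show "integrable noise (estimate K)"
    and "norm ((\<integral>z. estimate K z \<partial>noise) - gradient Jr K) \<le> phi0 * r" by auto
qed

text \<open>In the two-point case two errors between 0 and \<open>delta\<close> are subtracted and
  halved, so \<open>delta / 2\<close> holds pointwise. In the one-point case it holds for the mean
  only.\<close>

lemma truncation_error: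
  assumes K: "K \<in> sublevel b"
  shows "AE z in noise. norm (estimate K z - estimate_trunc K z) \<le> delta"
    and "mode = TwoPoint \<Longrightarrow> AE z in noise. norm (estimate K z - estimate_trunc K z) \<le> delta / 2"
    and "norm (\<integral>z. estimate K z - estimate_trunc K z \<partial>noise) \<le> delta / 2"
proof -
  have two: "AE z in noise. norm (estimate K z - estimate_trunc K z) \<le> delta / 2" if "mode = TwoPoint"
    using AE_err[OF K]
  proof eventually_elim
    case (elim z)
    let ?a = "err (K + r *\<^sub>R snd z) (fst z) * (d / r)" and ?c = "err (K - r *\<^sub>R snd z) (fst z) * (d / r)"
    have "norm (estimate K z - estimate_trunc K z) = \<bar>?a - ?c\<bar> / 2"
      unfolding estimate_cases(3) using elim that r d_pos
      by (simp add: abs_mult abs_divide flip: left_diff_distrib diff_divide_distrib)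
    also have "\<dots> \<le> delta / 2" using elim by (intro divide_right_mono) auto
    finally show ?case .
  qed
  then show "mode = TwoPoint \<Longrightarrow> AE z in noise. norm (estimate K z - estimate_trunc K z) \<le> delta / 2" .
  show "AE z in noise. norm (estimate K z - estimate_trunc K z) \<le> delta"
  proof (cases mode)
    case OnePoint
    show ?thesis
      using AE_err[OF K] unfolding estimate_cases(3)
    proof eventually_elim
      case (elim z)
      then have "norm ((err (K + r *\<^sub>R snd z) (fst z) * (d / r)) *\<^sub>R snd z) \<le> delta"
        by (simp only: norm_scaleR abs_of_nonneg mult_1_right)
      then show ?case using OnePoint by simp
    qed
  next
    case TwoPoint
    show ?thesis using two[OF TwoPoint] AE_err[OF K] by eventually_elim linarith
  qed
  show "norm (\<integral>z. estimate K z - estimate_trunc K z \<partial>noise) \<le> delta / 2"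
  proof (cases mode)
    case TwoPoint
    show ?thesis by (rule norm_integral_le_const[OF _ two[OF TwoPoint]]) measurable
  next
    case OnePoint
    let ?c = "\<lambda>z. err (K + r *\<^sub>R snd z) (fst z) * (d / r)"
    \<comment> \<open>Subtracting the constant \<open>delta / 2\<close> centres the error; it leaves
      the mean unchanged because the direction has mean zero.\<close>
    have bd: "AE z in noise. norm ((?c z - delta / 2) *\<^sub>R snd z) \<le> delta / 2"
      using AE_err[OF K]
    proof eventually_elim
      case (elim z)
      then have "\<bar>?c z - delta / 2\<bar> \<le> delta / 2" by linarith
      then show ?case using elim by simp
    qed
    have one: "AE z in noise. norm (snd z :: real^'n^'m) \<le> 1" using AE_noise by eventually_elim simp
    have i1: "integrable noise (\<lambda>z. (?c z - delta / 2) *\<^sub>R snd z)" by (rule integrable_bounded[OF _ bd]) measurable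
    have i2: "integrable noise (\<lambda>z. snd z :: real^'n^'m)" by (rule integrable_bounded[OF _ one]) measurable
    have "(\<integral>z. snd z \<partial>noise) = (\<integral>D. (\<integral>x. D \<partial>Dist) \<partial>(sphere_uniform :: (real^'n^'m) measure))"
      by (rule integral_snd[of "\<lambda>x D. D", unfolded case_prod_unfold, OF i2, symmetric])
    also have "\<dots> = 0" by (simp add: Dist.prob_space integral_sphere_id)
    finally have z: "(\<integral>z. snd z \<partial>noise) = (0 :: real^'n^'m)" .
    have "(\<integral>z. estimate K z - estimate_trunc K z \<partial>noise)
        = (\<integral>z. (?c z - delta / 2) *\<^sub>R snd z + (delta / 2) *\<^sub>R snd z \<partial>noise)"
      unfolding estimate_cases(3) using OnePoint by (simp add: scaleR_diff_left)
    also have "\<dots> = (\<integral>z. (?c z - delta / 2) *\<^sub>R snd z \<partial>noise)"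
      using i1 i2 z by simp
    finally show ?thesis using norm_integral_le_const[OF _ bd] by simp
  qed
qed

text \<open>The second moment needs two arguments. In the one-point case truncation shrinks the
  estimate pointwise, so the untruncated second moment dominates; perturbation by
  \<open>delta\<close> would give a term \<open>3 * delta\<^sup>2\<close> there. A difference of two
  costs is not monotone under truncation, but its error is only \<open>delta / 2\<close>, and
  \<open>perturbed_second_moment\<close> gives \<open>3 / 4 * delta\<^sup>2\<close>.\<close>

lemma estimate_trunc_moments:
  assumes K: "K \<in> sublevel b" and sup: "AE z in noise. norm (estimate K z) \<le> ginf"
    and var: "(\<integral>\<^sup>+z. ennreal ((norm (estimate K z - (\<integral>z. estimate K z \<partial>noise)))\<^sup>2) \<partial>noise) \<le> ennreal g2"
    and g2: "0 \<le> g2"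
  shows "AE z in noise. norm (estimate_trunc K z) \<le> ginf + delta"
    and "norm ((\<integral>z. estimate_trunc K z \<partial>noise) - gradient Jr K) \<le> phi0 * r + delta / 2"
    and "(\<integral>z. (norm (estimate_trunc K z))\<^sup>2 \<partial>noise)
      \<le> (norm (gradient Jr K) + (phi0 * r + delta / 2))\<^sup>2 + (3 / 2 * g2 + 3 / 4 * delta\<^sup>2)"
proof -
  define m where "m = (\<integral>z. estimate K z \<partial>noise)"
  define G where "G = norm (gradient Jr K)"
  let ?e = "\<lambda>z. estimate K z - estimate_trunc K z"
  note err = truncation_error[OF K]
  show bd: "AE z in noise. norm (estimate_trunc K z) \<le> ginf + delta"
    using sup err(1)
  proof eventually_elim
    case (elim z)
    then show ?case using norm_triangle_ineq2[of "estimate_trunc K z" "estimate K z"]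
      by (simp add: norm_minus_commute)
  qed
  have i: "integrable noise (estimate K)" "integrable noise (estimate_trunc K)"
    using integrable_bounded[OF _ sup] integrable_bounded[OF _ bd] by auto
  have mean: "(\<integral>z. estimate_trunc K z \<partial>noise) = m - (\<integral>z. ?e z \<partial>noise)"
    using i by (simp add: m_def)
  have mb: "norm (m - gradient Jr K) \<le> phi0 * r" using estimate_mean(2)[OF K] by (simp add: m_def)
  show bias: "norm ((\<integral>z. estimate_trunc K z \<partial>noise) - gradient Jr K) \<le> phi0 * r + delta / 2"
    unfolding mean using norm_triangle_ineq4[of "m - gradient Jr K" "\<integral>z. ?e z \<partial>noise"] mb err(3)
    by (simp add: algebra_simps)
  have delta0: "0 \<le> delta" using order_trans[OF norm_ge_zero err(3)] by simp
  have vb: "AE z in noise. norm (estimate K z - m) \<le> ginf + norm m"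
    using sup by eventually_elim (rule norm_triangle_le_diff, simp)
  have var': "(\<integral>z. (norm (estimate K z - m))\<^sup>2 \<partial>noise) \<le> g2"
  proof -
    have "integrable noise (\<lambda>z. (norm (estimate K z - m))\<^sup>2)"
      by (rule integrable_norm_square_bounded[OF _ vb]) measurable
    from nn_integral_eq_integral[OF this] var g2 show ?thesis by (simp add: m_def)
  qed
  show "(\<integral>z. (norm (estimate_trunc K z))\<^sup>2 \<partial>noise)
      \<le> (G + (phi0 * r + delta / 2))\<^sup>2 + (3 / 2 * g2 + 3 / 4 * delta\<^sup>2)"
  proof (cases mode)
    case OnePoint
    have le: "AE z in noise. norm (estimate_trunc K z) \<le> norm (estimate K z)"
      using AE_noise
    proof eventually_elim
      case (elim z)
      then have S: "K + r *\<^sub>R snd z \<in> sublevel lev" by (intro sublevel_sphere(1)[OF K]) simp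
      show ?case
        unfolding estimate_cases(1,2) Let_def
        using elim OnePoint tail_cost(1)[OF S, where x="fst z" and N=Td] r d_pos
          jx_bounds(1,3)[OF S, where x="fst z"]
        by (simp add: divide_right_mono mult_right_mono)
    qed
    have "(\<integral>z. (norm (estimate_trunc K z))\<^sup>2 \<partial>noise) \<le> (\<integral>z. (norm (estimate K z))\<^sup>2 \<partial>noise)"
    proof (rule integral_mono_AE)
      show "integrable noise (\<lambda>z. (norm (estimate_trunc K z))\<^sup>2)"
        by (rule integrable_norm_square_bounded[OF _ bd]) measurable
      show "integrable noise (\<lambda>z. (norm (estimate K z))\<^sup>2)"
        by (rule integrable_norm_square_bounded[OF _ sup]) measurable
      show "AE z in noise. (norm (estimate_trunc K z))\<^sup>2 \<le> (norm (estimate K z))\<^sup>2"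
        using le by eventually_elim (simp add: power_mono)
    qed
    also have "\<dots> = (\<integral>z. (norm (estimate K z - m))\<^sup>2 \<partial>noise) + (norm m)\<^sup>2"
      using norm_square_integral_decompose[OF _ sup, of 0] by (simp add: m_def)
    also have "\<dots> \<le> g2 + (G + (phi0 * r + delta / 2))\<^sup>2"
    proof (intro add_mono var' power_mono)
      show "norm m \<le> G + (phi0 * r + delta / 2)"
        using norm_triangle_ineq2[of m "gradient Jr K"] mb delta0 by (simp add: G_def)
    qed simp
    finally show ?thesis using g2 zero_le_power2[of delta] by linarith
  next
    case TwoPoint
    have "(\<integral>z. (norm (estimate K z - ?e z))\<^sup>2 \<partial>noise)
      \<le> (norm (\<integral>z. estimate K z - ?e z \<partial>noise))\<^sup>2
        + 3 / 2 * (\<integral>z. (norm (estimate K z - m))\<^sup>2 \<partial>noise) + 3 * (delta / 2)\<^sup>2"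
      unfolding m_def by (rule perturbed_second_moment[OF _ _ sup err(2)[OF TwoPoint]]) measurable
    also have "\<dots> \<le> (G + (phi0 * r + delta / 2))\<^sup>2 + 3 / 2 * g2 + 3 * (delta / 2)\<^sup>2"
    proof (intro add_mono mult_left_mono var' power_mono)
      show "norm (\<integral>z. estimate K z - ?e z \<partial>noise) \<le> G + (phi0 * r + delta / 2)"
        using norm_triangle_ineq2[of "\<integral>z. estimate_trunc K z \<partial>noise" "gradient Jr K"] bias by (simp add: G_def)
    qed (use delta0 in simp_all)
    finally show ?thesis by (simp add: power2_eq_square)
  qed
qed

end

section \<open>The stopped iteration\<close>

locale lqr_descent = lqr_estimator A B Q R Dist Cm Kstar lev phi0 rho0 gam M r delta b d Td mode
  for A :: "real^'n^'n" and B :: "real^'m^'n" and Q R Dist Cm and Kstar :: "real^'n^'m"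
    and lev phi0 rho0 gam M r delta b d Td mode +
  fixes mu eps eta ginf g2 :: real
  assumes mu: "0 < mu" "\<And>K. K \<in> stabilizing A B \<Longrightarrow> mu * (Jr K - Jr Kstar) \<le> (norm (gradient Jr K))\<^sup>2"
    and eps: "0 < eps" and eta: "0 < eta" "phi0 * eta \<le> 1 / 4" "eta * mu \<le> 1"
    and sup: "\<And>K. K \<in> sublevel b \<Longrightarrow> AE z in noise. norm (estimate K z) \<le> ginf"
    and var: "\<And>K. K \<in> sublevel b \<Longrightarrow>
      (\<integral>\<^sup>+z. ennreal ((norm (estimate K z - (\<integral>z. estimate K z \<partial>noise)))\<^sup>2) \<partial>noise) \<le> ennreal g2"
    and g2: "0 \<le> g2" and step_length: "eta * (ginf + delta) \<le> rho0"
    and bias_le: "(phi0 * r + delta / 2)\<^sup>2 \<le> mu * eps / 80"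
    and noise_le: "phi0 * eta / 2 * (3 / 2 * g2 + 3 / 4 * delta\<^sup>2) \<le> 9 / 3840 * (mu * eps)"
begin

text \<open>The infinite value makes leaving the stabilizing set count as an exit in Markov's
  inequality.\<close>

definition "cost K = (if K \<in> stabilizing A B then ennreal (gap K) else \<top>)"
definition "stopped_step K z = (if K \<in> sublevel b then K - eta *\<^sub>R estimate_trunc K z else K)"

lemma stopped_step_simps [simp]:
  "K \<in> sublevel b \<Longrightarrow> stopped_step K z = K - eta *\<^sub>R estimate_trunc K z"
  "K \<notin> sublevel b \<Longrightarrow> stopped_step K z = K"
  by (simp_all add: stopped_step_def)

lemma measurable_cost [measurable]: "cost \<in> borel_measurable borel"
  unfolding cost_def[abs_def] by measurable

lemma measurable_stopped_step [measurable]: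
  "case_prod stopped_step \<in> borel_measurable (borel \<Otimes>\<^sub>M (borel \<Otimes>\<^sub>M borel))"
proof -
  have "case_prod stopped_step = (\<lambda>p. if fst p \<in> sublevel b
      then fst p - eta *\<^sub>R case_prod estimate_trunc p else fst p)"
    by (auto simp: stopped_step_def fun_eq_iff)
  also have "\<dots> \<in> borel_measurable (borel \<Otimes>\<^sub>M (borel \<Otimes>\<^sub>M borel))"
    using measurable_estimate_trunc_pair by measurable
  finally show ?thesis .
qed

text \<open>A step has length at most \<open>rho0\<close> almost surely, so it stays where the
  quadratic bound holds. The first estimate absorbs the gradient term and serves to control exits;
  the second keeps a quarter of its square for the contraction.\<close>

lemma expected_cost_step:
  assumes K: "K \<in> sublevel b"
  shows "(\<integral>\<^sup>+z. cost (stopped_step K z) \<partial>noise) \<le> ennreal (gap K + eta * mu * eps / 100)"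
    and "(\<integral>\<^sup>+z. cost (stopped_step K z) \<partial>noise) \<le> ennreal ((1 - eta * mu / 4) * gap K + eta * mu * eps / 80)"
proof -
  define G where "G = norm (gradient Jr K)"
  define V where "V = 3 / 2 * g2 + 3 / 4 * delta\<^sup>2"
  note KL = sublevel_b[OF K]
  note mom = estimate_trunc_moments[OF K sup[OF K] var[OF K] g2]
  have st: "AE z in noise. eta * norm (estimate_trunc K z) \<le> rho0"
    using mom(1)
  proof eventually_elim
    case (elim z)
    then have "eta * norm (estimate_trunc K z) \<le> eta * (ginf + delta)" using eta by (intro mult_left_mono) auto
    with step_length show ?case by simp
  qed
  note des = expected_descent[OF smooth_gap[OF KL] measurable_gap measurable_estimate_trunc st eta(1) phi0 eta(2) mom(2,3)]
  have near: "AE z in noise. K - eta *\<^sub>R estimate_trunc K z \<in> stabilizing A B"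
    using st
  proof eventually_elim
    case (elim z)
    then show ?case using eta by (intro near_sublevel[OF KL]) simp
  qed
  have "(\<integral>\<^sup>+z. cost (stopped_step K z) \<partial>noise) = (\<integral>\<^sup>+z. ennreal (gap (K - eta *\<^sub>R estimate_trunc K z)) \<partial>noise)"
  proof (rule nn_integral_cong_AE)
    show "AE z in noise. cost (stopped_step K z) = ennreal (gap (K - eta *\<^sub>R estimate_trunc K z))"
      using near by eventually_elim (simp add: cost_def stopped_step_def K)
  qed
  also have "\<dots> = ennreal (\<integral>z. gap (K - eta *\<^sub>R estimate_trunc K z) \<partial>noise)"
  proof (rule nn_integral_eq_integral[OF des(1)])
    show "AE z in noise. 0 \<le> gap (K - eta *\<^sub>R estimate_trunc K z)"
      using near by eventually_elim (rule gap_nonneg)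
  qed
  finally have int: "(\<integral>\<^sup>+z. cost (stopped_step K z) \<partial>noise) = \<dots>" .
  let ?e = "phi0 * r + delta / 2" and ?w = "phi0 * eta / 2 * V"
  have "phi0 * eta\<^sup>2 / 2 * V = eta * ?w" by (simp add: power2_eq_square)
  with des(2) have le: "(\<integral>z. gap (K - eta *\<^sub>R estimate_trunc K z) \<partial>noise)
      \<le> gap K + eta * (5 / 4 * G * ?e + ?e\<^sup>2 / 8 - 7 / 8 * G\<^sup>2 + ?w)"
    by (simp add: G_def V_def distrib_left)
  note db = drift_bounds[where \<mu>=mu and \<epsilon>=eps, OF bias_le noise_le[folded V_def], of G]
  have me: "0 \<le> mu * eps" using mu eps by simp
  have "(\<integral>z. gap (K - eta *\<^sub>R estimate_trunc K z) \<partial>noise) \<le> gap K + eta * (mu * eps / 100)"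
    using le mult_left_mono[OF db(1)[OF me], of eta] eta by linarith
  then show "(\<integral>\<^sup>+z. cost (stopped_step K z) \<partial>noise) \<le> ennreal (gap K + eta * mu * eps / 100)"
    unfolding int by (intro ennreal_leI) (simp add: mult.assoc)
  \<comment> \<open>Gradient domination converts the retained square into a multiple of the
    gap.\<close>
  have "mu * gap K \<le> G\<^sup>2" using mu(2)[of K] K by (simp add: G_def gap_def sublevel_def)
  then have "eta * (mu * eps / 80 - G\<^sup>2 / 4) \<le> eta * (mu * eps / 80 - mu * gap K / 4)"
    using eta by (intro mult_left_mono) auto
  then have "(\<integral>z. gap (K - eta *\<^sub>R estimate_trunc K z) \<partial>noise) \<le> gap K + eta * (mu * eps / 80 - mu * gap K / 4)"
    using le mult_left_mono[OF db(2)[OF me], of eta] eta by linarith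
  also have "\<dots> = (1 - eta * mu / 4) * gap K + eta * mu * eps / 80" by (simp add: algebra_simps)
  finally show "(\<integral>\<^sup>+z. cost (stopped_step K z) \<partial>noise)
      \<le> ennreal ((1 - eta * mu / 4) * gap K + eta * mu * eps / 80)"
    unfolding int by (rule ennreal_leI)
qed

text \<open>
  The iteration is compared with the process that freezes at its first exit from \<open>sublevel b\<close>.
  Unlike the iteration itself, the frozen process depends on the past samples only, and it has
  left \<open>sublevel b\<close> by time \<open>T\<close> iff it is outside at time \<open>T\<close>.
\<close>

lemma stopped_process_bounds:
  assumes "prob_space Pr" and K0: "K0 \<in> stabilizing A B"
    and law: "\<And>s. s < T \<Longrightarrow> distr Pr (borel \<Otimes>\<^sub>M borel) (Z s) = noise"
    and indep: "prob_space.indep_vars Pr (\<lambda>_. borel \<Otimes>\<^sub>M borel) Z {..<T}"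
    and s: "s \<le> T"
  shows "(\<integral>\<^sup>+\<omega>. cost (noisy_iterate stopped_step K0 (\<lambda>i. Z i \<omega>) s) \<partial>Pr)
      \<le> ennreal (gap K0 + real s * (eta * mu * eps / 100))" (is "?E s \<le> _")
    and "(\<integral>\<^sup>+\<omega>. cost (noisy_iterate stopped_step K0 (\<lambda>i. Z i \<omega>) s)
        * indicator (sublevel b) (noisy_iterate stopped_step K0 (\<lambda>i. Z i \<omega>) s) \<partial>Pr)
      \<le> ennreal ((1 - eta * mu / 4) ^ s * gap K0 + eps / 20)" (is "?W s \<le> _")
proof -
  interpret Pr: prob_space Pr by fact
  have g0: "0 \<le> gap K0" by (rule gap_nonneg[OF K0])
  have q: "0 \<le> 1 - eta * mu / 4" using eta by simp
  have c: "0 \<le> eta * mu * eps / 100" "0 \<le> eta * mu * eps / 80" using eta mu eps by auto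
  have cost_K: "cost K = ennreal (gap K)" "0 \<le> gap K" if "K \<in> sublevel b" for K
    using that gap_nonneg by (auto simp: cost_def sublevel_def)
  have E: "?E (Suc s) \<le> 1 * ?E s + ennreal (eta * mu * eps / 100)" if "s < T" for s
  proof (rule Pr.noisy_iterate_nn_integral_step[OF indep that law[OF that] measurable_stopped_step measurable_cost])
    show "(\<integral>\<^sup>+z. cost (stopped_step K z) \<partial>noise) \<le> 1 * cost K + ennreal (eta * mu * eps / 100)" for K
    proof (cases "K \<in> sublevel b")
      case True
      then show ?thesis
        using expected_cost_step(1)[OF True] cost_K[OF True] c by (simp add: ennreal_plus)
    next
      case False
      then show ?thesis by (simp add: stopped_step_def emeasure_space_1)
    qed
  qed
  have "?E s \<le> ennreal (gap K0 + real s * (eta * mu * eps / 100))" if "s \<le> T" for s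
    using that
  proof (induction s)
    case 0
    then show ?case using K0 by (simp add: cost_def Pr.emeasure_space_1)
  next
    case (Suc s)
    have "?E (Suc s) \<le> ?E s + ennreal (eta * mu * eps / 100)" using E[of s] Suc.prems by simp
    also have "\<dots> \<le> ennreal (gap K0 + real s * (eta * mu * eps / 100)) + ennreal (eta * mu * eps / 100)"
      using Suc by (intro add_right_mono) auto
    also have "\<dots> = ennreal (gap K0 + real (Suc s) * (eta * mu * eps / 100))"
    proof (subst ennreal_plus[symmetric])
      show "0 \<le> gap K0 + real s * (eta * mu * eps / 100)" using g0 c(1) by (intro add_nonneg_nonneg mult_nonneg_nonneg) auto
    qed (use c in \<open>simp_all add: field_simps\<close>)
    finally show ?case .
  qed
  with s show "?E s \<le> ennreal (gap K0 + real s * (eta * mu * eps / 100))" by blast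
  \<comment> \<open>Restricting to \<open>sublevel b\<close> loses mass when the process exits, and
    a frozen outside state contributes 0, so the contraction holds at every state.\<close>
  have W: "?W (Suc s) \<le> ennreal (1 - eta * mu / 4) * ?W s + ennreal (eta * mu * eps / 80)" if "s < T" for s
  proof (rule Pr.noisy_iterate_nn_integral_step[OF indep that law[OF that] measurable_stopped_step,
        where W="\<lambda>K. cost K * indicator (sublevel b) K"])
    show "(\<lambda>K. cost K * indicator (sublevel b) K) \<in> borel_measurable borel" by measurable
    show "(\<integral>\<^sup>+z. cost (stopped_step K z) * indicator (sublevel b) (stopped_step K z) \<partial>noise)
        \<le> ennreal (1 - eta * mu / 4) * (cost K * indicator (sublevel b) K) + ennreal (eta * mu * eps / 80)" for K
    proof (cases "K \<in> sublevel b")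
      case True
      have "(\<integral>\<^sup>+z. cost (stopped_step K z) * indicator (sublevel b) (stopped_step K z) \<partial>noise)
          \<le> (\<integral>\<^sup>+z. cost (stopped_step K z) \<partial>noise)"
        by (intro nn_integral_mono) (auto simp: indicator_def)
      also note expected_cost_step(2)[OF True]
      also have "ennreal ((1 - eta * mu / 4) * gap K + eta * mu * eps / 80)
          = ennreal (1 - eta * mu / 4) * (cost K * indicator (sublevel b) K) + ennreal (eta * mu * eps / 80)"
        using True cost_K[OF True] q c by (simp add: ennreal_plus ennreal_mult)
      finally show ?thesis .
    next
      case False
      then show ?thesis by (simp add: stopped_step_def)
    qed
  qed
  have "?W s \<le> ennreal ((1 - eta * mu / 4) ^ s * gap K0 + eps / 20)" if "s \<le> T" for s
    using that
  proof (induction s)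
    case 0
    have "?W 0 \<le> ennreal (gap K0)"
      using K0 by (simp add: cost_def Pr.emeasure_space_1 indicator_def)
    also have "\<dots> \<le> ennreal ((1 - eta * mu / 4) ^ 0 * gap K0 + eps / 20)" using eps by (intro ennreal_leI) simp
    finally show ?case .
  next
    case (Suc s)
    let ?q = "1 - eta * mu / 4"
    have "?W (Suc s) \<le> ennreal ?q * ?W s + ennreal (eta * mu * eps / 80)" using W[of s] Suc.prems by simp
    also have "\<dots> \<le> ennreal ?q * ennreal (?q ^ s * gap K0 + eps / 20) + ennreal (eta * mu * eps / 80)"
      using Suc by (intro add_right_mono mult_left_mono) auto
    also have "\<dots> = ennreal (?q * (?q ^ s * gap K0 + eps / 20) + eta * mu * eps / 80)"
      using q c g0 eps by (simp add: ennreal_plus ennreal_mult)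
    \<comment> \<open>\<open>eps / 20\<close> is the fixed point of the affine map with slope
      \<open>1 - eta * mu / 4\<close> and offset \<open>eta * mu * eps / 80\<close>.\<close>
    also have "?q * (?q ^ s * gap K0 + eps / 20) + eta * mu * eps / 80 = ?q ^ Suc s * gap K0 + eps / 20"
      by (simp add: algebra_simps)
    finally show ?case .
  qed
  with s show "?W s \<le> ennreal ((1 - eta * mu / 4) ^ s * gap K0 + eps / 20)" by blast
qed

lemma stopped_process_in_sublevel:
  assumes "noisy_iterate stopped_step K0 z T \<in> sublevel b" "s \<le> T"
  shows "noisy_iterate stopped_step K0 z s \<in> sublevel b"
  using assms(2,1)
proof (induction s rule: inc_induct)
  case (step s)
  then show ?case by (cases "noisy_iterate stopped_step K0 z s \<in> sublevel b") auto
qed simp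

text \<open>The recursion for \<open>K\<close> is prescribed only while all costs queried so far are
  finite, so agreement at all earlier times is needed to justify one more step; hence the strong
  induction.\<close>

lemma iteration_eq_stopped:
  assumes T: "noisy_iterate stopped_step K0 (\<lambda>s. (X s, U s)) T \<in> sublevel b"
    and U: "\<And>s. s < T \<Longrightarrow> norm (U s) = 1"
    and K0: "K 0 = K0"
    and K: "\<And>s. s < T \<Longrightarrow> (\<And>t. t \<le> s \<Longrightarrow> queried_costs_finite mode Jx r (K t) (U t) (X t)) \<Longrightarrow>
      K (Suc s) = K s - eta *\<^sub>R estimate_trunc (K s) (X s, U s)"
    and "s \<le> T"
  shows "K s = noisy_iterate stopped_step K0 (\<lambda>s. (X s, U s)) s"
  using \<open>s \<le> T\<close>
proof (induction s rule: less_induct)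
  case (less s)
  let ?k = "noisy_iterate stopped_step K0 (\<lambda>s. (X s, U s))"
  show ?case
  proof (cases s)
    case 0
    then show ?thesis using K0 by simp
  next
    case (Suc n)
    have "queried_costs_finite mode Jx r (K t) (U t) (X t)" if "t \<le> n" for t
    proof -
      have "K t \<in> sublevel b"
        using less.IH[of t] that Suc less.prems stopped_process_in_sublevel[OF T, of t] by simp
      moreover have "norm (U t) = 1" using that Suc less.prems by (intro U) simp
      ultimately show ?thesis
        using sublevel_sphere[of "K t" "U t"] jx_eq(1)
        by (auto simp: queried_costs_finite_def split: estimator.split)
    qed
    then have "K (Suc n) = K n - eta *\<^sub>R estimate_trunc (K n) (X n, U n)"
      using Suc less.prems by (intro K) auto
    moreover have "K n = ?k n" using Suc less.prems by (intro less.IH) auto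
    moreover have "?k n \<in> sublevel b" using Suc less.prems by (intro stopped_process_in_sublevel[OF T]) simp
    ultimately show ?thesis using Suc by simp
  qed
qed

text \<open>Failure means an exit or ending inside with gap at least \<open>eps\<close>; Markov's
  inequality is applied at level \<open>b\<close> to the first and at level \<open>eps\<close> to
  the second, which is impossible when \<open>b < eps\<close>.\<close>

lemma success_probability:
  assumes "prob_space Pr" and K0: "K0 \<in> stabilizing A B" and b0: "0 < b"
    and law: "\<And>s. s < T \<Longrightarrow> distr Pr (borel \<Otimes>\<^sub>M borel) (\<lambda>\<omega>. (X s \<omega>, U s \<omega>)) = noise"
    and indep: "prob_space.indep_vars Pr (\<lambda>_. borel \<Otimes>\<^sub>M borel) (\<lambda>s \<omega>. (X s \<omega>, U s \<omega>)) {..<T}"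
    and meas: "K T \<in> borel_measurable Pr"
    and init: "\<And>\<omega>. \<omega> \<in> space Pr \<Longrightarrow> K 0 \<omega> = K0"
    and step: "\<And>\<omega> s. \<omega> \<in> space Pr \<Longrightarrow> s < T \<Longrightarrow>
      (\<And>t. t \<le> s \<Longrightarrow> queried_costs_finite mode Jx r (K t \<omega>) (U t \<omega>) (X t \<omega>)) \<Longrightarrow>
      K (Suc s) \<omega> = K s \<omega> - eta *\<^sub>R estimate_trunc (K s \<omega>) (X s \<omega>, U s \<omega>)"
    and p: "(gap K0 + real T * (eta * mu * eps / 100)) / b
      + (if b < eps then 0 else ((1 - eta * mu / 4) ^ T * gap K0 + eps / 20) / eps) \<le> p"
  shows "1 - p \<le> measure Pr {\<omega> \<in> space Pr. K T \<omega> \<in> stabilizing A B \<and> gap (K T \<omega>) < eps}"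
proof -
  interpret Pr: prob_space Pr by fact
  define k where "k \<omega> = noisy_iterate stopped_step K0 (\<lambda>i. (X i \<omega>, U i \<omega>)) T" for \<omega>
  have Z: "(\<lambda>\<omega>. (X s \<omega>, U s \<omega>)) \<in> Pr \<rightarrow>\<^sub>M borel \<Otimes>\<^sub>M borel" if "s < T" for s
    using indep that by (auto simp: Pr.indep_vars_def)
  have km [measurable]: "k \<in> borel_measurable Pr"
    unfolding k_def
    by (rule Pr.measurable_noisy_iterate_samples[where Z="\<lambda>s \<omega>. (X s \<omega>, U s \<omega>)", OF Z order.refl measurable_stopped_step])
  have [measurable]: "K T \<in> borel_measurable Pr" by (rule meas)
  let ?exit = "{\<omega> \<in> space Pr. k \<omega> \<notin> sublevel b}"
  let ?bad = "{\<omega> \<in> space Pr. k \<omega> \<in> sublevel b \<and> eps \<le> gap (k \<omega>)}"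
  let ?good = "{\<omega> \<in> space Pr. K T \<omega> \<in> stabilizing A B \<and> gap (K T \<omega>) < eps}"
  note bounds = stopped_process_bounds[where Z="\<lambda>s \<omega>. (X s \<omega>, U s \<omega>)", OF assms(1) K0 law indep order.refl]
  have g0: "0 \<le> gap K0" by (rule gap_nonneg[OF K0])
  have q: "0 \<le> 1 - eta * mu / 4" using eta by simp
  have c: "0 \<le> eta * mu * eps / 100" using eta mu eps by auto
  have exit: "Pr.prob ?exit \<le> (gap K0 + real T * (eta * mu * eps / 100)) / b"
  proof -
    have "ennreal b * emeasure Pr ?exit = (\<integral>\<^sup>+\<omega>. ennreal b * indicator ?exit \<omega> \<partial>Pr)"
      by (subst nn_integral_cmult_indicator) simp_all
    \<comment> \<open>Outside \<open>sublevel b\<close> either the gain is not stabilizing and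
      \<open>cost\<close> is infinite, or the gap exceeds \<open>b\<close>.\<close>
    also have "\<dots> \<le> (\<integral>\<^sup>+\<omega>. cost (k \<omega>) \<partial>Pr)"
      by (intro nn_integral_mono) (auto simp: indicator_def cost_def sublevel_def intro: ennreal_leI)
    also have "\<dots> \<le> ennreal (gap K0 + real T * (eta * mu * eps / 100))"
      using bounds(1) by (simp add: k_def)
    finally have "ennreal (b * Pr.prob ?exit) \<le> ennreal (gap K0 + real T * (eta * mu * eps / 100))"
      using b0 by (simp add: Pr.emeasure_eq_measure ennreal_mult)
    then have "b * Pr.prob ?exit \<le> gap K0 + real T * (eta * mu * eps / 100)"
      using g0 c by (subst (asm) ennreal_le_iff) simp_all
    then show ?thesis using b0 by (simp add: field_simps)
  qed
  have bad: "Pr.prob ?bad \<le> (if b < eps then 0 else ((1 - eta * mu / 4) ^ T * gap K0 + eps / 20) / eps)"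
  proof (cases "b < eps")
    case True
    then have e: "?bad = {}" by (auto simp: sublevel_def)
    show ?thesis unfolding e using True by simp
  next
    case False
    have "ennreal eps * emeasure Pr ?bad = (\<integral>\<^sup>+\<omega>. ennreal eps * indicator ?bad \<omega> \<partial>Pr)"
      by (subst nn_integral_cmult_indicator) simp_all
    also have "\<dots> \<le> (\<integral>\<^sup>+\<omega>. cost (k \<omega>) * indicator (sublevel b) (k \<omega>) \<partial>Pr)"
      by (intro nn_integral_mono) (auto simp: indicator_def cost_def sublevel_def intro: ennreal_leI)
    also have "\<dots> \<le> ennreal ((1 - eta * mu / 4) ^ T * gap K0 + eps / 20)"
      using bounds(2) by (simp add: k_def)
    finally have "ennreal (eps * Pr.prob ?bad) \<le> ennreal ((1 - eta * mu / 4) ^ T * gap K0 + eps / 20)"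
      using eps by (simp add: Pr.emeasure_eq_measure ennreal_mult)
    then have "eps * Pr.prob ?bad \<le> (1 - eta * mu / 4) ^ T * gap K0 + eps / 20"
      using g0 q eps by (subst (asm) ennreal_le_iff) simp_all
    then show ?thesis using False eps by (simp add: field_simps)
  qed
  \<comment> \<open>Only the laws of the samples are prescribed, so directions are unit almost
    surely; finitely many exceptional null sets are combined.\<close>
  have unit: "AE \<omega> in Pr. \<forall>s<T. norm (U s \<omega>) = 1"
  proof -
    have "AE \<omega> in Pr. norm (U s \<omega>) = 1" if "s < T" for s
    proof -
      have "AE z in distr Pr (borel \<Otimes>\<^sub>M borel) (\<lambda>\<omega>. (X s \<omega>, U s \<omega>)). norm (snd z) = 1"
        unfolding law[OF that] using AE_noise by eventually_elim simp
      from AE_distrD[OF Z[OF that] this] show ?thesis by simp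
    qed
    then have "AE \<omega> in Pr. \<forall>s\<in>{..<T}. norm (U s \<omega>) = 1"
      by (subst AE_finite_all) auto
    then show ?thesis by (rule eventually_mono) auto
  qed
  have "AE \<omega> in Pr. \<omega> \<in> space Pr - (?exit \<union> ?bad) \<longrightarrow> \<omega> \<in> ?good"
    using unit AE_space
  proof eventually_elim
    case (elim \<omega>)
    show ?case
    proof
      assume "\<omega> \<in> space Pr - (?exit \<union> ?bad)"
      then have k: "k \<omega> \<in> sublevel b" "gap (k \<omega>) < eps" by auto
      have "K T \<omega> = k \<omega>" unfolding k_def
        by (rule iteration_eq_stopped[where K="\<lambda>s. K s \<omega>" and T=T])
          (use k(1) elim init step in \<open>auto simp: k_def\<close>)
      with k elim show "\<omega> \<in> ?good" by (simp add: sublevel_def)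
    qed
  qed
  then have "Pr.prob (space Pr - (?exit \<union> ?bad)) \<le> Pr.prob ?good"
    by (intro Pr.finite_measure_mono_AE) auto
  moreover have "Pr.prob (space Pr - (?exit \<union> ?bad)) = 1 - Pr.prob (?exit \<union> ?bad)"
    by (rule Pr.prob_compl) measurable
  moreover have "Pr.prob (?exit \<union> ?bad) \<le> Pr.prob ?exit + Pr.prob ?bad"
    by (rule measure_Un_le) measurable
  ultimately show ?thesis using exit bad p by linarith
qed

end

section \<open>Choice of the constants\<close>

text \<open>Between 6/5 and 25 the concave logarithm lies above its chord, and at both ends it is at
  least \<open>u / 10\<close>: \<open>ln (6/5) \<ge> 1/6\<close>, and
  \<open>exp 5 \<le> 3 ^ 5 \<le> 25 ^ 2\<close>.\<close>

lemma ln_less_tenth: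
  fixes u :: real
  assumes u: "1 < u" and l: "ln u < u / 10"
  shows "u \<le> 6 / 5 \<or> 25 \<le> u"
proof (rule ccontr)
  assume "\<not> ?thesis"
  then have u: "6 / 5 < u" "u < 25" by auto
  have "ln (5 / 6 :: real) \<le> 5 / 6 - 1" by (intro ln_le_minus_one) simp
  moreover have "ln (6 / 5 :: real) = - ln (5 / 6)" by (simp add: ln_div)
  ultimately have x: "3 / 25 \<le> ln (6 / 5 :: real)" by simp
  have "exp (5::real) = exp 1 ^ 5" using exp_of_nat_mult[of 5 "1::real"] by simp
  also have "\<dots> \<le> 3 ^ 5" by (intro power_mono exp_le) simp
  also have "\<dots> \<le> 25 ^ 2" by simp
  finally have "ln (exp (5::real)) \<le> ln (25 ^ 2)" by (subst ln_le_cancel_iff) simp_all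
  then have y: "5 / 2 \<le> ln (25 :: real)" by (subst (asm) ln_realpow) simp_all
  define t where "t = (u - 6 / 5) / (25 - 6 / 5)"
  have t: "0 \<le> t" "t \<le> 1" using u by (simp_all add: t_def)
  have ut: "u = (1 - t) * (6 / 5) + t * 25" by (simp add: t_def field_simps)
  have "u / 10 = (1 - t) * (3 / 25) + t * (5 / 2)" by (simp add: ut)
  also have "\<dots> \<le> (1 - t) * ln (6 / 5) + t * ln 25" using x y t by (intro add_mono mult_left_mono) auto
  also have "\<dots> \<le> ln u" using concave_onD[OF ln_concave t, of "6 / 5" 25] by (simp add: ut)
  finally show False using l by simp
qed

text \<open>From \<open>ln gam \<le> gam - 1\<close>, the power \<open>gam ^ (2 * N)\<close> is at
  most \<open>exp (- 2 * N * (1 - gam))\<close>. The case \<open>a = 0\<close> is separate because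
  the logarithm then carries no information.\<close>

lemma geometric_truncation:
  fixes gam a k :: real
  assumes gam: "0 < gam" "gam < 1" and a: "0 \<le> a" and k: "0 < k"
    and N: "1 / (2 * (1 - gam)) * ln (k * a) \<le> real N"
  shows "gam ^ (2 * N) * a \<le> 1 / k"
proof (cases "a = 0")
  case False
  then have ka: "0 < k * a" using a k by simp
  have "ln gam \<le> gam - 1" using gam by (intro ln_le_minus_one)
  then have "real (2 * N) * ln gam \<le> real (2 * N) * (gam - 1)" by (intro mult_left_mono) auto
  also have "\<dots> \<le> - ln (k * a)" using N gam by (simp add: field_simps)
  finally have "exp (real (2 * N) * ln gam) \<le> exp (- ln (k * a))" by simp
  moreover have "exp (real (2 * N) * ln gam) = gam ^ (2 * N)" using gam by (subst exp_of_nat_mult) simp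
  moreover have "exp (- ln (k * a)) = 1 / (k * a)" using ka by (simp add: exp_minus field_simps)
  ultimately have "gam ^ (2 * N) * a \<le> 1 / (k * a) * a" using a by (intro mult_right_mono) auto
  then show ?thesis using False by simp
qed (use k in simp)

lemma one_minus_power_le_exp:
  fixes x :: real
  assumes "x \<le> 1"
  shows "(1 - x) ^ n \<le> exp (- (real n * x))"
proof -
  have "1 - x \<le> exp (- x)" using exp_ge_add_one_self[of "- x"] by simp
  then have "(1 - x) ^ n \<le> exp (- x) ^ n" using assms by (intro power_mono) auto
  then show ?thesis by (simp add: exp_of_nat_mult[symmetric])
qed

text \<open>Measured in units of \<open>sqrt \<Delta>\<close>, the condition of
  \<open>sublevel_step\<close> becomes the numerical inequality
  \<open>(s + c)\<^sup>2 \<le> 10\<close>.\<close>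

lemma exit_level:
  fixes s y \<Delta> :: real
  assumes "0 \<le> \<Delta>" "0 \<le> s" "0 \<le> y" "y \<le> c * sqrt \<Delta>" "(s + c)\<^sup>2 \<le> 10"
  shows "(sqrt (s\<^sup>2 * \<Delta>) + y)\<^sup>2 \<le> 10 * \<Delta>"
proof -
  have "sqrt (s\<^sup>2 * \<Delta>) + y \<le> (s + c) * sqrt \<Delta>"
    using assms by (simp add: real_sqrt_mult algebra_simps)
  then have "(sqrt (s\<^sup>2 * \<Delta>) + y)\<^sup>2 \<le> ((s + c) * sqrt \<Delta>)\<^sup>2"
    using assms by (intro power_mono) auto
  also have "\<dots> = (s + c)\<^sup>2 * \<Delta>" using assms by (simp add: power_mult_distrib)
  also have "\<dots> \<le> 10 * \<Delta>" using assms by (intro mult_right_mono) auto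
  finally show ?thesis .
qed

lemma parameter_bounds:
  fixes mu phi eps r delta eta g :: real
  assumes mu: "0 < mu" "mu \<le> 2 * phi" and phi: "0 < phi" and eps: "0 < eps"
    and r: "0 < r" "r \<le> 1 / (4 * phi) * sqrt (mu * eps / 15)"
    and delta: "0 \<le> delta" "delta \<le> 1 / 2 * sqrt (mu * eps / 30)"
    and eta: "0 < eta" "eta \<le> 1 / (4 * phi)" and g: "phi * eta * g \<le> mu * eps / 480"
  shows "(phi * r + delta / 2)\<^sup>2 \<le> mu * eps / 80"
    and "phi * eta / 2 * (3 / 2 * g + 3 / 4 * delta\<^sup>2) \<le> 9 / 3840 * (mu * eps)"
    and "r * sqrt (phi / 2) \<le> sqrt (eps / 240)"
    and "phi * eta \<le> 1 / 4" and "eta * mu \<le> 1"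
proof -
  have "phi * r \<le> 1 / 4 * sqrt (mu * eps / 15)"
    using mult_left_mono[OF r(2), of phi] phi by simp
  then have "(phi * r)\<^sup>2 \<le> (1 / 4 * sqrt (mu * eps / 15))\<^sup>2" using phi r by (intro power_mono) auto
  also have "\<dots> = mu * eps / 240"
    using mu eps by (simp only: power_mult_distrib) (simp add: power2_eq_square)
  finally have pr: "(phi * r)\<^sup>2 \<le> mu * eps / 240" .
  have "delta\<^sup>2 \<le> (1 / 2 * sqrt (mu * eps / 30))\<^sup>2" using delta by (intro power_mono) auto
  also have "\<dots> = mu * eps / 120"
    using mu eps by (simp only: power_mult_distrib) (simp add: power2_eq_square)
  finally have d2: "delta\<^sup>2 \<le> mu * eps / 120" .
  have "(phi * r + delta / 2)\<^sup>2 \<le> 2 * (phi * r)\<^sup>2 + delta\<^sup>2 / 2"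
    using zero_le_power2[of "phi * r - delta / 2"] by (simp add: power2_sum power2_diff power_divide)
  \<comment> \<open>The two parts are \<open>2/240\<close> and \<open>1/240\<close>.\<close>
  with pr d2 show "(phi * r + delta / 2)\<^sup>2 \<le> mu * eps / 80" by linarith
  show pe: "phi * eta \<le> 1 / 4" using eta(2) phi by (simp add: field_simps)
  have "phi * eta * delta\<^sup>2 \<le> 1 / 4 * (mu * eps / 120)"
    using pe d2 phi eta by (intro mult_mono) auto
  moreover have "phi * eta / 2 * (3 / 2 * g + 3 / 4 * delta\<^sup>2)
      = 3 / 4 * (phi * eta * g) + 3 / 8 * (phi * eta * delta\<^sup>2)"
    by (simp add: algebra_simps)
  \<comment> \<open>Here \<open>3/4 * 1/480\<close> is \<open>6/3840\<close>, and
    \<open>3/8 * 1/4 * 1/120\<close> is \<open>3/3840\<close>.\<close>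
  ultimately show "phi * eta / 2 * (3 / 2 * g + 3 / 4 * delta\<^sup>2) \<le> 9 / 3840 * (mu * eps)"
    using g by linarith
  have "(r * sqrt (phi / 2))\<^sup>2 = (phi * r)\<^sup>2 / (2 * phi)"
    using phi by (simp only: power_mult_distrib real_sqrt_pow2 divide_nonneg_pos zero_less_numeral less_imp_le)
      (simp add: power2_eq_square)
  also have "\<dots> \<le> (mu * eps / 240) / (2 * phi)" using pr phi by (intro divide_right_mono) auto
  also have "\<dots> \<le> eps / 240" using mu(2) eps phi by (simp add: field_simps)
  finally show "r * sqrt (phi / 2) \<le> sqrt (eps / 240)" by (rule real_le_rsqrt)
  have "eta * mu \<le> eta * (2 * phi)" using mu eta by (intro mult_left_mono) auto
  with pe show "eta * mu \<le> 1" by (simp add: mult.commute)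
qed

lemma AE_estimate_sup:
  assumes "estimate_sup G Dist S \<le> ereal c" "K \<in> S"
  shows "AE z in Dist \<Otimes>\<^sub>M sphere_uniform. norm (G K (snd z) (fst z)) \<le> c"
proof -
  let ?f = "\<lambda>(x0, D). ereal (norm (G K D x0))"
  have "esssup (Dist \<Otimes>\<^sub>M sphere_uniform) ?f \<le> ereal c"
    using assms unfolding estimate_sup_def by (auto simp: SUP_le_iff)
  moreover have "AE z in Dist \<Otimes>\<^sub>M sphere_uniform. ?f z \<le> esssup (Dist \<Otimes>\<^sub>M sphere_uniform) ?f"
    by (rule esssup_AE)
  ultimately show ?thesis by (auto simp: case_prod_beta elim!: eventually_mono dest: order_trans)
qed

lemma nn_integral_estimate_variance:
  assumes "estimate_variance G Dist S \<le> c" "K \<in> S"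
  shows "(\<integral>\<^sup>+z. ennreal ((norm (G K (snd z) (fst z)
      - (\<integral>z. G K (snd z) (fst z) \<partial>(Dist \<Otimes>\<^sub>M sphere_uniform))))\<^sup>2) \<partial>(Dist \<Otimes>\<^sub>M sphere_uniform)) \<le> c"
  using assms unfolding estimate_variance_def case_prod_unfold by (auto simp: SUP_le_iff)

theorem corollary1:
  fixes A :: "real^'n^'n" and B :: "real^'m^'n"
    and Q :: "real^'n^'n" and R :: "real^'m^'m"
    and Dist :: "(real^'n) measure" and Cm :: real
    and Jx :: "real^'n^'m \<Rightarrow> real^'n \<Rightarrow> ereal" and J :: "real^'n^'m \<Rightarrow> ereal"
    and Jr :: "real^'n^'m \<Rightarrow> real"
    and Kst G0 :: "(real^'n^'m) set" and Kstar K0 :: "real^'n^'m"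
    and lamK lamtK zetaK phiK betaK :: "real^'n^'m \<Rightarrow> real"
    and Delta0 lam0 phi0 rho0 theta0 mu d eps delta eta r beta gam M :: real
    and mode :: estimator and Ts Td :: nat
    and Pr :: "'w measure"
    and X :: "nat \<Rightarrow> 'w \<Rightarrow> real^'n" and U :: "nat \<Rightarrow> 'w \<Rightarrow> real^'n^'m"
    and K :: "nat \<Rightarrow> 'w \<Rightarrow> real^'n^'m"
  assumes \<comment> \<open>the LQR problem\<close>
        "stabilizable A B" and "symmetric_psd Q" and "symmetric_pd R"
    and "detectable A (psd_sqrt Q)"
    and "prob_space Dist" and "sets Dist = sets borel"
    and "(\<integral>v. v \<partial>Dist) = 0" and "(\<integral>v. (\<chi> i j. v $ i * v $ j) \<partial>Dist) = (mat 1 :: real^'n^'n)"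
    and "0 < Cm" and "AE v in Dist. (norm v)\<^sup>2 \<le> Cm"
    and "Kst = stabilizing A B"
    and "Jx = lqr_cost_from A B Q R" and "J = lqr_cost A B Q R Dist"
    and "Jr = (\<lambda>K'. real_of_ereal (J K'))"
    and "Kstar \<in> Kst" and "\<And>K'. K' \<in> Kst \<Longrightarrow> K' \<noteq> Kstar \<Longrightarrow> J Kstar < J K'"
    and "K0 \<in> Kst"
    \<comment> \<open>local Lipschitz, smoothness and gradient domination constants\<close>
    and "\<And>K1. K1 \<in> Kst \<Longrightarrow>
           0 < lamK K1 \<and> 0 < lamtK K1 \<and> 0 < zetaK K1 \<and> 0 < phiK K1 \<and> 0 < betaK K1"
    and "\<And>K1 K2. K1 \<in> Kst \<Longrightarrow> norm (K2 - K1) \<le> zetaK K1 \<Longrightarrow>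
           \<bar>J K2 - J K1\<bar> \<le> ereal (lamK K1 * norm (K2 - K1))"
    and "\<And>K1 K2. K1 \<in> Kst \<Longrightarrow> norm (K2 - K1) \<le> zetaK K1 \<Longrightarrow>
           (AE x0 in Dist. \<bar>Jx K2 x0 - Jx K1 x0\<bar> \<le> ereal (lamtK K1 * norm (K2 - K1)))"
    and "\<And>K1 K2. K1 \<in> Kst \<Longrightarrow> norm (K2 - K1) \<le> betaK K1 \<Longrightarrow>
           K2 \<in> Kst \<and> norm (gradient Jr K2 - gradient Jr K1) \<le> phiK K1 * norm (K2 - K1)"
    and "0 < mu"
    and "\<And>K1. K1 \<in> Kst \<Longrightarrow> mu * (Jr K1 - Jr Kstar) \<le> (norm (gradient Jr K1))\<^sup>2"
    and "Delta0 = Jr K0 - Jr Kstar"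
    and "G0 = {K'. J K' - J Kstar \<le> ereal (10 * Delta0)}"
    and "bdd_above (phiK ` G0)" and "phi0 = (SUP K'\<in>G0. phiK K')"
    and "bdd_above (lamK ` G0)" and "lam0 = (SUP K'\<in>G0. lamK K')"
    and "rho0 = (INF K'\<in>G0. min (betaK K') (zetaK K'))" and "0 < rho0"
    and "theta0 = min (1 / (2 * phi0)) (rho0 / lam0)"
    and "d = real (CARD('m) * CARD('n))"
    \<comment> \<open>known bounds on the gradient estimates formed with the infinite-horizon cost\<close>
    and "mode = OnePoint \<Longrightarrow> r \<le> min (10 * Jr K0 / lam0) rho0 \<Longrightarrow>
           estimate_variance (grad_estimate mode (\<lambda>K' x0. real_of_ereal (Jx K' x0)) r) Dist G0
             \<le> ennreal ((20 * Cm * Jr K0 * d / r)\<^sup>2)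
         \<and> estimate_sup (grad_estimate mode (\<lambda>K' x0. real_of_ereal (Jx K' x0)) r) Dist G0
             \<le> ereal (20 * Cm * Jr K0 * d / r)"
    and "mode = TwoPoint \<Longrightarrow> r \<le> rho0 \<Longrightarrow>
           estimate_variance (grad_estimate mode (\<lambda>K' x0. real_of_ereal (Jx K' x0)) r) Dist G0
             \<le> ennreal (d * lam0\<^sup>2)
         \<and> estimate_sup (grad_estimate mode (\<lambda>K' x0. real_of_ereal (Jx K' x0)) r) Dist G0
             \<le> ereal (d * lam0)"
    \<comment> \<open>accuracy, stepsize, smoothing radius, number of iterations\<close>
    and "0 < eps" and "eps * ln (120 * Delta0 / eps) < 12 * Delta0"
    and "delta = min (mu * theta0 / 16 * sqrt (eps / 15)) (1 / 2 * sqrt (mu * eps / 30))"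
    and "0 < eta" and "0 < r"
    and "mode = OnePoint \<Longrightarrow>
           eta \<le> Min {mu * r\<^sup>2 * eps / (480 * phi0 * (20 * Cm * Jr K0 * d)\<^sup>2),
                      1 / (4 * phi0),
                      rho0 * r / (20 * Cm * Jr K0 * d + delta * r)}
         \<and> r \<le> Min {mu * theta0 / (16 * phi0) * sqrt (eps / 15),
                    1 / (4 * phi0) * sqrt (mu * eps / 15),
                    rho0,
                    10 * Jr K0 / lam0}"
    and "mode = TwoPoint \<Longrightarrow>
           eta \<le> Min {mu * eps / (480 * phi0 * d * lam0\<^sup>2),
                      1 / (4 * phi0),
                      rho0 / (d * lam0 + delta)}
         \<and> r \<le> Min {mu * theta0 / (16 * phi0) * sqrt (eps / 15),
                    1 / (4 * phi0) * sqrt (mu * eps / 15),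
                    rho0}"
    and "1 \<le> Ts" and "real Ts = 4 / (eta * mu) * ln (120 * Delta0 / eps)"
    \<comment> \<open>the samples: i.i.d. pairs of an initial state and an independent uniform direction\<close>
    and "prob_space Pr"
    and "\<And>s. s < Ts \<Longrightarrow>
           distr Pr (borel \<Otimes>\<^sub>M borel) (\<lambda>\<omega>. (X s \<omega>, U s \<omega>)) = Dist \<Otimes>\<^sub>M sphere_uniform"
    and "prob_space.indep_vars Pr (\<lambda>_. borel \<Otimes>\<^sub>M borel) (\<lambda>s \<omega>. (X s \<omega>, U s \<omega>)) {..<Ts}"
    \<comment> \<open>the truncated iteration; arbitrary measurable iterates after an infinite cost value\<close>
    and "\<And>s. s \<le> Ts \<Longrightarrow> K s \<in> borel_measurable Pr"
    and "\<And>\<omega>. \<omega> \<in> space Pr \<Longrightarrow> K 0 \<omega> = K0"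
    and "\<And>\<omega> s. \<omega> \<in> space Pr \<Longrightarrow> s < Ts \<Longrightarrow>
           (\<And>t. t \<le> s \<Longrightarrow> queried_costs_finite mode Jx r (K t \<omega>) (U t \<omega>) (X t \<omega>)) \<Longrightarrow>
           K (Suc s) \<omega> =
             K s \<omega>
             - eta *\<^sub>R grad_estimate mode (\<lambda>K' x0. real_of_ereal (Jx K' x0)) r
                         (K s \<omega>) (U s \<omega>) (X s \<omega>)
             + eta *\<^sub>R (grad_estimate mode (\<lambda>K' x0. real_of_ereal (Jx K' x0)) r
                          (K s \<omega>) (U s \<omega>) (X s \<omega>)
                        - grad_estimate mode (lqr_cost_horizon A B Q R Td) r
                          (K s \<omega>) (U s \<omega>) (X s \<omega>))"
    \<comment> \<open>the rollout length\<close>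
    and "beta = (SUP K'\<in>G0. onorm ((*v) (Q + transpose K' ** R ** K')))"
    and "0 < gam" and "gam < 1" and "0 < M"
    and "\<And>K' x0 t. K' \<in> G0 \<Longrightarrow>
           (norm (lqr_state A B K' x0 t))\<^sup>2 \<le> M * gam ^ (2 * t) * (norm x0)\<^sup>2"
    and "1 \<le> Td"
    and "AE \<omega> in Pr. \<forall>s<Ts.
           real Td \<ge> 1 / (2 * (1 - gam)) *
             max (ln (16 * sqrt 15 * M * beta * d * (norm (X s \<omega>))\<^sup>2
                      / ((1 - gam\<^sup>2) * r * mu * theta0 * sqrt eps)))
                 (ln (2 * sqrt 30 * M * beta * d * (norm (X s \<omega>))\<^sup>2
                      / ((1 - gam\<^sup>2) * r * sqrt (mu * eps))))"
  shows "measure Pr {\<omega> \<in> space Pr. J (K Ts \<omega>) - J Kstar < ereal eps} \<ge> 3 / 4"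
proof -
  note Kst_def = assms(11) and Jx_def = assms(12) and J_def = assms(13) and Jr_def = assms(14)
  note Kstar = assms(15,16) and K0 = assms(17)
  note scalars_pos = assms(18) and smooth = assms(21) and mu = assms(22,23)
  note Delta0 = assms(24) and G0_def = assms(25)
  note phi0_def = assms(26,27) and lam0_def = assms(28,29) and rho0_def = assms(30) and rho0 = assms(31)
  note theta0_def = assms(32) and d_def = assms(33) and known1 = assms(34) and known2 = assms(35)
  note eps = assms(36,37) and delta_def = assms(38) and eta0 = assms(39) and r0 = assms(40)
  note one = assms(41) and two = assms(42) and Ts = assms(43,44)
  note Pr = assms(45) and law = assms(46) and indep = assms(47)
  note meas = assms(48) and init = assms(49) and step = assms(50)
  note beta_def = assms(51) and gam = assms(52,53) and M = assms(54) and decay = assms(55)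
  note Td = assms(57)
  \<comment> \<open>The smoothness hypothesis asserts that gains within \<open>betaK K1\<close> of a
    stabilizing gain \<open>K1\<close> are stabilizing.\<close>
  have "open Kst"
    unfolding open_contains_ball
  proof
    fix K1 assume K1: "K1 \<in> Kst"
    then have "ball K1 (betaK K1) \<subseteq> Kst"
      using smooth[OF K1] by (auto simp: dist_norm norm_minus_commute)
    then show "\<exists>e>0. ball K1 e \<subseteq> Kst" using scalars_pos[OF K1] by blast
  qed
  then have op: "open (stabilizing A B)" by (simp only: Kst_def)

  \<comment> \<open>Translation of the hypotheses into the locales\<close>
  interpret L: lqr A B Q R Dist Cm by (rule lqr.intro[OF assms(2,3,5,6,8,10) op])
  have Jr: "Jr = L.Jr" by (simp add: fun_eq_iff Jr_def J_def L.Jr_def)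
  have JK: "J K1 = ereal (Jr K1)" if "K1 \<in> Kst" for K1
    using that L.J_stabilizing by (simp add: J_def Jr Kst_def)
  have JK': "J K1 = \<infinity>" if "K1 \<notin> Kst" for K1
    using that L.J_not_stabilizing by (simp add: J_def Kst_def)
  have G0: "K1 \<in> G0 \<longleftrightarrow> K1 \<in> Kst \<and> Jr K1 - Jr Kstar \<le> 10 * Delta0" for K1
    using JK[of K1] JK'[of K1] JK[OF Kstar(1)] by (cases "K1 \<in> Kst") (auto simp: G0_def)
  have min: "Jr Kstar \<le> Jr K1" if "K1 \<in> Kst" for K1
    using Kstar(2)[OF that] JK[OF that] JK[OF Kstar(1)] by (cases "K1 = Kstar") auto
  have Delta0_pos: "0 < Delta0"
  proof -
    have "0 \<le> Delta0" using min[OF K0] Delta0 by simp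
    \<comment> \<open>With \<open>Delta0 = 0\<close> the logarithmic condition on \<open>eps\<close>
      would read \<open>0 < 0\<close>, since \<open>ln 0 = 0\<close>.\<close>
    moreover have "Delta0 \<noteq> 0" using eps by auto
    ultimately show ?thesis by simp
  qed
  have K0G: "K0 \<in> G0" using K0 Delta0 Delta0_pos by (simp add: G0)
  have phiK: "phiK K1 \<le> phi0" and lamK: "lamK K1 \<le> lam0" if "K1 \<in> G0" for K1
    using that phi0_def lam0_def by (auto intro: cSUP_upper)
  have phi0: "0 < phi0" and lam0: "0 < lam0"
    using phiK[OF K0G] lamK[OF K0G] scalars_pos[OF K0] by linarith+
  have betaK: "rho0 \<le> betaK K1" if "K1 \<in> G0" for K1
  proof -
    have "bdd_below ((\<lambda>K'. min (betaK K') (zetaK K')) ` G0)"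
      by (rule bdd_belowI2[of _ 0]) (use scalars_pos G0 in \<open>auto intro: less_imp_le\<close>)
    then have "rho0 \<le> min (betaK K1) (zetaK K1)" unfolding rho0_def using that by (rule cINF_lower)
    then show ?thesis by simp
  qed
  interpret S: lqr_sublevel A B Q R Dist Cm Kstar "10 * Delta0" phi0 rho0 gam M
  proof
    show "Kstar \<in> stabilizing A B" using Kstar(1) Kst_def by simp
    show "L.Jr Kstar \<le> L.Jr K1" if "K1 \<in> stabilizing A B" for K1
      using min that by (simp add: Jr Kst_def)
    show "K2 \<in> stabilizing A B \<and> norm (gradient L.Jr K2 - gradient L.Jr K1) \<le> phi0 * norm (K2 - K1)"
      if "K1 \<in> stabilizing A B" "L.Jr K1 - L.Jr Kstar \<le> 10 * Delta0" "norm (K2 - K1) \<le> rho0" for K1 K2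
    proof -
      have K1: "K1 \<in> G0" using that by (simp add: G0 Jr Kst_def)
      have "norm (K2 - K1) \<le> betaK K1" using betaK[OF K1] that by simp
      then have "K2 \<in> Kst" "norm (gradient Jr K2 - gradient Jr K1) \<le> phiK K1 * norm (K2 - K1)"
        using smooth[of K1 K2] K1 G0 by auto
      moreover have "phiK K1 * norm (K2 - K1) \<le> phi0 * norm (K2 - K1)"
        by (intro mult_right_mono phiK K1) simp
      ultimately show ?thesis by (simp add: Jr Kst_def)
    qed
    show "(norm (lqr_state A B K1 x t))\<^sup>2 \<le> M * gam ^ (2 * t) * (norm x)\<^sup>2"
      if "K1 \<in> stabilizing A B" "L.Jr K1 - L.Jr Kstar \<le> 10 * Delta0" for K1 x t
      using that by (intro decay) (simp add: G0 Jr Kst_def)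
  qed (use phi0 rho0 gam M in auto)
  have G0S: "G0 = S.sublevel (10 * Delta0)"
    by (auto simp: G0 S.sublevel_def S.gap_def Jr Kst_def)
  have betaS: "beta = S.beta" by (simp add: beta_def S.beta_def G0S)
  have gapK0: "S.gap K0 = Delta0" by (simp add: S.gap_def Delta0 Jr)
  \<comment> \<open>At \<open>K0\<close>, gradient domination from below meets
    \<open>gradient_le\<close> from above, and the gap there is positive.\<close>
  have mu2: "mu \<le> 2 * phi0"
  proof -
    have "mu * Delta0 \<le> 2 * phi0 * Delta0"
      using mu(2)[OF K0] S.gradient_le[of K0] K0G by (simp add: G0S gapK0 Delta0 Jr)
    then show ?thesis using Delta0_pos by simp
  qed
  define u where "u = 120 * Delta0 / eps"
  have u: "1 < u" "ln u < u / 10"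
  proof -
    have u0: "0 < u" using Delta0_pos eps by (simp add: u_def)
    \<comment> \<open>The iteration number is a positive integer, which forces the logarithm to be
      positive.\<close>
    have "0 < 4 / (eta * mu) * ln u" using Ts by (simp add: u_def)
    moreover have "0 < 4 / (eta * mu)" using eta0 mu(1) by simp
    ultimately have "0 < ln u" by (rule zero_less_mult_pos)
    then show "1 < u" using u0 by simp
    show "ln u < u / 10" using eps by (simp add: u_def field_simps)
  qed
  have eps_u: "eps = 120 * Delta0 / u" using eps Delta0_pos by (simp add: u_def)
  have d: "0 < d" by (simp add: d_def)
  have theta0: "0 < theta0" using phi0 lam0 rho0 by (simp add: theta0_def)
  have delta: "0 \<le> delta" "delta \<le> mu * theta0 / 16 * sqrt (eps / 15)" "delta \<le> 1 / 2 * sqrt (mu * eps / 30)"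
    using theta0 mu(1) eps(1) by (auto simp: delta_def)
  have r: "r \<le> 1 / (4 * phi0) * sqrt (mu * eps / 15)" "r \<le> rho0" and eta: "eta \<le> 1 / (4 * phi0)"
    using one two by (cases mode; simp)+

  \<comment> \<open>Bounds on the estimates in the two settings\<close>
  let ?G = "grad_estimate mode L.jx r"
  obtain ginf g2 where known: "estimate_sup ?G Dist G0 \<le> ereal ginf" "estimate_variance ?G Dist G0 \<le> ennreal g2"
    and g2: "0 \<le> g2" and step_length: "eta * (ginf + delta) \<le> rho0" and noise: "phi0 * eta * g2 \<le> mu * eps / 480"
  proof -
    have jx: "(\<lambda>K' x0. real_of_ereal (Jx K' x0)) = L.jx"
      by (simp add: fun_eq_iff L.jx_def Jx_def)
    show ?thesis
    proof (cases mode)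
      case OnePoint
      define N where "N = 20 * Cm * Jr K0 * d"
      have o: "eta \<le> mu * r\<^sup>2 * eps / (480 * phi0 * N\<^sup>2)" "eta \<le> rho0 * r / (N + delta * r)" "r \<le> 10 * Jr K0 / lam0"
        using one[OF OnePoint] by (auto simp: N_def)
      \<comment> \<open>\<open>eta\<close> is positive and lies below these quotients. As division
        by 0 gives 0, positivity yields \<open>N \<noteq> 0\<close> and a positive denominator in
        the second one.\<close>
      have pos: "0 < mu * r\<^sup>2 * eps / (480 * phi0 * N\<^sup>2)" "0 < rho0 * r / (N + delta * r)" using o eta0 by linarith+
      have "N \<noteq> 0" using pos(1) by auto
      moreover have "0 < rho0 * r" using rho0 r0 by simp
      then have "0 < N + delta * r" using pos(2) by (simp add: zero_less_divide_iff)
      ultimately have N: "N \<noteq> 0" "0 < N + delta * r" by blast+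
      show ?thesis
      proof (rule that[of "N / r" "(N / r)\<^sup>2"])
        show "estimate_sup ?G Dist G0 \<le> ereal (N / r)" "estimate_variance ?G Dist G0 \<le> ennreal ((N / r)\<^sup>2)"
          using known1[OF OnePoint] o(3) r(2) by (simp_all add: jx N_def)
        show "eta * (N / r + delta) \<le> rho0"
        proof -
          have "eta * (N + delta * r) \<le> rho0 * r" using o(2) N(2) by (simp only: pos_le_divide_eq)
          then have "eta * (N + delta * r) / r \<le> rho0" using r0 by (simp only: pos_divide_le_eq)
          moreover have "eta * (N / r + delta) = eta * (N + delta * r) / r" using r0 by (simp add: field_simps)
          ultimately show ?thesis by simp
        qed
        have "eta * (480 * phi0 * N\<^sup>2) \<le> mu * r\<^sup>2 * eps"
          using o(1) N(1) phi0 by (simp add: pos_le_divide_eq)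
        then show "phi0 * eta * (N / r)\<^sup>2 \<le> mu * eps / 480"
          using r0 by (simp add: power_divide field_simps)
      qed simp
    next
      case TwoPoint
      have o: "eta \<le> mu * eps / (480 * phi0 * d * lam0\<^sup>2)" "eta \<le> rho0 / (d * lam0 + delta)"
        using two[OF TwoPoint] by auto
      have pos: "0 < d * lam0 + delta" using d lam0 delta(1) by (simp add: add_pos_nonneg)
      show ?thesis
      proof (rule that[of "d * lam0" "d * lam0\<^sup>2"])
        show "estimate_sup ?G Dist G0 \<le> ereal (d * lam0)" "estimate_variance ?G Dist G0 \<le> ennreal (d * lam0\<^sup>2)"
          using known2[OF TwoPoint r(2)] by (simp_all add: jx)
        show "eta * (d * lam0 + delta) \<le> rho0" using o(2) pos by (simp add: pos_le_divide_eq)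
        have "0 < 480 * phi0 * d * lam0\<^sup>2" using phi0 d lam0 by simp
        then show "phi0 * eta * (d * lam0\<^sup>2) \<le> mu * eps / 480"
          using o(1) by (simp add: pos_le_divide_eq mult_ac)
      qed (use d in simp)
    qed
  qed
  note params = parameter_bounds[OF mu(1) mu2 phi0 eps(1) r0 r(1) delta(1,3) eta0 eta noise]
  \<comment> \<open>The exit probability \<open>148/100 / s\<^sup>2\<close> asks for a large
    \<open>s\<close>; a query raises the square root of the gap by at most
    \<open>sqrt (Delta0 / (2 * u))\<close>, so \<open>c\<^sup>2 \<ge> 1 / (2 * u)\<close> is
    required, and both must fit into \<open>(s + c)\<^sup>2 \<le> 10\<close>. The sums 3.15 and 3.16
    have squares 9.9225 and 9.9856.\<close>
  define s c :: real where "s = (if 25 \<le> u then 3 else 49 / 20)" and "c = (if 25 \<le> u then 3 / 20 else 71 / 100)"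
  define b where "b = s\<^sup>2 * Delta0"
  have b: "0 < b" "(sqrt b + r * sqrt (phi0 / 2))\<^sup>2 \<le> 10 * Delta0"
  proof -
    show "0 < b" using Delta0_pos by (simp add: b_def s_def)
    have "1 / (2 * u) \<le> c\<^sup>2" using u(1) by (auto simp: c_def power2_eq_square field_simps)
    then have "1 / (2 * u) * Delta0 \<le> c\<^sup>2 * Delta0" using Delta0_pos by (intro mult_right_mono) auto
    then have "sqrt (eps / 240) \<le> sqrt (c\<^sup>2 * Delta0)" by (simp add: eps_u)
    also have "\<dots> = c * sqrt Delta0" by (simp add: real_sqrt_mult c_def)
    finally have "r * sqrt (phi0 / 2) \<le> c * sqrt Delta0" using params(3) by linarith
    moreover have "(s + c)\<^sup>2 \<le> 10" "0 \<le> s" by (simp_all add: s_def c_def power2_eq_square)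
    ultimately show "(sqrt b + r * sqrt (phi0 / 2))\<^sup>2 \<le> 10 * Delta0"
      unfolding b_def using Delta0_pos r0 phi0 by (intro exit_level[where c=c]) auto
  qed
  have tail: "AE x in Dist. S.beta * M * gam ^ (2 * Td) / (1 - gam\<^sup>2) * (norm x)\<^sup>2 \<le> delta * r / d"
  proof -
    interpret P: prob_space Pr by (rule Pr)
    interpret D: prob_space Dist by (rule L.prob_Dist)
    interpret U: prob_space "sphere_uniform :: (real^'n^'m) measure" by (rule prob_space_sphere_uniform)
    interpret DU: pair_prob_space Dist "sphere_uniform :: (real^'n^'m) measure" ..
    have T0: "0 < Ts" using Ts(1) by simp
    have Z: "(\<lambda>\<omega>. (X 0 \<omega>, U 0 \<omega>)) \<in> Pr \<rightarrow>\<^sub>M borel \<Otimes>\<^sub>M borel"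
      using indep T0 by (auto simp: P.indep_vars_def)
    let ?P = "\<lambda>x :: real^'n. S.beta * M * gam ^ (2 * Td) / (1 - gam\<^sup>2) * (norm x)\<^sup>2 \<le> delta * r / d"
    have g2: "0 < 1 - gam\<^sup>2" using S.gam2 by simp
    have beta0: "0 \<le> beta" using S.stage_le(2)[of K0] K0G by (simp add: G0S betaS)
    \<comment> \<open>The rollout condition is about sampled states; sample 0 exists because
      \<open>Ts \<ge> 1\<close>, and its law carries the bound over to \<open>Dist\<close>.\<close>
    have "AE \<omega> in Pr. ?P (X 0 \<omega>)"
      using Td
    proof eventually_elim
      case (elim \<omega>)
      define a where "a = M * beta * d * (norm (X 0 \<omega>))\<^sup>2 / ((1 - gam\<^sup>2) * r)"
      have a: "0 \<le> a" using M beta0 d g2 r0 by (simp add: a_def)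
      let ?k1 = "16 * sqrt 15 / (mu * theta0 * sqrt eps)" and ?k2 = "2 * sqrt 30 / sqrt (mu * eps)"
      have k: "0 < ?k1" "0 < ?k2" using mu(1) theta0 eps(1) by simp_all
      have e: "16 * sqrt 15 * M * beta * d * (norm (X 0 \<omega>))\<^sup>2 / ((1 - gam\<^sup>2) * r * mu * theta0 * sqrt eps) = ?k1 * a"
        "2 * sqrt 30 * M * beta * d * (norm (X 0 \<omega>))\<^sup>2 / ((1 - gam\<^sup>2) * r * sqrt (mu * eps)) = ?k2 * a"
        by (simp_all add: a_def mult_ac)
      have "1 / (2 * (1 - gam)) * max (ln (?k1 * a)) (ln (?k2 * a)) \<le> real Td"
        using elim[rule_format, OF T0] unfolding e .
      moreover have "0 \<le> 1 / (2 * (1 - gam))" using gam by simp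
      ultimately have "1 / (2 * (1 - gam)) * ln (?k1 * a) \<le> real Td" "1 / (2 * (1 - gam)) * ln (?k2 * a) \<le> real Td"
        by (blast intro: order_trans[OF mult_left_mono[OF max.cobounded1]]
            order_trans[OF mult_left_mono[OF max.cobounded2]])+
      then have "gam ^ (2 * Td) * a \<le> 1 / ?k1" "gam ^ (2 * Td) * a \<le> 1 / ?k2"
        by - (rule geometric_truncation[OF gam a k(1)] geometric_truncation[OF gam a k(2)], assumption)+
      then have "gam ^ (2 * Td) * a \<le> delta"
        by (simp add: delta_def real_sqrt_divide)
      then have "gam ^ (2 * Td) * a * (r / d) \<le> delta * (r / d)" using r0 d by (intro mult_right_mono) auto
      moreover have "gam ^ (2 * Td) * a * (r / d) = beta * M * gam ^ (2 * Td) / (1 - gam\<^sup>2) * (norm (X 0 \<omega>))\<^sup>2"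
        using r0 d by (simp add: a_def)
      ultimately show ?case by (simp add: betaS)
    qed
    then have "AE z in distr Pr (borel \<Otimes>\<^sub>M borel) (\<lambda>\<omega>. (X 0 \<omega>, U 0 \<omega>)). ?P (fst z)"
      by (subst AE_distr_iff[OF Z]) simp_all
    then have "AE x in Dist. AE D in (sphere_uniform :: (real^'n^'m) measure). ?P x"
      unfolding law[OF T0] by (auto dest: DU.AE_pair)
    then show ?thesis by simp
  qed
  interpret E: lqr_estimator A B Q R Dist Cm Kstar "10 * Delta0" phi0 rho0 gam M r delta b d Td mode
    by unfold_locales (use r0 r(2) d_def b tail in auto)
  have bG: "K1 \<in> G0" if "K1 \<in> S.sublevel b" for K1 using E.sublevel_b[OF that] by (simp add: G0S)
  interpret D: lqr_descent A B Q R Dist Cm Kstar "10 * Delta0" phi0 rho0 gam M r delta b d Td mode mu eps eta ginf g2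
  proof
    show "mu * (L.Jr K1 - L.Jr Kstar) \<le> (norm (gradient L.Jr K1))\<^sup>2" if "K1 \<in> stabilizing A B" for K1
      using mu(2)[of K1] that by (simp add: Jr Kst_def)
    show "AE z in E.noise. norm (E.estimate K1 z) \<le> ginf" if "K1 \<in> S.sublevel b" for K1
      using AE_estimate_sup[OF known(1) bG[OF that]] by (simp add: E.estimate_def)
    show "(\<integral>\<^sup>+z. ennreal ((norm (E.estimate K1 z - (\<integral>z. E.estimate K1 z \<partial>E.noise)))\<^sup>2) \<partial>E.noise) \<le> ennreal g2"
      if "K1 \<in> S.sublevel b" for K1
      using nn_integral_estimate_variance[OF known(2) bG[OF that]] by (simp add: E.estimate_def)
  qed (use mu(1) eps(1) eta0 params g2 step_length in auto)

  \<comment> \<open>The failure probability\<close>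
  have drift: "real Ts * (eta * mu) = 4 * ln u"
    using Ts(2) eta0 mu(1) by (simp add: u_def)
  have fail: "(S.gap K0 + real Ts * (eta * mu * eps / 100)) / b
      + (if b < eps then 0 else ((1 - eta * mu / 4) ^ Ts * S.gap K0 + eps / 20) / eps) \<le> 1 / 4"
  proof -
    have "real Ts * (eta * mu * eps / 100) = real Ts * (eta * mu) * eps / 100" by simp
    also have "\<dots> = 4 * (eps * ln u) / 100" by (simp add: drift)
    \<comment> \<open>The logarithmic condition gives \<open>eps * ln u < 12 * Delta0\<close>;
      adding the initial gap \<open>Delta0\<close> yields \<open>148/100\<close>.\<close>
    also have "\<dots> \<le> 48 / 100 * Delta0" using eps(2) by (simp add: u_def)
    finally have "(S.gap K0 + real Ts * (eta * mu * eps / 100)) / b \<le> (148 / 100 * Delta0) / b"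
      using b(1) by (intro divide_right_mono) (auto simp: gapK0)
    also have "\<dots> = 148 / 100 / s\<^sup>2" using Delta0_pos by (simp add: b_def)
    finally have 1: "(S.gap K0 + real Ts * (eta * mu * eps / 100)) / b \<le> 148 / 100 / s\<^sup>2" .
    show ?thesis
    proof (cases "25 \<le> u")
      case True
      \<comment> \<open>The iteration number is chosen so that the contraction over the whole run is
        at most \<open>1 / u\<close>, which shrinks \<open>Delta0\<close> to
        \<open>eps / 120\<close>.\<close>
      have "(1 - eta * mu / 4) ^ Ts \<le> exp (- (real Ts * (eta * mu / 4)))"
        using params(5) by (intro one_minus_power_le_exp) simp
      also have "real Ts * (eta * mu / 4) = ln u" using drift by simp
      also have "exp (- ln u) = 1 / u" using u(1) by (simp add: exp_minus field_simps)
      finally have "(1 - eta * mu / 4) ^ Ts * Delta0 \<le> 1 / u * Delta0" using Delta0_pos by (intro mult_right_mono) auto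
      also have "\<dots> = eps / 120" by (simp add: eps_u)
      finally have "((1 - eta * mu / 4) ^ Ts * S.gap K0 + eps / 20) / eps \<le> (eps / 120 + eps / 20) / eps"
        using eps(1) by (intro divide_right_mono) (auto simp: gapK0)
      also have "\<dots> = 7 / 120" using eps(1) by (simp add: field_simps)
      finally have "(if b < eps then 0 else ((1 - eta * mu / 4) ^ Ts * S.gap K0 + eps / 20) / eps) \<le> 7 / 120"
        by simp
      moreover have "148 / 100 / s\<^sup>2 = 148 / 900" using True by (simp add: s_def)
      ultimately show ?thesis using 1 by linarith
    next
      case False
      then have "u \<le> 6 / 5" using ln_less_tenth[OF u] by blast
      \<comment> \<open>\<open>eps\<close> is \<open>120 * Delta0 / u\<close>, far above the level
        \<open>b\<close>, which is about \<open>6 * Delta0\<close> here.\<close>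
      then have "100 * Delta0 \<le> eps" using u(1) Delta0_pos by (simp add: eps_u field_simps)
      then have "b < eps" using False Delta0_pos by (simp add: b_def s_def power2_eq_square)
      then have "(if b < eps then 0 else ((1 - eta * mu / 4) ^ Ts * S.gap K0 + eps / 20) / eps) = 0"
        by (simp only: if_True)
      moreover have "148 / 100 / s\<^sup>2 \<le> 1 / 4" using False by (simp add: s_def power2_eq_square)
      ultimately show ?thesis using 1 by linarith
    qed
  qed
  have "1 - 1 / 4 \<le> measure Pr {\<omega> \<in> space Pr. K Ts \<omega> \<in> stabilizing A B \<and> S.gap (K Ts \<omega>) < eps}"
  proof (rule D.success_probability[where X=X and U=U and ?K0.0=K0 and K=K and T=Ts and p="1/4", OF Pr _ b(1) law indep _ init _ fail])
    show "K0 \<in> stabilizing A B" using K0 Kst_def by simp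
    show "K Ts \<in> borel_measurable Pr" by (rule meas) simp
    show "K (Suc s) \<omega> = K s \<omega> - eta *\<^sub>R E.estimate_trunc (K s \<omega>) (X s \<omega>, U s \<omega>)"
      if "\<omega> \<in> space Pr" "s < Ts"
        "\<And>t. t \<le> s \<Longrightarrow> queried_costs_finite mode (lqr_cost_from A B Q R) r (K t \<omega>) (U t \<omega>) (X t \<omega>)" for \<omega> s
      using step[OF that(1,2)] that(3) by (simp add: Jx_def E.estimate_trunc_def scaleR_diff_right)
  qed
  also have "{\<omega> \<in> space Pr. K Ts \<omega> \<in> stabilizing A B \<and> S.gap (K Ts \<omega>) < eps}
      = {\<omega> \<in> space Pr. J (K Ts \<omega>) - J Kstar < ereal eps}"
  proof -
    \<comment> \<open>A gain that is not stabilizing has infinite cost, so the extended-real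
      inequality already excludes it.\<close>
    have "K1 \<in> stabilizing A B \<and> S.gap K1 < eps \<longleftrightarrow> J K1 - J Kstar < ereal eps" for K1
      using JK[of K1] JK'[of K1] JK[OF Kstar(1)]
      by (cases "K1 \<in> Kst") (auto simp: S.gap_def Jr Kst_def)
    then show ?thesis by simp
  qed
  finally show ?thesis by simp
qed

end
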